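(* There is a function $C:[0,\infty)\to(0,\infty)$ such that for every orientation-preserving homeomorphism $h$ of $\widehat{\mathbb{R}}=\mathbb{R}\cup\{\infty\}$ with induced shear function $s:\mathcal{F}\to\mathbb{R}$ of finite shear norm $M_s<\infty$, one has $$K(ex(h))<C(M_s);$$ that is, the maximal dilatation of the Douady–Earle extension of $h$ is bounded above by a positive constant depending only on the shear norm of $h$.
   Context: **Cross ratio.** For four distinct points in counterclockwise order on $\widehat{\mathbb{R}}=\partial\mathbb{H}$ ($\mathbb{H}$ the upper half plane), $cr(\{a,b,c,d\})=\frac{(b-a)(d-c)}{(c-b)(d-a)}$ (by continuity if a point is $\infty$). **Farey tesselation and shear functions.** Let $\Delta_0\subset\mathbb{H}$ be the ideal triangle with vertices $0,1,\infty$ and $\Gamma$ the group generated by the hyperbolic reflections in its sides. The Farey tesselation $\mathcal{F}$ is the set of geodesics in the $\Gamma$-orbits of the sides of $\Delta_0$; the set of endpoints of its geodesics is $\mathcal{P}=\mathbb{Q}\cup\{\infty\}$. For $e\in\mathcal{F}$ with endpoints $a,c$, let $b,d$ be the third vertices of the two triangles of $\mathcal{F}$ adjacent along $e$, labelled so that $a,b,c,d$ are in counterclockwise order; the shear function induced by $h$ is $s(e)=\log cr(\{h(a),h(b),h(c),h(d)\})$. **Fans and shear norm.** For $p\in\mathcal{P}$, the fan of edges of $\mathcal{F}$ with endpoint $p$ is indexed as $\{e^p_n\}_{n\in\mathbb{Z}}$ according to the order in which the edges meet a horocycle at $p$ oriented so that its horoball lies on its left (the indexing is unique up to translation; for $p=\infty$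 one may take $e_n^\infty$ to be the geodesic from $n$ to $\infty$). With $s_n^p=s(e_n^p)$, for $m\in\mathbb{Z}$ and integers $k\ge0$ put $$s(p;m,k)=e^{s_m^p}\,\frac{1+e^{s_{m+1}^p}+e^{s_{m+1}^p+s_{m+2}^p}+\cdots+e^{s_{m+1}^p+\cdots+s_{m+k}^p}}{1+e^{-s_{m-1}^p}+e^{-(s_{m-1}^p+s_{m-2}^p)}+\cdots+e^{-(s_{m-1}^p+\cdots+s_{m-k}^p)}}.$$ The shear norm is $M_s=\sup_{p\in\mathcal{P}}\sup_{m,k}|\log s(p;m,k)|$. **Douady–Earle extension.** For an orientation-preserving homeomorphism $g$ of $\mathbb{S}^1$ and $z\in\mathbb{D}$ (open unit disk), $ex(g)(z)$ is the unique $w\in\mathbb{D}$ with $$\frac1{2\pi}\int_{\mathbb{S}^1}\frac{g(\xi)-w}{1-\bar w g(\xi)}\cdot\frac{1-|z|^2}{|z-\xi|^2}\,|d\xi|=0 .$$ It is a real-analytic diffeomorphism of $\mathbb{D}$ extending $g$. For a homeomorphism $h$ of $\widehat{\mathbb{R}}$, $ex(h)=A^{-1}\circ ex(A\circ h\circ A^{-1})\circ A:\mathbb{H}\to\mathbb{H}$ with $A(z)=-\frac{z-i}{z+i}$. $K(f)=\sup\frac{1+|\mu_f|}{1-|\mu_f|}$ is the maximal dilatation of $f$, $\mu_f$ its Beltrami coefficient. *)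

theory Defs
  imports "HOL-Analysis.Analysis"
begin

section \<open>The extended real line\<close>

text \<open>The boundary of the upper half plane is the one-point compactification of the real line;
  \<open>None\<close> is the point at infinity.\<close>

type_synonym rhat = "real option"

definition UHP :: "complex set" where
  "UHP = {z. 0 < Im z}"

fun ccw :: "rhat \<Rightarrow> rhat \<Rightarrow> rhat \<Rightarrow> bool" where
  "ccw (Some x) (Some y) (Some z) \<longleftrightarrow> x < y \<and> y < z \<or> y < z \<and> z < x \<or> z < x \<and> x < y"
| "ccw None (Some y) (Some z) \<longleftrightarrow> y < z"
| "ccw (Some x) None (Some z) \<longleftrightarrow> z < x"
| "ccw (Some x) (Some y) None \<longleftrightarrow> x < y"
| "ccw _ _ _ \<longleftrightarrow> False"

definition ccw4 :: "rhat \<Rightarrow> rhat \<Rightarrow> rhat \<Rightarrow> rhat \<Rightarrow> bool" where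
  "ccw4 a b c d \<longleftrightarrow> ccw a b c \<and> ccw b c d \<and> ccw c d a \<and> ccw d a b"

definition orientation_preserving_homeo :: "(rhat \<Rightarrow> rhat) \<Rightarrow> bool" where
  "orientation_preserving_homeo h \<longleftrightarrow>
     homeomorphic_map (Alexandroff_compactification euclideanreal)
       (Alexandroff_compactification euclideanreal) h \<and>
     (\<forall>a b c. ccw a b c \<longrightarrow> ccw (h a) (h b) (h c))"

text \<open>The cases with a point at infinity are the limits of the first formula. The value for two or
  more points at infinity is irrelevant.\<close>

fun cross_ratio :: "rhat \<Rightarrow> rhat \<Rightarrow> rhat \<Rightarrow> rhat \<Rightarrow> real" where
  "cross_ratio (Some a) (Some b) (Some c) (Some d) = ((b - a) * (d - c)) / ((c - b) * (d - a))"
| "cross_ratio None (Some b) (Some c) (Some d) = (d - c) / (c - b)"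
| "cross_ratio (Some a) None (Some c) (Some d) = - ((d - c) / (d - a))"
| "cross_ratio (Some a) (Some b) None (Some d) = - ((b - a) / (d - a))"
| "cross_ratio (Some a) (Some b) (Some c) None = (b - a) / (c - b)"
| "cross_ratio _ _ _ _ = 0"

section \<open>The Farey tesselation\<close>

text \<open>The geodesic of the upper half plane with the given endpoints; it is empty if the two points
  coincide.\<close>

fun geod :: "rhat \<Rightarrow> rhat \<Rightarrow> complex set" where
  "geod (Some x) (Some y) =
     {z \<in> UHP. cmod (z - complex_of_real ((x + y) / 2)) = \<bar>x - y\<bar> / 2}"
| "geod (Some x) None = {z \<in> UHP. Re z = x}"
| "geod None (Some x) = {z \<in> UHP. Re z = x}"
| "geod None None = {}"

text \<open>The hyperbolic reflection in the geodesic with the given (distinct) endpoints: a Euclidean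
  reflection or the inversion in a circle orthogonal to the real line. Only its values on the upper
  half plane are used.\<close>

fun hyp_reflection :: "rhat \<Rightarrow> rhat \<Rightarrow> complex \<Rightarrow> complex" where
  "hyp_reflection (Some x) (Some y) z =
     complex_of_real ((x + y) / 2)
       + complex_of_real (((x - y) / 2)\<^sup>2) / (cnj z - complex_of_real ((x + y) / 2))"
| "hyp_reflection (Some x) None z = complex_of_real (2 * x) - cnj z"
| "hyp_reflection None (Some x) z = complex_of_real (2 * x) - cnj z"
| "hyp_reflection None None z = z"

text \<open>As reflections are involutions, closing under composition with the three generators yields
  the whole group acting on the upper half plane.\<close>

inductive_set farey_group :: "(complex \<Rightarrow> complex) set" where
  id: "id \<in> farey_group"
| refl_0_1: "g \<in> farey_group \<Longrightarrow> hyp_reflection (Some 0) (Some 1) \<circ> g \<in> farey_group"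
| refl_1_inf: "g \<in> farey_group \<Longrightarrow> hyp_reflection (Some 1) None \<circ> g \<in> farey_group"
| refl_0_inf: "g \<in> farey_group \<Longrightarrow> hyp_reflection (Some 0) None \<circ> g \<in> farey_group"

definition base_sides :: "complex set set" where
  "base_sides = {geod (Some 0) (Some 1), geod (Some 1) None, geod (Some 0) None}"

definition farey :: "complex set set" where
  "farey = {g ` e | g e. g \<in> farey_group \<and> e \<in> base_sides}"

definition farey_points :: "rhat set" where
  "farey_points = {p. \<exists>q. geod p q \<in> farey}"

text \<open>A triangle of the tesselation is an image of the base triangle under the group; it is
  determined by its three sides.\<close>

definition farey_triangle :: "rhat \<Rightarrow> rhat \<Rightarrow> rhat \<Rightarrow> bool" where
  "farey_triangle a b c \<longleftrightarrow>
     (\<exists>g \<in> farey_group. {geod a b, geod b c, geod a c} = (\<lambda>e. g ` e) ` base_sides)"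

section \<open>Shears and the shear norm\<close>

text \<open>The two admissible labellings of the endpoints of an edge, \<open>(a, b, c, d)\<close> and
  \<open>(c, d, a, b)\<close>, give the same cross ratio, so the value below is unique for an edge of the
  tesselation.\<close>

definition shear :: "(rhat \<Rightarrow> rhat) \<Rightarrow> complex set \<Rightarrow> real" where
  "shear h e = (THE t. \<exists>a b c d. e = geod a c \<and> ccw4 a b c d \<and>
     farey_triangle a b c \<and> farey_triangle a c d \<and>
     t = ln (cross_ratio (h a) (h b) (h c) (h d)))"

text \<open>A horocycle at \<open>p\<close>, parametrised so that its horoball lies on the left: a horizontal line
  traversed to the right for \<open>p = \<infinity>\<close>, and its image under the hyperbolic isometry
  \<open>z \<mapsto> x - 1 / z\<close>, which maps \<open>\<infinity>\<close> to \<open>x\<close>, for a real point \<open>x\<close>.\<close>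

fun horocycle :: "rhat \<Rightarrow> real \<Rightarrow> complex" where
  "horocycle None t = Complex t 1"
| "horocycle (Some x) t = complex_of_real x - 1 / Complex t 1"

definition is_fan :: "rhat \<Rightarrow> (int \<Rightarrow> complex set) \<Rightarrow> bool" where
  "is_fan p e \<longleftrightarrow> bij_betw e UNIV {l \<in> farey. \<exists>q. l = geod p q} \<and>
     (\<exists>\<tau>. strict_mono \<tau> \<and> (\<forall>n. horocycle p (\<tau> n) \<in> e n))"

definition fan_ratio :: "(int \<Rightarrow> real) \<Rightarrow> int \<Rightarrow> nat \<Rightarrow> real" where
  "fan_ratio s m k =
     exp (s m) * (\<Sum>j\<le>k. exp (\<Sum>i=1..j. s (m + int i)))
               / (\<Sum>j\<le>k. exp (- (\<Sum>i=1..j. s (m - int i))))"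

text \<open>The indexing of a fan is unique up to a translation, which is absorbed by the supremum over
  \<open>m\<close>; hence the supremum over all admissible indexings is the one over any particular choice.\<close>

definition shear_norm :: "(complex set \<Rightarrow> real) \<Rightarrow> ereal" where
  "shear_norm s =
     (SUP p \<in> farey_points. SUP e \<in> {e. is_fan p e}. SUP m. SUP k.
        ereal \<bar>ln (fan_ratio (\<lambda>n. s (e n)) m k)\<bar>)"

section \<open>The Douady-Earle extension\<close>

definition de_disk :: "(complex \<Rightarrow> complex) \<Rightarrow> complex \<Rightarrow> complex" where
  "de_disk g z = (THE w. w \<in> ball 0 1 \<and>
     1 / (2 * pi) * integral {0..2 * pi}
       (\<lambda>t. (g (cis t) - w) / (1 - cnj w * g (cis t))
             * complex_of_real ((1 - (cmod z)\<^sup>2) / (cmod (z - cis t))\<^sup>2)) = 0)"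

definition cayley :: "complex \<Rightarrow> complex" where
  "cayley z = - ((z - \<i>) / (z + \<i>))"

fun cayley_bdry :: "rhat \<Rightarrow> complex" where
  "cayley_bdry (Some x) = cayley (complex_of_real x)"
| "cayley_bdry None = - 1"

text \<open>\<open>cayley\<close> is a bijection from the upper half plane onto the open unit disk, and \<open>cayley_bdry\<close>,
  its boundary extension, one from the extended real line onto the unit circle.\<close>

definition de_ext :: "(rhat \<Rightarrow> rhat) \<Rightarrow> complex \<Rightarrow> complex" where
  "de_ext h = inv_into UHP cayley \<circ> de_disk (cayley_bdry \<circ> h \<circ> inv cayley_bdry) \<circ> cayley"

section \<open>Maximal dilatation\<close>

definition d_z :: "(complex \<Rightarrow> complex) \<Rightarrow> complex \<Rightarrow> complex" where
  "d_z f z = (frechet_derivative f (at z) 1 - \<i> * frechet_derivative f (at z) \<i>) / 2"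

definition d_zbar :: "(complex \<Rightarrow> complex) \<Rightarrow> complex \<Rightarrow> complex" where
  "d_zbar f z = (frechet_derivative f (at z) 1 + \<i> * frechet_derivative f (at z) \<i>) / 2"

definition beltrami :: "(complex \<Rightarrow> complex) \<Rightarrow> complex \<Rightarrow> complex" where
  "beltrami f z = d_zbar f z / d_z f z"

text \<open>The maximal dilatation of a map of the upper half plane, intended for orientation-preserving
  diffeomorphisms. A point where the map is not real differentiable with positive Jacobian
  determinant counts as infinite dilatation, so that values such as \<open>x / 0 = 0\<close> cannot make the
  supremum artificially small.\<close>

definition max_dilatation :: "(complex \<Rightarrow> complex) \<Rightarrow> ereal" where
  "max_dilatation f =
     (SUP z \<in> UHP.
        if f differentiable (at z) \<and> cmod (d_zbar f z) < cmod (d_z f z)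
        then ereal ((1 + cmod (beltrami f z)) / (1 - cmod (beltrami f z)))
        else \<infinity>)"

end

theory Submission
  imports Defs
begin

text \<open>By conformal naturality the dilatation of the extension at \<open>z\<close> can be computed after \<open>z\<close> and its
  image have been moved to the origin of the disk. The boundary map \<open>g\<close> then has mean zero, and the
  implicit function defining the extension linearises to an expression in the means \<open>b\<close>, \<open>c1\<close>, \<open>c2\<close>
  of \<open>g\<^sup>2\<close>, \<open>cnj \<xi> * g \<xi>\<close> and \<open>\<xi> * g \<xi>\<close>. The dilatation is at most \<open>16\<close> divided by
  \<open>(1 - \<bar>b\<bar>\<^sup>2) * (\<bar>c1\<bar>\<^sup>2 - \<bar>c2\<bar>\<^sup>2)\<close>. Following Douady and Earle, the second factor is a mean of areas of
  quadrilaterals inscribed in the circle; both factors are bounded below as soon as \<open>g\<close> maps points at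
  distance at least \<open>6/5\<close> to points at distance at least \<open>\<delta>\<close>.

  To find such a \<open>\<delta>\<close>, move \<open>z\<close> by the modular group to a point with imaginary part at least
  \<open>\<surd>3 / 2\<close>. Depending on the height of the point, the multiples of a suitable integer or the quarter
  integers form a lattice which, seen from \<open>z\<close>, is fine but not too fine. In the first case the bound on
  the fan at infinity, in the second case in addition the bounds on the shears of finitely many Farey
  edges show that the images of the lattice cells have comparable lengths. Since \<open>g\<close> has mean zero, its
  mass cannot concentrate near one point, so these images have a definite size on the circle.\<close>

section \<open>Automorphisms of the disk\<close>

text \<open>The shear norm controls \<open>h\<close> only along Farey fans: with the common endpoint
  at infinity it compares adjacent image intervals over equal numbers of integers, at integer scales
  only. So no quasisymmetry constant for all scales is derived; the dilatation at one point needs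
  only a coarse separation of the recentred map, and for this a single lattice seen from that point
  suffices. Since the imaginary part is at least sqrt 3 / 2, no mesh finer than 1/4 is ever needed,
  and the window always has the same number of cells, so the comparison constants depend on the
  shear norm alone. The distance 6/5 fits two purposes: it is below sqrt 2, so quarter turns count
  as separated, and points within 6/5 of a given point lie in an arc carrying less than half of the
  mass. The factor \<open>1 - |b|^2\<close> is the determinant of the real-linear map
  \<open>w - b * cnj w\<close>, and \<open>|c1|^2 - |c2|^2\<close> is the Jacobian at the origin of
  the harmonic extension of \<open>g\<close>. Mean zero acts twice: it removes the constant term of
  the linearisation and it prevents the image mass from concentrating.\<close>

definition disk_mob :: "complex \<Rightarrow> complex \<Rightarrow> complex" where
  "disk_mob a z = (z - a) / (1 - cnj a * z)"

definition poisson :: "complex \<Rightarrow> complex \<Rightarrow> real" where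
  "poisson z \<zeta> = (1 - (cmod z)\<^sup>2) / (cmod (z - \<zeta>))\<^sup>2"

definition circ_int :: "(complex \<Rightarrow> 'a::euclidean_space) \<Rightarrow> 'a" where
  "circ_int f = integral {0..2 * pi} (\<lambda>t. f (cis t))"

text \<open>Twice the signed area of the triangle \<open>p q r\<close>. For points of the circle its
  sign gives the cyclic order, so orientation becomes a quantity that can be estimated.\<close>

definition orient :: "complex \<Rightarrow> complex \<Rightarrow> complex \<Rightarrow> real" where
  "orient p q r = Im (q * cnj p + r * cnj q + p * cnj r)"

lemma unit_mult_cnj: "cmod \<zeta> = 1 \<Longrightarrow> \<zeta> * cnj \<zeta> = 1"
  by (metis complex_norm_square of_real_1 one_power2)

lemma unit_cnj: "cmod \<zeta> = 1 \<Longrightarrow> cnj \<zeta> = 1 / \<zeta>"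
  by (metis unit_mult_cnj nonzero_mult_div_cancel_left norm_zero zero_neq_one)

lemma disk_mob_denom_nonzero:
  assumes "cmod a < 1" "cmod z \<le> 1"
  shows "1 - cnj a * z \<noteq> 0"
proof
  assume "1 - cnj a * z = 0"
  then have "cmod (cnj a * z) = 1" by (metis eq_iff_diff_eq_0 norm_one)
  moreover have "cmod a * cmod z \<le> cmod a * 1" using assms by (intro mult_left_mono) auto
  ultimately show False using assms by (simp add: norm_mult)
qed

lemma cmod_disk_mob_denom:
  assumes "cmod \<zeta> = 1"
  shows "cmod (1 - cnj a * \<zeta>) = cmod (\<zeta> - a)"
proof -
  have "1 - cnj a * \<zeta> = \<zeta> * cnj (\<zeta> - a)"
    using unit_mult_cnj[OF assms] by (simp add: algebra_simps)
  then show ?thesis using assms by (metis complex_mod_cnj mult_1 norm_mult)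
qed

lemma disk_mob_diff:
  assumes "1 - cnj a * p \<noteq> 0" "1 - cnj a * q \<noteq> 0"
  shows "disk_mob a p - disk_mob a q =
    of_real (1 - (cmod a)\<^sup>2) * (p - q) / ((1 - cnj a * p) * (1 - cnj a * q))"
  using assms unfolding disk_mob_def of_real_diff of_real_1 complex_norm_square
  by (simp add: divide_simps) (simp add: algebra_simps)

lemma disk_mob_norm:
  assumes "1 - cnj a * z \<noteq> 0"
  shows "1 - (cmod (disk_mob a z))\<^sup>2 = (1 - (cmod a)\<^sup>2) * (1 - (cmod z)\<^sup>2) / (cmod (1 - cnj a * z))\<^sup>2"
proof -
  have n: "1 - a * cnj z \<noteq> 0"
    using assms by (metis complex_cnj_cnj complex_cnj_diff complex_cnj_mult complex_cnj_one complex_cnj_zero mult.commute)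
  have "complex_of_real (1 - (cmod (disk_mob a z))\<^sup>2) =
    of_real ((1 - (cmod a)\<^sup>2) * (1 - (cmod z)\<^sup>2) / (cmod (1 - cnj a * z))\<^sup>2)"
    unfolding of_real_diff of_real_mult of_real_divide complex_norm_square disk_mob_def of_real_1
    using assms n by (simp add: divide_simps) (simp add: algebra_simps)
  then show ?thesis using of_real_eq_iff by blast
qed

lemma disk_mob_unit:
  assumes "cmod a < 1" "cmod \<zeta> = 1"
  shows "cmod (disk_mob a \<zeta>) = 1"
proof -
  have "(cmod (disk_mob a \<zeta>))\<^sup>2 = 1"
    using disk_mob_norm[of a \<zeta>] disk_mob_denom_nonzero[of a \<zeta>] assms by simp
  then show ?thesis by (simp add: power2_eq_1_iff)  (smt (verit) norm_ge_zero)
qed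

lemma disk_mob_ball:
  assumes "cmod a < 1" "cmod z < 1"
  shows "cmod (disk_mob a z) < 1"
proof -
  have n: "1 - cnj a * z \<noteq> 0" using disk_mob_denom_nonzero assms by simp
  have "(cmod a)\<^sup>2 < 1" "(cmod z)\<^sup>2 < 1" using assms by (simp_all add: power_less_one_iff abs_square_less_1)
  then have "1 - (cmod (disk_mob a z))\<^sup>2 > 0"
    unfolding disk_mob_norm[OF n] using n by (simp add: zero_less_divide_iff)
  then show ?thesis by (simp add: abs_square_less_1)
qed

lemma disk_mob_inverse:
  assumes "cmod a < 1" "cmod z \<le> 1"
  shows "disk_mob (- a) (disk_mob a z) = z"
proof -
  have n: "1 - cnj a * z \<noteq> 0" using disk_mob_denom_nonzero assms by simp
  have "a * cnj a \<noteq> 1" using assms(1)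
    by (metis complex_mod_mult_cnj complex_norm_square norm_one less_irrefl mult.right_neutral norm_power one_power2 power_less_one_iff norm_ge_zero pos2)
  then have n2: "1 - cnj a * a \<noteq> 0" by (simp add: mult.commute)
  have "disk_mob (- a) (disk_mob a z) = ((z - a) + a * (1 - cnj a * z)) / ((1 - cnj a * z) + cnj a * (z - a))"
    using n unfolding disk_mob_def by (simp add: divide_simps)
  also have "\<dots> = (z * (1 - cnj a * a)) / (1 - cnj a * a)" by (simp add: algebra_simps)
  finally show ?thesis using n2 by simp
qed

lemma disk_mob_inverse':
  assumes "cmod a < 1" "cmod z \<le> 1"
  shows "disk_mob a (disk_mob (- a) z) = z"
  using disk_mob_inverse[of "- a" z] assms by simp

lemma disk_mob_self [simp]: "disk_mob a a = 0"
  by (simp add: disk_mob_def)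

lemma disk_mob_0 [simp]: "disk_mob 0 z = z"
  by (simp add: disk_mob_def)

lemma continuous_on_disk_mob: "cmod a < 1 \<Longrightarrow> continuous_on (cball 0 1) (disk_mob a)"
  unfolding disk_mob_def by (intro continuous_intros) (use disk_mob_denom_nonzero in auto)

lemma disk_mob_has_field_derivative:
  assumes "1 - cnj a * z \<noteq> 0"
  shows "(disk_mob a has_field_derivative of_real (1 - (cmod a)\<^sup>2) / (1 - cnj a * z)\<^sup>2) (at z)"
proof -
  have "(disk_mob a has_field_derivative
      ((1 * (1 - cnj a * z) - (z - a) * (- cnj a)) / ((1 - cnj a * z) * (1 - cnj a * z)))) (at z)"
    unfolding disk_mob_def
    by (rule derivative_eq_intros refl | use assms in simp)+
  moreover have "1 * (1 - cnj a * z) - (z - a) * (- cnj a) = of_real (1 - (cmod a)\<^sup>2)"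
    unfolding of_real_diff of_real_1 complex_norm_square by (simp add: algebra_simps)
  ultimately show ?thesis unfolding power2_eq_square[of "1 - cnj a * z"] by (simp only:)
qed

text \<open>Both sides are automorphisms of the disk in \<open>\<zeta>\<close> that vanish at
  \<open>w\<close>, hence agree up to a rotation. The factor does not depend on
  \<open>\<zeta>\<close> and can be pulled out of the barycentre integral.\<close>

lemma disk_mob_chain:
  assumes "cmod a < 1" "cmod w < 1" "cmod \<zeta> \<le> 1"
  shows "disk_mob (disk_mob a w) (disk_mob a \<zeta>) = (1 - a * cnj w) / (1 - cnj a * w) * disk_mob w \<zeta>"
proof -
  have n: "1 - cnj a * w \<noteq> 0" "1 - cnj a * \<zeta> \<noteq> 0" "1 - cnj w * \<zeta> \<noteq> 0" "1 - a * cnj w \<noteq> 0"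
    using disk_mob_denom_nonzero[of a w] disk_mob_denom_nonzero[of a \<zeta>] disk_mob_denom_nonzero[of w \<zeta>]
      disk_mob_denom_nonzero[of w a] assms by (auto simp: mult.commute)
  have k: "1 - cnj a * a \<noteq> 0" using disk_mob_denom_nonzero[of a a] assms by auto
  have "1 - cnj (disk_mob a w) * disk_mob a \<zeta> = (1 - cnj a * a) * (1 - cnj w * \<zeta>) / ((1 - a * cnj w) * (1 - cnj a * \<zeta>))"
    unfolding disk_mob_def using n by (simp add: divide_simps) (simp add: algebra_simps)
  moreover have "disk_mob a \<zeta> - disk_mob a w = (1 - cnj a * a) * (\<zeta> - w) / ((1 - cnj a * \<zeta>) * (1 - cnj a * w))"
    unfolding disk_mob_def using n by (simp add: divide_simps) (simp add: algebra_simps)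
  ultimately have "disk_mob (disk_mob a w) (disk_mob a \<zeta>) =
     ((1 - cnj a * a) * (\<zeta> - w) / ((1 - cnj a * \<zeta>) * (1 - cnj a * w))) / ((1 - cnj a * a) * (1 - cnj w * \<zeta>) / ((1 - a * cnj w) * (1 - cnj a * \<zeta>)))"
    unfolding disk_mob_def[of "disk_mob a w"] by simp
  also have "\<dots> = (1 - a * cnj w) / (1 - cnj a * w) * ((\<zeta> - w) / (1 - cnj w * \<zeta>))"
    using n k by (simp add: divide_simps)
  finally show ?thesis by (simp add: disk_mob_def)
qed

text \<open>\<open>poisson a\<close> is the Jacobian of \<open>disk_mob a\<close> on the circle, so
  this is the transformation rule of harmonic measure.\<close>

lemma poisson_disk_mob:
  assumes "cmod a < 1" "cmod z < 1" "cmod \<zeta> = 1"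
  shows "poisson (disk_mob a z) (disk_mob a \<zeta>) * poisson a \<zeta> = poisson z \<zeta>"
proof -
  have n: "1 - cnj a * z \<noteq> 0" "1 - cnj a * \<zeta> \<noteq> 0" using disk_mob_denom_nonzero assms by auto
  have a2: "(cmod a)\<^sup>2 < 1" using assms by (simp add: abs_square_less_1)
  have ne: "\<zeta> \<noteq> a" "\<zeta> \<noteq> z" using assms by auto
  define A where "A = 1 - (cmod a)\<^sup>2"
  have A: "A > 0" using a2 by (simp add: A_def)
  have e1: "1 - (cmod (disk_mob a z))\<^sup>2 = A * (1 - (cmod z)\<^sup>2) / (cmod (1 - cnj a * z))\<^sup>2"
    using disk_mob_norm[OF n(1)] by (simp add: A_def)
  have e2: "cmod (disk_mob a z - disk_mob a \<zeta>) = A * cmod (z - \<zeta>) / (cmod (1 - cnj a * z) * cmod (1 - cnj a * \<zeta>))"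
    unfolding disk_mob_diff[OF n] norm_divide norm_mult A_def[symmetric] using A by simp
  have e3: "cmod (a - \<zeta>) = cmod (1 - cnj a * \<zeta>)"
    using cmod_disk_mob_denom[OF assms(3), of a] by (simp add: norm_minus_commute)
  show ?thesis unfolding poisson_def e1 e2 e3 A_def[symmetric]
    using A n ne by (simp add: divide_simps power2_eq_square)
qed

text \<open>Conjugation on the circle is inversion, which turns the area into an alternating
  rational function that factors into the differences. Taking moduli gives the classical formula:
  area is the product of the sides over four times the circumradius.\<close>

lemma orient_eq:
  assumes "cmod p = 1" "cmod q = 1" "cmod r = 1"
  shows "of_real (orient p q r) * (2 * \<i>) = - ((p - q) * (q - r) * (r - p)) / (p * q * r)"
proof -
  have ne: "p \<noteq> 0" "q \<noteq> 0" "r \<noteq> 0" using assms by auto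
  let ?s = "q * cnj p + r * cnj q + p * cnj r"
  have "of_real (orient p q r) * (2 * \<i>) = ?s - cnj ?s"
    unfolding orient_def by (metis complex_diff_cnj mult.assoc mult.commute of_real_mult of_real_numeral)
  also have "\<dots> = (q / p + r / q + p / r) - (p / q + q / r + r / p)"
    using assms by (simp add: unit_cnj)
  also have "\<dots> = - ((p - q) * (q - r) * (r - p)) / (p * q * r)"
    using ne by (simp add: divide_simps) (simp add: algebra_simps)
  finally show ?thesis .
qed

lemma abs_orient:
  assumes "cmod p = 1" "cmod q = 1" "cmod r = 1"
  shows "\<bar>orient p q r\<bar> = cmod (p - q) * cmod (q - r) * cmod (r - p) / 2"
proof -
  have "cmod (of_real (orient p q r) * (2 * \<i>)) = cmod (- ((p - q) * (q - r) * (r - p)) / (p * q * r))"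
    using orient_eq[OF assms] by simp
  then show ?thesis using assms by (simp add: norm_mult norm_divide)
qed

text \<open>By \<open>disk_mob_diff\<close> each side picks up the factors of its two endpoints. The
  total factor is positive, and so the cyclic order survives.\<close>

lemma orient_disk_mob:
  assumes a: "cmod a < 1" and u: "cmod p = 1" "cmod q = 1" "cmod r = 1"
  shows "orient (disk_mob a p) (disk_mob a q) (disk_mob a r) =
    orient p q r * ((1 - (cmod a)\<^sup>2) ^ 3 / ((cmod (1 - cnj a * p))\<^sup>2 * (cmod (1 - cnj a * q))\<^sup>2 * (cmod (1 - cnj a * r))\<^sup>2))"
proof -
  have n: "1 - cnj a * p \<noteq> 0" "1 - cnj a * q \<noteq> 0" "1 - cnj a * r \<noteq> 0"
    using disk_mob_denom_nonzero[OF a] u by auto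
  have ne: "p \<noteq> 0" "q \<noteq> 0" "r \<noteq> 0" using u by auto
  have n': "1 - a / p \<noteq> 0" "1 - a / q \<noteq> 0" "1 - a / r \<noteq> 0" using a u by auto
  have m: "disk_mob a x = x * (1 - a / x) / (1 - cnj a * x)" if "x \<noteq> 0" for x
    using that unfolding disk_mob_def by (simp add: algebra_simps)
  define A where "A = complex_of_real (1 - (cmod a)\<^sup>2)"
  have sq: "complex_of_real ((cmod (1 - cnj a * x))\<^sup>2) = (1 - cnj a * x) * (1 - a / x)" if "cmod x = 1" for x
    unfolding of_real_power using complex_norm_square[of "1 - cnj a * x"] unit_cnj[OF that] by simp
  have "of_real (orient (disk_mob a p) (disk_mob a q) (disk_mob a r)) * (2 * \<i>) =
     - ((disk_mob a p - disk_mob a q) * (disk_mob a q - disk_mob a r) * (disk_mob a r - disk_mob a p)) /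
      (disk_mob a p * disk_mob a q * disk_mob a r)"
    using orient_eq disk_mob_unit a u by auto
  also have "\<dots> = (- ((p - q) * (q - r) * (r - p)) / (p * q * r)) *
      (A ^ 3 / (((1 - cnj a * p) * (1 - a / p)) * ((1 - cnj a * q) * (1 - a / q)) * ((1 - cnj a * r) * (1 - a / r))))"
  proof -
    have gen: "- ((A * d1 / (P * Q)) * (A * d2 / (Q * R)) * (A * d3 / (R * P))) / ((p * P' / P) * (q * Q' / Q) * (r * R' / R))
       = - (d1 * d2 * d3) / (p * q * r) * (A ^ 3 / ((P * P') * (Q * Q') * (R * R')))"
      if "P \<noteq> 0" "Q \<noteq> 0" "R \<noteq> 0" "P' \<noteq> 0" "Q' \<noteq> 0" "R' \<noteq> 0" for d1 d2 d3 P Q R P' Q' R'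
      using that ne by (simp add: divide_simps power3_eq_cube)
    show ?thesis
      unfolding disk_mob_diff[OF n(1) n(2)] disk_mob_diff[OF n(2) n(3)] disk_mob_diff[OF n(3) n(1)]
      unfolding m[OF ne(1)] m[OF ne(2)] m[OF ne(3)] A_def[symmetric]
      by (rule gen) (use n n' in auto)
  qed
  also have "\<dots> = of_real (orient p q r * ((1 - (cmod a)\<^sup>2) ^ 3 / ((cmod (1 - cnj a * p))\<^sup>2 * (cmod (1 - cnj a * q))\<^sup>2 * (cmod (1 - cnj a * r))\<^sup>2))) * (2 * \<i>)"
    unfolding orient_eq[OF u, symmetric] of_real_mult of_real_divide sq[OF u(1)] sq[OF u(2)] sq[OF u(3)]
    by (simp add: A_def)
  finally show ?thesis
    by (metis (no_types, lifting) complex_i_not_zero mult_cancel_right mult_eq_0_iff of_real_eq_iff zero_neq_numeral)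
qed

lemma orient_disk_mob_pos_iff:
  assumes a: "cmod a < 1" and u: "cmod p = 1" "cmod q = 1" "cmod r = 1"
  shows "orient (disk_mob a p) (disk_mob a q) (disk_mob a r) > 0 \<longleftrightarrow> orient p q r > 0"
proof -
  have "1 - cnj a * p \<noteq> 0" "1 - cnj a * q \<noteq> 0" "1 - cnj a * r \<noteq> 0"
    using disk_mob_denom_nonzero[OF a] u by auto
  moreover have "(cmod a)\<^sup>2 < 1" using a by (simp add: abs_square_less_1)
  ultimately have "((1 - (cmod a)\<^sup>2) ^ 3 / ((cmod (1 - cnj a * p))\<^sup>2 * (cmod (1 - cnj a * q))\<^sup>2 * (cmod (1 - cnj a * r))\<^sup>2)) > 0"
    by simp
  then show ?thesis unfolding orient_disk_mob[OF assms] by (metis zero_less_mult_pos2 mult_pos_pos)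
qed

section \<open>Integration over the circle\<close>

lemma continuous_on_circle_cis:
  assumes "continuous_on (sphere 0 1) f"
  shows "continuous_on S (\<lambda>t. f (cis t))"
  by (rule continuous_on_compose2[OF assms]) (auto intro!: continuous_intros)

lemma integrable_circle_cis:
  fixes f :: "complex \<Rightarrow> 'a::euclidean_space"
  assumes "continuous_on (sphere 0 1) f"
  shows "(\<lambda>t. f (cis t)) integrable_on {a..b}"
  by (intro integrable_continuous_interval continuous_on_circle_cis assms)

lemma integral_circle_period:
  fixes f :: "complex \<Rightarrow> 'a::euclidean_space"
  assumes f: "continuous_on (sphere 0 1) f"
  shows "integral {a..a + 2 * pi} (\<lambda>t. f (cis t)) = circ_int f"
proof -
  let ?F = "\<lambda>t. f (cis t)"
  have sh: "integral {x + 2 * pi * of_int k..y + 2 * pi * of_int k} ?F = integral {x..y} ?F" for x y k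
  proof -
    have "integral {x..y} (?F \<circ> (\<lambda>t. t + 2 * pi * of_int k)) = integral {x + 2 * pi * of_int k..y + 2 * pi * of_int k} ?F"
      by (rule integral_shift) (rule continuous_on_circle_cis[OF f])
    moreover have "?F \<circ> (\<lambda>t. t + 2 * pi * of_int k) = ?F"
    proof
      fix t
      have "cis (2 * pi * real_of_int k) = 1" by (intro cis_multiple_2pi) auto
      then show "(?F \<circ> (\<lambda>t. t + 2 * pi * of_int k)) t = ?F t" by (simp flip: cis_mult)
    qed
    ultimately show ?thesis by simp
  qed
  define k where "k = \<lfloor>a / (2 * pi)\<rfloor>"
  define b where "b = a - 2 * pi * of_int k"
  have b: "0 \<le> b" "b \<le> 2 * pi"
  proof -
    have "of_int k \<le> a / (2 * pi)" "a / (2 * pi) \<le> of_int k + 1" unfolding k_def by linarith+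
    then show "0 \<le> b" "b \<le> 2 * pi" unfolding b_def using pi_gt_zero by (simp_all add: field_simps)
  qed
  have "integral {a..a + 2 * pi} ?F = integral {b..b + 2 * pi} ?F"
    using sh[of b k "b + 2 * pi"] by (simp add: b_def)
  also have "\<dots> = integral {b..2 * pi} ?F + integral {2 * pi..b + 2 * pi} ?F"
    using b by (intro Henstock_Kurzweil_Integration.integral_combine[symmetric] integrable_circle_cis f) auto
  also have "integral {2 * pi..b + 2 * pi} ?F = integral {0..b} ?F"
    using sh[of 0 1 b] by simp
  also have "integral {b..2 * pi} ?F + integral {0..b} ?F = integral {0..2 * pi} ?F"
    using b by (subst add.commute, intro Henstock_Kurzweil_Integration.integral_combine integrable_circle_cis f) auto
  finally show ?thesis by (simp add: circ_int_def)
qed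

lemma continuous_on_poisson:
  assumes "cmod z < 1"
  shows "continuous_on (sphere 0 1) (poisson z)"
  unfolding poisson_def by (intro continuous_intros) (use assms in auto)

text \<open>On the circle \<open>disk_mob z\<close> is \<open>cis t \<mapsto> cis (\<psi> t)\<close> with the lift
  \<open>\<psi> t = t - 2 arg (1 - cnj z * cis t)\<close>, whose derivative is the Poisson kernel.\<close>

lemma circ_int_disk_mob:
  fixes f :: "complex \<Rightarrow> 'a::euclidean_space"
  assumes f: "continuous_on (sphere 0 1) f" and z: "cmod z < 1"
  shows "circ_int (\<lambda>\<zeta>. poisson z \<zeta> *\<^sub>R f (disk_mob z \<zeta>)) = circ_int f"
proof -
  define u where "u t = 1 - cnj z * cis t" for t
  define \<psi> where "\<psi> t = t - 2 * Im (Ln (u t))" for t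
  \<comment> \<open>A positive real part keeps \<open>u t\<close> off the branch cut of
    \<open>Ln\<close>, so the lift \<open>\<psi>\<close> is differentiable everywhere.\<close>
  have Re_u: "Re (u t) > 0" for t
  proof -
    have "Re (cnj z * cis t) \<le> cmod (cnj z * cis t)" by (rule complex_Re_le_cmod)
    then show ?thesis using z by (simp add: u_def norm_mult)
  qed
  have u0: "u t \<noteq> 0" for t using Re_u[of t] by auto
  have cis\<psi>: "cis (\<psi> t) = disk_mob z (cis t)" for t
  proof -
    have e: "u t = of_real (cmod (u t)) * cis (Im (Ln (u t)))"
      using exp_Ln[OF u0] by (metis Re_Ln complex_cnj_cnj exp_eq_polar exp_ln norm_exp_eq_Re u0 zero_less_norm_iff)
    let ?c = "cis (Im (Ln (u t)))"
    have "cnj (u t) / u t = (of_real (cmod (u t)) * cnj ?c) / (of_real (cmod (u t)) * ?c)"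
      by (subst e, subst (2) e) simp
    also have "\<dots> = cnj ?c / ?c" using u0[of t] by simp
    also have "\<dots> = cis (- 2 * Im (Ln (u t)))"
      by (simp add: cis_cnj cis_divide)
    finally have "cis (\<psi> t) = (cis t * cnj (u t)) / u t"
      by (simp add: \<psi>_def cis_mult flip: times_divide_eq_right)
    also have "cis t * cnj (u t) = cis t - z"
      by (simp add: u_def algebra_simps cis_cnj cis_mult)
    finally show ?thesis
      by (simp add: disk_mob_def u_def)
  qed
  have d: "(\<psi> has_field_derivative poisson z (cis t)) (at t within S)" for t S
  proof -
    have du: "(u has_vector_derivative - (cnj z * (\<i> * cis t))) (at t)"
    proof -
      have "((\<lambda>x. 1 - cnj z * exp (\<i> * x)) has_field_derivative - (cnj z * (\<i> * cis t))) (at (of_real t))"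
        by (auto intro!: derivative_eq_intros simp: cis_conv_exp)
      from has_vector_derivative_real_field[OF this] 
      have "((\<lambda>x. 1 - cnj z * exp (\<i> * complex_of_real x)) has_vector_derivative - (cnj z * (\<i> * cis t))) (at t)" .
      moreover have "u = (\<lambda>x. 1 - cnj z * exp (\<i> * complex_of_real x))"
        by (simp add: fun_eq_iff u_def cis_conv_exp)
      ultimately show ?thesis by simp
    qed
    have "(Ln has_field_derivative inverse (u t)) (at (u t))"
      using Re_u[of t] by (intro has_field_derivative_Ln) (auto simp: complex_nonpos_Reals_iff)
    from field_vector_diff_chain_at[OF du this]
    have "((\<lambda>t. Ln (u t)) has_vector_derivative - (cnj z * (\<i> * cis t)) * inverse (u t)) (at t)"
      by (simp add: o_def)
    then have "((\<lambda>t. Im (Ln (u t))) has_vector_derivative Im (- (cnj z * (\<i> * cis t)) * inverse (u t))) (at t)"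
      by (rule bounded_linear.has_vector_derivative[OF bounded_linear_Im])
    then have "((\<lambda>t. Im (Ln (u t))) has_real_derivative Im (- (cnj z * (\<i> * cis t)) * inverse (u t))) (at t)"
      by (simp add: has_real_derivative_iff_has_vector_derivative)
    then have "(\<psi> has_real_derivative 1 - 2 * Im (- (cnj z * (\<i> * cis t)) * inverse (u t))) (at t)"
      unfolding \<psi>_def by (intro DERIV_diff DERIV_ident DERIV_cmult)
    moreover have "1 - 2 * Im (- (cnj z * (\<i> * cis t)) * inverse (u t)) = poisson z (cis t)"
    proof -
      define s where "s = cnj z * cis t"
      have us: "u t = 1 - s" by (simp add: u_def s_def)
      have ns: "cmod s = cmod z" by (simp add: s_def norm_mult)
      have c: "cmod (z - cis t) = cmod (1 - s)"
        using cmod_disk_mob_denom[of "cis t" z] by (simp add: s_def norm_minus_commute)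
      have "- (cnj z * (\<i> * cis t)) * inverse (u t) = - \<i> * (s / (1 - s))"
        by (simp add: us s_def field_simps)
      then have "1 - 2 * Im (- (cnj z * (\<i> * cis t)) * inverse (u t)) = 1 + 2 * Re (s / (1 - s))"
        by (simp only:) (simp del: times_divide_eq_right)
      also have "Re (s / (1 - s)) = (Re s - (cmod s)\<^sup>2) / (cmod (1 - s))\<^sup>2"
        unfolding cmod_power2 Re_divide by (simp add: power2_eq_square algebra_simps)
      also have "1 + 2 * \<dots> = ((cmod (1 - s))\<^sup>2 + 2 * Re s - 2 * (cmod s)\<^sup>2) / (cmod (1 - s))\<^sup>2"
        using u0[of t] by (simp add: us field_simps)
      also have "(cmod (1 - s))\<^sup>2 + 2 * Re s - 2 * (cmod s)\<^sup>2 = 1 - (cmod s)\<^sup>2"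
        unfolding cmod_power2 by (simp add: power2_eq_square algebra_simps)
      finally show ?thesis by (simp add: poisson_def c ns)
    qed
    ultimately show ?thesis by (simp add: has_field_derivative_at_within)
  qed
  have cont: "continuous_on {0..2 * pi} \<psi>"
    by (rule DERIV_continuous_on[OF d])
  have pnn: "poisson z (cis t) \<ge> 0" for t
    using z by (simp add: poisson_def power_le_one)
  have per: "\<psi> (2 * pi) = \<psi> 0 + 2 * pi"
    by (simp add: \<psi>_def u_def)
  have mono: "\<psi> x \<le> \<psi> y" if "x \<le> y" for x y
    by (rule DERIV_nonneg_imp_nondecreasing[OF that]) (use d[where S=UNIV] pnn in blast)
  have "((\<lambda>t. poisson z (cis t) *\<^sub>R f (cis (\<psi> t))) has_integral integral {\<psi> 0..\<psi> (2 * pi)} (\<lambda>s. f (cis s))) {0..2 * pi}"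
    by (rule has_integral_substitution[where c = "\<psi> 0" and d = "\<psi> (2 * pi)"])
       (auto intro!: mono d continuous_on_circle_cis f)
  then show ?thesis
    unfolding per integral_circle_period[OF f] by (simp add: cis\<psi> circ_int_def integral_unique)
qed

lemma circ_int_cong: "(\<And>\<zeta>. cmod \<zeta> = 1 \<Longrightarrow> f \<zeta> = g \<zeta>) \<Longrightarrow> circ_int f = circ_int g"
  unfolding circ_int_def by (intro integral_cong) auto

lemma circ_int_add:
  fixes f g :: "complex \<Rightarrow> 'a::euclidean_space"
  assumes "continuous_on (sphere 0 1) f" "continuous_on (sphere 0 1) g"
  shows "circ_int (\<lambda>\<zeta>. f \<zeta> + g \<zeta>) = circ_int f + circ_int g"
  unfolding circ_int_def
  by (rule Henstock_Kurzweil_Integration.integral_add) (intro integrable_circle_cis assms)+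

lemma circ_int_diff:
  fixes f g :: "complex \<Rightarrow> 'a::euclidean_space"
  assumes "continuous_on (sphere 0 1) f" "continuous_on (sphere 0 1) g"
  shows "circ_int (\<lambda>\<zeta>. f \<zeta> - g \<zeta>) = circ_int f - circ_int g"
  unfolding circ_int_def
  by (rule Henstock_Kurzweil_Integration.integral_diff) (intro integrable_circle_cis assms)+

lemma circ_int_linear:
  fixes f :: "complex \<Rightarrow> 'a::euclidean_space" and h :: "'a \<Rightarrow> 'b::euclidean_space"
  assumes "continuous_on (sphere 0 1) f" "bounded_linear h"
  shows "circ_int (\<lambda>\<zeta>. h (f \<zeta>)) = h (circ_int f)"
  unfolding circ_int_def
  using integral_linear[OF integrable_circle_cis[OF assms(1)] assms(2)] by (simp add: o_def)

lemma circ_int_cmult: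
  fixes f :: "complex \<Rightarrow> complex"
  assumes "continuous_on (sphere 0 1) f"
  shows "circ_int (\<lambda>\<zeta>. c * f \<zeta>) = c * circ_int f"
  by (rule circ_int_linear[OF assms bounded_linear_mult_right])

lemma circ_int_const [simp]: "circ_int (\<lambda>\<zeta>. c) = (2 * pi) *\<^sub>R c"
  by (simp add: circ_int_def)

lemma circ_int_mono:
  fixes f g :: "complex \<Rightarrow> real"
  assumes "continuous_on (sphere 0 1) f" "continuous_on (sphere 0 1) g"
    "\<And>\<zeta>. cmod \<zeta> = 1 \<Longrightarrow> f \<zeta> \<le> g \<zeta>"
  shows "circ_int f \<le> circ_int g"
  unfolding circ_int_def
  by (rule integral_le) (use assms in \<open>auto intro!: integrable_circle_cis\<close>)

lemma norm_circ_int_le: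
  fixes f :: "complex \<Rightarrow> 'a::euclidean_space"
  assumes "continuous_on (sphere 0 1) f" "\<And>\<zeta>. cmod \<zeta> = 1 \<Longrightarrow> norm (f \<zeta>) \<le> B"
  shows "norm (circ_int f) \<le> 2 * pi * B"
  unfolding circ_int_def
  using integral_bound[of 0 "2 * pi" "\<lambda>t. f (cis t)" B] assms
  by (simp add: continuous_on_circle_cis mult.commute)

lemma continuous_on_circle_compose:
  assumes "continuous_on (sphere 0 1) f" "continuous_on (sphere 0 1) h" "\<And>\<zeta>. cmod \<zeta> = 1 \<Longrightarrow> cmod (h \<zeta>) = 1"
  shows "continuous_on (sphere 0 1) (\<lambda>\<zeta>. f (h \<zeta>))"
  by (rule continuous_on_compose2[OF assms(1,2)]) (use assms(3) in auto)

lemma circ_int_rotate: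
  fixes f :: "complex \<Rightarrow> 'a::euclidean_space"
  assumes f: "continuous_on (sphere 0 1) f" and "cmod c = 1"
  shows "circ_int (\<lambda>\<zeta>. f (c * \<zeta>)) = circ_int f"
proof -
  obtain a where c: "c = cis a"
    using \<open>cmod c = 1\<close> by (metis cis_Arg norm_zero zero_neq_one sgn_eq div_by_1 of_real_1)
  have "integral {0..2*pi} ((\<lambda>t. f (cis t)) \<circ> (\<lambda>t. t + a)) = integral {0 + a..2 * pi + a} (\<lambda>t. f (cis t))"
    by (rule integral_shift) (rule continuous_on_circle_cis[OF f])
  also have "\<dots> = circ_int f"
    using integral_circle_period[OF f, of a] by (simp add: add.commute)
  finally show ?thesis
    by (simp add: circ_int_def c o_def cis_mult add.commute)
qed

lemma circ_int_uminus:
  fixes f :: "complex \<Rightarrow> 'a::euclidean_space"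
  assumes f: "continuous_on (sphere 0 1) f"
  shows "circ_int (\<lambda>\<zeta>. f (- \<zeta>)) = circ_int f"
  using circ_int_rotate[OF f, of "-1"] by simp

section \<open>The conformal barycenter\<close>

definition circle_map :: "(complex \<Rightarrow> complex) \<Rightarrow> bool" where
  "circle_map g \<longleftrightarrow> continuous_on (sphere 0 1) g \<and> (\<forall>\<zeta>. cmod \<zeta> = 1 \<longrightarrow> cmod (g \<zeta>) = 1) \<and>
    (\<forall>p q r. cmod p = 1 \<longrightarrow> cmod q = 1 \<longrightarrow> cmod r = 1 \<longrightarrow> orient p q r > 0 \<longrightarrow> orient (g p) (g q) (g r) > 0)"

lemma circle_map_cont: "circle_map g \<Longrightarrow> continuous_on (sphere 0 1) g"
  and circle_map_unit: "circle_map g \<Longrightarrow> cmod \<zeta> = 1 \<Longrightarrow> cmod (g \<zeta>) = 1"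
  and circle_map_orient: "circle_map g \<Longrightarrow> cmod p = 1 \<Longrightarrow> cmod q = 1 \<Longrightarrow> cmod r = 1 \<Longrightarrow>
    orient p q r > 0 \<Longrightarrow> orient (g p) (g q) (g r) > 0"
  unfolding circle_map_def by auto

text \<open>A third point completes two distinct points to a triangle of non-zero orientation; if
  their images coincided, the image triangle would be degenerate.\<close>

lemma circle_map_inj:
  assumes g: "circle_map g" and u: "cmod p = 1" "cmod q = 1" and "p \<noteq> q"
  shows "g p \<noteq> g q"
proof
  assume eq: "g p = g q"
  obtain r where r: "cmod r = 1" "r \<noteq> p" "r \<noteq> q"
  proof (cases "q = - p")
    case True
    have "p \<noteq> 0" using u(1) by auto
    moreover have "(\<i> - 1) * p = \<i> * p - p" "(\<i> + 1) * p = \<i> * p + p" by (simp_all add: algebra_simps)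
    moreover have "\<i> - 1 \<noteq> 0" "\<i> + 1 \<noteq> 0" by (simp_all add: complex_eq_iff)
    ultimately have "\<i> * p \<noteq> p" "\<i> * p \<noteq> - p"
      by (metis eq_iff_diff_eq_0 mult_eq_0_iff, metis add.left_inverse mult_eq_0_iff)
    then show ?thesis using that[of "\<i> * p"] True u by (simp add: norm_mult)
  next
    case False
    then show ?thesis using that[of "- p"] u False by fastforce
  qed
  have "\<bar>orient p q r\<bar> > 0"
    unfolding abs_orient[OF u r(1)] using r \<open>p \<noteq> q\<close> by simp
  moreover have "orient q p r = - orient p q r"
    by (simp add: orient_def algebra_simps)
  ultimately have "orient p q r > 0 \<or> orient q p r > 0" by linarith
  then have "orient (g p) (g q) (g r) > 0 \<or> orient (g q) (g p) (g r) > 0"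
    using circle_map_orient[OF g] u r by blast
  then show False by (auto simp: eq orient_def)
qed

lemma continuous_on_disk_mob_comp:
  assumes "continuous_on S f" "\<And>x. x \<in> S \<Longrightarrow> cmod (f x) \<le> 1" "cmod a < 1"
  shows "continuous_on S (\<lambda>x. disk_mob a (f x))"
  by (rule continuous_on_compose2[OF continuous_on_disk_mob assms(1)]) (use assms in auto)

lemma circle_map_conj:
  assumes g: "circle_map g" and "cmod z < 1" "cmod w < 1"
  shows "circle_map (disk_mob w \<circ> g \<circ> disk_mob (- z))"
proof -
  have z: "cmod (- z) < 1" using assms by simp
  have 1: "cmod (disk_mob (- z) \<zeta>) = 1" if "cmod \<zeta> = 1" for \<zeta> using disk_mob_unit[OF z that] .
  have "continuous_on (sphere 0 1) (\<lambda>\<zeta>. g (disk_mob (- z) \<zeta>))"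
    by (rule continuous_on_circle_compose[OF circle_map_cont[OF g] continuous_on_subset[OF continuous_on_disk_mob[OF z]]])
       (use 1 in auto)
  then have c: "continuous_on (sphere 0 1) (\<lambda>\<zeta>. disk_mob w (g (disk_mob (- z) \<zeta>)))"
    by (intro continuous_on_disk_mob_comp) (auto simp: circle_map_unit[OF g] 1 assms)
  show ?thesis
    unfolding circle_map_def comp_def
    using c 1 circle_map_unit[OF g] circle_map_orient[OF g] disk_mob_unit[OF assms(3)]
      orient_disk_mob_pos_iff[OF z] orient_disk_mob_pos_iff[OF assms(3)] by simp
qed

text \<open>A relation instead of a function: \<open>w\<close> is the conformal barycentre of the
  image under \<open>g\<close> of harmonic measure seen from \<open>z\<close>. Existence and
  uniqueness are separate arguments, after which \<open>de_disk_eq\<close> evaluates the definite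
  description.\<close>

definition bary :: "(complex \<Rightarrow> complex) \<Rightarrow> complex \<Rightarrow> complex \<Rightarrow> bool" where
  "bary g z w \<longleftrightarrow> cmod w < 1 \<and> circ_int (\<lambda>\<zeta>. poisson z \<zeta> *\<^sub>R disk_mob w (g \<zeta>)) = 0"

lemma continuous_on_bary_integrand:
  assumes "circle_map g" "cmod z < 1" "cmod w < 1"
  shows "continuous_on (sphere 0 1) (\<lambda>\<zeta>. poisson z \<zeta> *\<^sub>R disk_mob w (g \<zeta>))"
  by (intro continuous_intros continuous_on_poisson continuous_on_disk_mob_comp circle_map_cont assms)
     (use circle_map_unit[OF assms(1)] in auto)

text \<open>Conformal naturality: a change of variables with Jacobian \<open>poisson z0\<close> in
  the source and \<open>disk_mob_chain\<close> in the target. It lets later arguments place the base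
  point, and its image, at the origin.\<close>

lemma bary_conj_iff:
  assumes g: "circle_map g" and z: "cmod z < 1" and w: "cmod w < 1" and z0: "cmod z0 < 1" and w0: "cmod w0 < 1"
  shows "bary (disk_mob w0 \<circ> g \<circ> disk_mob (- z0)) (disk_mob z0 z) (disk_mob w0 w) \<longleftrightarrow> bary g z w"
proof -
  let ?g = "disk_mob w0 \<circ> g \<circ> disk_mob (- z0)"
  define f where "f \<zeta> = poisson (disk_mob z0 z) \<zeta> *\<^sub>R disk_mob (disk_mob w0 w) (?g \<zeta>)" for \<zeta>
  define \<kappa> where "\<kappa> = (1 - w0 * cnj w) / (1 - cnj w0 * w)"
  have \<kappa>: "\<kappa> \<noteq> 0"
    using disk_mob_denom_nonzero[of w0 w] disk_mob_denom_nonzero[of w w0] w w0 by (simp add: \<kappa>_def mult.commute)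
  have cf: "continuous_on (sphere 0 1) f"
    unfolding f_def by (intro continuous_on_bary_integrand circle_map_conj disk_mob_ball assms)
  have "circ_int f = circ_int (\<lambda>\<zeta>. poisson z0 \<zeta> *\<^sub>R f (disk_mob z0 \<zeta>))"
    using circ_int_disk_mob[OF cf z0] by simp
  also have "\<dots> = circ_int (\<lambda>\<zeta>. \<kappa> * (poisson z \<zeta> *\<^sub>R disk_mob w (g \<zeta>)))"
  proof (rule circ_int_cong)
    fix \<zeta> :: complex assume u: "cmod \<zeta> = 1"
    have "f (disk_mob z0 \<zeta>) = poisson (disk_mob z0 z) (disk_mob z0 \<zeta>) *\<^sub>R (\<kappa> * disk_mob w (g \<zeta>))"
      unfolding f_def \<kappa>_def
      using disk_mob_chain[OF w0 w, of "g \<zeta>"] disk_mob_inverse[OF z0, of \<zeta>] circle_map_unit[OF g u] u by simp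
    then show "poisson z0 \<zeta> *\<^sub>R f (disk_mob z0 \<zeta>) = \<kappa> * (poisson z \<zeta> *\<^sub>R disk_mob w (g \<zeta>))"
      unfolding poisson_disk_mob[OF z0 z u, symmetric] by (simp add: scaleR_conv_of_real)
  qed
  also have "\<dots> = \<kappa> * circ_int (\<lambda>\<zeta>. poisson z \<zeta> *\<^sub>R disk_mob w (g \<zeta>))"
    by (intro circ_int_cmult continuous_on_bary_integrand assms)
  finally show ?thesis
    using \<kappa> w disk_mob_ball[OF w0 w] by (simp add: bary_def f_def[abs_def])
qed

text \<open>With \<open>x = cnj a * s\<close> the relation \<open>x * cnj x = a * cnj a\<close>
  makes the numerator factor. The sign is the point: in the direction \<open>a\<close> no point of
  the circle is moved forwards by \<open>disk_mob a\<close>. Uniqueness uses the sign,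
  \<open>bary_Lipschitz\<close> the size.\<close>

lemma Re_cnj_diff_disk_mob:
  assumes "cmod s = 1" "cmod a < 1"
  shows "Re (cnj a * (s - disk_mob a s)) = 2 * (Im (cnj a * s))\<^sup>2 / (cmod (1 - cnj a * s))\<^sup>2"
proof -
  define x where "x = cnj a * s"
  have n: "1 - x \<noteq> 0" using disk_mob_denom_nonzero[of a s] assms by (simp add: x_def)
  have Re_div: "Re (y / b) = Re (y * cnj b) / (cmod b)\<^sup>2" for y b
    by (simp add: Re_divide cmod_power2)
  have xx: "x * cnj x = a * cnj a"
    using unit_mult_cnj[OF assms(1)] by (simp add: x_def algebra_simps)
  have "cnj a * (s - disk_mob a s) = (a * cnj a - x * x) / (1 - x)"
    using n unfolding disk_mob_def x_def by (simp add: divide_simps) (simp add: algebra_simps)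
  also have "\<dots> = x * (cnj x - x) / (1 - x)" by (simp add: xx[symmetric] algebra_simps)
  finally have "Re (cnj a * (s - disk_mob a s)) = Re (x * (cnj x - x) * cnj (1 - x)) / (cmod (1 - x))\<^sup>2"
    using Re_div[of "x * (cnj x - x)" "1 - x"] by simp
  also have "Re (x * (cnj x - x) * cnj (1 - x)) = 2 * (Im x)\<^sup>2"
    by (simp add: algebra_simps power2_eq_square)
  finally show ?thesis by (simp add: x_def)
qed

text \<open>With the first barycentre moved to 0 and the second to \<open>a\<close>, both
  \<open>f\<close> and its composition with \<open>disk_mob a\<close> have mean zero. The
  nonnegative displacement of the previous lemma then vanishes, so the values of \<open>f\<close>
  lie on the line through 0 and \<open>a\<close>, which meets the circle in only two points;
  injectivity excludes this.\<close>

lemma bary_unique: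
  assumes g: "circle_map g" and z: "cmod z < 1" and b1: "bary g z w1" and b2: "bary g z w2"
  shows "w1 = w2"
proof (rule ccontr)
  assume "w1 \<noteq> w2"
  have w: "cmod w1 < 1" "cmod w2 < 1" using b1 b2 by (auto simp: bary_def)
  define f where "f = disk_mob w1 \<circ> g \<circ> disk_mob (- z)"
  define a where "a = disk_mob w1 w2"
  have f: "circle_map f" unfolding f_def by (intro circle_map_conj g z w)
  note cf = circle_map_cont[OF f]
  have a1: "cmod a < 1" unfolding a_def by (intro disk_mob_ball w)
  have a0: "a \<noteq> 0"
  proof
    assume "a = 0"
    then have "w1 = w2"
      using disk_mob_denom_nonzero[of w1 w2] w unfolding a_def disk_mob_def by auto
    then show False using \<open>w1 \<noteq> w2\<close> by simp
  qed
  have "bary f 0 0" "bary f 0 a"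
    using bary_conj_iff[OF g z w(1) z w(1)] bary_conj_iff[OF g z w(2) z w(1)] b1 b2 unfolding f_def a_def by simp_all
  then have i: "circ_int f = 0" "circ_int (\<lambda>\<zeta>. disk_mob a (f \<zeta>)) = 0"
    unfolding bary_def poisson_def circ_int_def by simp_all
  have cm: "continuous_on (sphere 0 1) (\<lambda>\<zeta>. disk_mob a (f \<zeta>))"
    by (intro continuous_on_disk_mob_comp cf a1) (use circle_map_unit[OF f] in auto)
  define h where "h \<zeta> = Re (cnj a * (f \<zeta> - disk_mob a (f \<zeta>)))" for \<zeta>
  have ch: "continuous_on (sphere 0 1) h"
    unfolding h_def by (intro continuous_intros cf cm)
  have hh: "h \<zeta> = 2 * (Im (cnj a * f \<zeta>))\<^sup>2 / (cmod (1 - cnj a * f \<zeta>))\<^sup>2" if "cmod \<zeta> = 1" for \<zeta>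
    unfolding h_def by (rule Re_cnj_diff_disk_mob) (use that circle_map_unit[OF f] a1 in auto)
  have "circ_int h = Re (cnj a * circ_int (\<lambda>\<zeta>. f \<zeta> - disk_mob a (f \<zeta>)))"
    unfolding h_def
    by (rule circ_int_linear[OF _ bounded_linear_compose[OF bounded_linear_Re bounded_linear_mult_right]])
       (intro continuous_intros cf cm)
  also have "circ_int (\<lambda>\<zeta>. f \<zeta> - disk_mob a (f \<zeta>)) = 0"
    unfolding circ_int_diff[OF cf cm] i by simp
  finally have h0: "circ_int h = 0" by simp
  have hz: "h (cis t) = 0" if "t \<in> cbox 0 (2 * pi)" for t
  proof (rule has_integral_0_cbox_imp_0[OF _ _ _ _ that])
    show "((\<lambda>t. h (cis t)) has_integral 0) (cbox 0 (2 * pi))"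
      using h0 integrable_circle_cis[OF ch, of 0 "2 * pi"] unfolding circ_int_def
      by (simp add: has_integral_iff)
    show "continuous_on (cbox 0 (2 * pi)) (\<lambda>t. h (cis t))" by (rule continuous_on_circle_cis[OF ch])
  qed (use pi_gt_zero in \<open>auto simp: hh box_real not_le\<close>)
  have Im0: "Im (cnj a * f (cis t)) = 0" if "0 \<le> t" "t \<le> 2 * pi" for t
  proof -
    have "1 - cnj a * f (cis t) \<noteq> 0"
      by (rule disk_mob_denom_nonzero[OF a1]) (use circle_map_unit[OF f] in simp)
    then show ?thesis using hz[of t] hh[of "cis t"] that by simp
  qed
  have ne: "f (cis 0) \<noteq> f (cis (pi/2))" "f (cis 0) \<noteq> f (cis pi)" "f (cis (pi/2)) \<noteq> f (cis pi)"
    by (intro circle_map_inj[OF f]; simp add: complex_eq_iff)+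
  have val: "cnj a * f (cis t) = of_real (cmod a) \<or> cnj a * f (cis t) = - of_real (cmod a)" if "0 \<le> t" "t \<le> 2 * pi" for t
  proof -
    let ?y = "cnj a * f (cis t)"
    have "cmod ?y = cmod a" using circle_map_unit[OF f, of "cis t"] by (simp add: norm_mult)
    moreover have "?y = of_real (Re ?y)" using Im0[OF that] by (simp add: complex_eq_iff)
    ultimately have "\<bar>Re ?y\<bar> = cmod a" by (metis norm_of_real)
    then have "Re ?y = cmod a \<or> Re ?y = - cmod a" by linarith
    with \<open>?y = of_real (Re ?y)\<close> show ?thesis by (metis of_real_minus)
  qed
  have "cnj a * f (cis 0) \<noteq> cnj a * f (cis (pi/2))" "cnj a * f (cis 0) \<noteq> cnj a * f (cis pi)"
    "cnj a * f (cis (pi/2)) \<noteq> cnj a * f (cis pi)"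
    using ne a0 by auto
  moreover have "0 \<le> pi / 2" "pi / 2 \<le> 2 * pi" "pi \<le> 2 * pi" "0 \<le> pi" "0 \<le> 2 * pi" using pi_gt_zero by simp_all
  ultimately show False using val[of 0] val[of "pi/2"] val[of pi] by (metis order_refl)
qed

section \<open>Existence of the barycentre\<close>

lemma cos_five_twelfths: "cos x \<le> 7 / 25" if "5 * pi / 12 \<le> x" "x \<le> pi" for x
proof -
  have "cos x \<le> cos (5 * pi / 12)" using that pi_gt_zero by (subst cos_mono_le_eq) auto
  also have "\<dots> = sin (pi / 12)" by (subst cos_sin_eq) (simp add: field_simps)
  also have "\<dots> \<le> pi / 12" using pi_gt_zero by (intro sin_x_le_x) auto
  also have "\<dots> \<le> 7 / 25" using pi_less_4 pi_approx by simp
  finally show ?thesis .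
qed

lemma dist_unit_sq: "(cmod (p - q))\<^sup>2 = 2 - 2 * Re (p * cnj q)" if "cmod p = 1" "cmod q = 1"
proof -
  have "(Re p)\<^sup>2 + (Im p)\<^sup>2 = 1" "(Re q)\<^sup>2 + (Im q)\<^sup>2 = 1" using that by (simp_all flip: cmod_power2)
  then show ?thesis unfolding cmod_power2 by (simp add: power2_eq_square algebra_simps)
qed

text \<open>The points off the arc of half-angle \<open>5\<pi>/12\<close> around \<open>\<xi>\<^sub>0\<close> carry \<open>7/12\<close> of the mass, and
  \<open>7/12 * 3/4 > 5/12\<close>.\<close>

lemma exists_far_point:
  assumes cf: "continuous_on (sphere 0 1) f" and uf: "\<And>\<zeta>. cmod \<zeta> = 1 \<Longrightarrow> cmod (f \<zeta>) = 1"
    and a: "cmod a = 1" and le: "Re (circ_int f * cnj a) \<le> 0" and \<xi>0: "cmod \<xi>0 = 1"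
  obtains \<xi> where "cmod \<xi> = 1" "cmod (\<xi> - \<xi>0) \<ge> 6 / 5" "(cmod (f \<xi> - a))\<^sup>2 > 1 / 2"
proof -
  have "\<exists>\<xi>. cmod \<xi> = 1 \<and> cmod (\<xi> - \<xi>0) \<ge> 6 / 5 \<and> Re (f \<xi> * cnj a) < 3 / 4"
  proof (rule ccontr)
    assume "\<not> ?thesis"
    then have far: "Re (f \<xi> * cnj a) \<ge> 3 / 4" if "cmod \<xi> = 1" "cmod (\<xi> - \<xi>0) \<ge> 6 / 5" for \<xi>
      using that by force
    obtain t0 where t0: "\<xi>0 = cis t0"
      using \<xi>0 by (metis cis_Arg norm_zero zero_neq_one sgn_eq div_by_1 of_real_1)
    define k where "k \<zeta> = Re (f \<zeta> * cnj a)" for \<zeta>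
    have ck: "continuous_on (sphere 0 1) k" unfolding k_def by (intro continuous_intros cf)
    have lo: "k (cis t) \<ge> - 1" for t
    proof -
      have "\<bar>Re (f (cis t) * cnj a)\<bar> \<le> cmod (f (cis t) * cnj a)" by (rule abs_Re_le_cmod)
      also have "\<dots> = 1" using a uf[of "cis t"] by (simp add: norm_mult)
      finally show ?thesis by (simp add: k_def)
    qed
    have hi: "k (cis t) \<ge> 3 / 4" if "5 * pi / 12 \<le> \<bar>t - t0\<bar>" "\<bar>t - t0\<bar> \<le> pi" for t
      unfolding k_def
    proof (rule far)
      have "Re (cis t * cnj \<xi>0) = cos \<bar>t - t0\<bar>" by (simp add: t0 cos_diff)
      also have "\<dots> \<le> 7 / 25" by (rule cos_five_twelfths[OF that])
      \<comment> \<open>The number 7/25 is chosen because \<open>2 - 2 * 7 / 25\<close> is exactly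
        the square of 6/5.\<close>
      finally have "(cmod (cis t - \<xi>0))\<^sup>2 \<ge> (6 / 5)\<^sup>2"
        unfolding dist_unit_sq[of "cis t" \<xi>0, simplified \<xi>0, simplified] by (simp add: power2_eq_square)
      then show "cmod (cis t - \<xi>0) \<ge> 6 / 5" by (rule power2_le_imp_le) simp
    qed simp
    have hi': "3 / 4 \<le> k (cis t)" if "t0 - pi \<le> t \<and> t \<le> t0 - 5 * pi / 12 \<or> t0 + 5 * pi / 12 \<le> t \<and> t \<le> t0 + pi" for t
      using that pi_gt_zero by (intro hi) (auto simp: abs_if)
    \<comment> \<open>One period starting at the antipode of \<open>\<xi>0\<close>;
      \<open>s + c\<close> and \<open>s + d\<close> are the ends of the excluded arc. The three
      bounds below sum to \<open>7 * pi / 8 - 5 * pi / 6\<close>, which is positive.\<close>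
    define s where "s = t0 - pi"
    define c where "c = 7 * pi / 12"
    define d where "d = 17 * pi / 12"
    have "circ_int k = integral {s..s + 2 * pi} (\<lambda>t. k (cis t))"
      using integral_circle_period[OF ck] by simp
    also have "\<dots> = integral {s..s + c} (\<lambda>t. k (cis t)) + integral {s + c..s + 2 * pi} (\<lambda>t. k (cis t))"
      by (intro Henstock_Kurzweil_Integration.integral_combine[symmetric] integrable_circle_cis ck) (auto simp: c_def)
    also have "integral {s + c..s + 2 * pi} (\<lambda>t. k (cis t)) =
        integral {s + c..s + d} (\<lambda>t. k (cis t)) + integral {s + d..s + 2 * pi} (\<lambda>t. k (cis t))"
      by (intro Henstock_Kurzweil_Integration.integral_combine[symmetric] integrable_circle_cis ck) (auto simp: c_def d_def)
    finally have e: "circ_int k = integral {s..s + c} (\<lambda>t. k (cis t)) + (integral {s + c..s + d} (\<lambda>t. k (cis t)) + integral {s + d..s + 2 * pi} (\<lambda>t. k (cis t)))" .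
    have i1: "integral {s..s + c} (\<lambda>t. 3 / 4 :: real) \<le> integral {s..s + c} (\<lambda>t. k (cis t))"
      by (intro integral_le integrable_circle_cis ck hi') (auto simp: s_def c_def)
    have i2: "integral {s + c..s + d} (\<lambda>t. - 1 :: real) \<le> integral {s + c..s + d} (\<lambda>t. k (cis t))"
      by (intro integral_le integrable_circle_cis ck) (auto intro!: lo)
    have i3: "integral {s + d..s + 2 * pi} (\<lambda>t. 3 / 4 :: real) \<le> integral {s + d..s + 2 * pi} (\<lambda>t. k (cis t))"
      by (intro integral_le integrable_circle_cis ck hi') (auto simp: s_def d_def)
    have "circ_int k > 0"
      using e i1 i2 i3 by (simp add: c_def d_def) (use pi_gt_zero in linarith)
    moreover have "circ_int k = Re (circ_int f * cnj a)"
      unfolding k_def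
      by (rule circ_int_linear[OF cf bounded_linear_compose[OF bounded_linear_Re bounded_linear_mult_left]])
    ultimately show False using le by simp
  qed
  then obtain \<xi> where "cmod \<xi> = 1" "cmod (\<xi> - \<xi>0) \<ge> 6 / 5" "Re (f \<xi> * cnj a) < 3 / 4" by blast
  moreover have "(cmod (f \<xi> - a))\<^sup>2 > 1 / 2"
    using dist_unit_sq[OF uf a, of \<xi>] calculation by simp
  ultimately show ?thesis using that by blast
qed

text \<open>Brouwer is applied to \<open>w + V w\<close> followed by the nearest-point projection.
  At a fixed point \<open>V w\<close> is zero or an outward normal; the latter is possible only on
  the boundary, where \<open>inw\<close> forbids it.\<close>

lemma inward_field_has_zero:
  fixes V :: "complex \<Rightarrow> complex"
  assumes r: "r > 0" and V: "continuous_on (cball 0 r) V" and inw: "\<And>w. cmod w = r \<Longrightarrow> V w \<bullet> w < 0"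
  obtains w where "cmod w \<le> r" "V w = 0"
proof -
  let ?S = "cball (0::complex) r"
  let ?c = "closest_point ?S"
  have ne: "?S \<noteq> {}" using r by auto
  have "continuous_on ?S (\<lambda>w. ?c (w + V w))"
    by (intro continuous_on_compose2[OF continuous_on_closest_point[of ?S UNIV]] continuous_intros V) (use ne in auto)
  moreover have "(\<lambda>w. ?c (w + V w)) \<in> ?S \<rightarrow> ?S"
    using closest_point_in_set[of ?S] ne by auto
  ultimately obtain w where w: "w \<in> ?S" "?c (w + V w) = w"
    using brouwer[of ?S "\<lambda>w. ?c (w + V w)"] ne by auto
  have dot: "V w \<bullet> (y - w) \<le> 0" if "y \<in> ?S" for y
    using closest_point_dot[of ?S y "w + V w"] w that by simp
  have "V w \<bullet> w \<ge> 0" using dot[of 0] r by simp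
  then have "cmod w \<noteq> r" using inw by force
  then have wr: "cmod w < r" using w by simp
  have "V w = 0"
  proof (rule ccontr)
    assume nz: "V w \<noteq> 0"
    define e where "e = (r - cmod w) / cmod (V w)"
    have e: "e > 0" using wr nz by (simp add: e_def)
    have "cmod (w + e *\<^sub>R V w) \<le> cmod w + e * cmod (V w)"
      using norm_triangle_ineq[of w "e *\<^sub>R V w"] e by simp
    also have "\<dots> = r" using nz by (simp add: e_def)
    finally have "V w \<bullet> (e *\<^sub>R V w) \<le> 0" using dot[of "w + e *\<^sub>R V w"] by simp
    moreover have "V w \<bullet> V w > 0" using nz by simp
    ultimately show False using e by (simp add: mult_le_0_iff)
  qed
  then show ?thesis using that w by simp
qed

text \<open>Compactness gives some \<open>\<delta>\<close> without control of its size. It serves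
  only the existence of the barycentre; the quantitative separation comes from the shear
  norm.\<close>

lemma circle_map_separation:
  assumes g: "circle_map g"
  obtains \<delta> where "\<delta> > 0" "\<delta> \<le> 2" "\<And>p q. cmod p = 1 \<Longrightarrow> cmod q = 1 \<Longrightarrow> cmod (p - q) \<ge> 6 / 5 \<Longrightarrow> cmod (g p - g q) \<ge> \<delta>"
proof -
  define S where "S = (sphere 0 1 \<times> sphere 0 1) \<inter> {x :: complex \<times> complex. 6 / 5 \<le> cmod (fst x - snd x)}"
  have "compact S"
    unfolding S_def by (intro compact_Int_closed compact_Times compact_sphere closed_Collect_le continuous_intros)
  moreover have in1: "(1, -1) \<in> S" by (simp add: S_def)
  moreover have "continuous_on S (\<lambda>x. cmod (g (fst x) - g (snd x)))"
    by (intro continuous_intros continuous_on_compose2[OF circle_map_cont[OF g]]) (auto simp: S_def)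
  ultimately obtain x where x: "x \<in> S" "\<And>y. y \<in> S \<Longrightarrow> cmod (g (fst x) - g (snd x)) \<le> cmod (g (fst y) - g (snd y))"
    using continuous_attains_inf[of S "\<lambda>x. cmod (g (fst x) - g (snd x))"] by (metis empty_iff)
  let ?d = "cmod (g (fst x) - g (snd x))"
  have "fst x \<noteq> snd x" using x(1) by (auto simp: S_def)
  then have "?d > 0"
    using x(1) circle_map_inj[OF g, of "fst x" "snd x"] by (auto simp: S_def)
  moreover have "?d \<le> 2"
    using norm_triangle_ineq4[of "g (fst x)" "g (snd x)"] x(1) circle_map_unit[OF g] by (auto simp: S_def)
  moreover have "?d \<le> cmod (g p - g q)" if "cmod p = 1" "cmod q = 1" "cmod (p - q) \<ge> 6 / 5" for p q
    using x(2)[of "(p, q)"] that by (simp add: S_def)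
  ultimately show ?thesis using that by blast
qed

lemma bary_exists_0:
  assumes g: "circle_map g"
  obtains w where "bary g 0 w"
proof -
  obtain \<delta> where d: "\<delta> > 0" "\<delta> \<le> 2" and sep: "\<And>p q. cmod p = 1 \<Longrightarrow> cmod q = 1 \<Longrightarrow> cmod (p - q) \<ge> 6 / 5 \<Longrightarrow> cmod (g p - g q) \<ge> \<delta>"
    using circle_map_separation[OF g] by blast
  \<comment> \<open>Chosen so that \<open>3 * (1 - r) = \<delta> / 2\<close>, the bound that results
    in \<open>close\<close>.\<close>
  define r where "r = 1 - \<delta> / 6"
  have r: "r > 0" "r < 1" using d by (auto simp: r_def)
  define V where "V w = circ_int (\<lambda>\<zeta>. disk_mob w (g \<zeta>))" for w
  have cV: "continuous_on (cball 0 r) V"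
  proof -
    have "continuous_on (cball 0 r \<times> cbox 0 (2 * pi)) (\<lambda>(w :: complex, t :: real). disk_mob w (g (cis t)))"
      unfolding disk_mob_def case_prod_unfold
    proof (intro continuous_intros continuous_on_compose2[OF circle_map_cont[OF g]] ballI)
      fix x :: "complex \<times> real" assume "x \<in> cball 0 r \<times> cbox 0 (2 * pi)"
      then show "1 - cnj (fst x) * g (cis (snd x)) \<noteq> 0"
        using r circle_map_unit[OF g] by (intro disk_mob_denom_nonzero) (auto simp: mem_Times_iff)
    qed auto
    then show ?thesis
      unfolding V_def circ_int_def using integral_continuous_on_param[of "cball 0 r" 0 "2*pi" "\<lambda>w t. disk_mob w (g (cis t))"]
      by simp
  qed
  \<comment> \<open>Near the boundary \<open>disk_mob w\<close> sends everything far from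
    \<open>w\<close> close to \<open>a = - (w / r)\<close>. If \<open>V w\<close> did not point
    inwards, \<open>exists_far_point\<close> would give two points at distance 6/5 that are not sent
    close to \<open>a\<close>; their images under \<open>g\<close> would both lie within
    \<open>\<delta> / 2\<close> of \<open>w\<close>, against the separation.\<close>
  have inw: "V w \<bullet> w < 0" if w: "cmod w = r" for w
  proof (rule ccontr)
    assume "\<not> V w \<bullet> w < 0"
    then have nn: "V w \<bullet> w \<ge> 0" by simp
    define a where "a = - (w / of_real r)"
    have a: "cmod a = 1" using w r by (simp add: a_def norm_divide)
    have w1: "cmod w < 1" using w r by simp
    have cm: "continuous_on (sphere 0 1) (\<lambda>\<zeta>. disk_mob w (g \<zeta>))"
      by (intro continuous_on_disk_mob_comp circle_map_cont[OF g] w1) (use circle_map_unit[OF g] in auto)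
    have um: "cmod (disk_mob w (g \<zeta>)) = 1" if "cmod \<zeta> = 1" for \<zeta>
      using disk_mob_unit[OF w1 circle_map_unit[OF g that]] .
    have "Re (V w * cnj a) = - (V w \<bullet> w) / r"
      using r by (simp add: a_def inner_complex_def Re_divide_of_real field_simps)
    then have "Re (circ_int (\<lambda>\<zeta>. disk_mob w (g \<zeta>)) * cnj a) \<le> 0"
      using nn r by (simp add: V_def[symmetric] divide_nonpos_pos)
    then have far: "\<exists>\<xi>. cmod \<xi> = 1 \<and> cmod (\<xi> - \<xi>0) \<ge> 6 / 5 \<and> (cmod (disk_mob w (g \<xi>) - a))\<^sup>2 > 1 / 2"
      if "cmod \<xi>0 = 1" for \<xi>0
      using exists_far_point[of "\<lambda>\<zeta>. disk_mob w (g \<zeta>)" a \<xi>0] cm um a that by blast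
    have close: "cmod (g \<xi> - w) < \<delta> / 2" if u: "cmod \<xi> = 1" and "(cmod (disk_mob w (g \<xi>) - a))\<^sup>2 > 1 / 2" for \<xi>
    proof -
      let ?s = "g \<xi>"
      have us: "cmod ?s = 1" using circle_map_unit[OF g u] .
      have n: "1 - cnj w * ?s \<noteq> 0" using disk_mob_denom_nonzero[OF w1] us by simp
      have ww: "w * cnj w = of_real r * of_real r"
        using complex_norm_square[of w] w by (simp add: power2_eq_square)
      have "disk_mob w ?s - a = ((?s - w) + (w / r) * (1 - cnj w * ?s)) / (1 - cnj w * ?s)"
        using n r unfolding disk_mob_def a_def by (simp add: field_simps)
      also have "(?s - w) + (w / r) * (1 - cnj w * ?s) = ?s - w + w / r - (w * cnj w) / r * ?s"
        by (simp add: algebra_simps)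
      also have "\<dots> = of_real (1 - r) * (?s + w / r)"
        unfolding ww using r by (simp add: field_simps)
      finally have "disk_mob w ?s - a = of_real (1 - r) * (?s + w / r) / (1 - cnj w * ?s)" .
      moreover have "cmod (1 - complex_of_real r) = 1 - r" using norm_of_real[of "1 - r"] r by simp
      ultimately have "cmod (disk_mob w ?s - a) = (1 - r) * cmod (?s + w / r) / cmod (?s - w)"
        using r by (simp add: norm_divide norm_mult cmod_disk_mob_denom[OF us])
      moreover have "cmod (?s + w / r) \<le> 2"
        using norm_triangle_ineq[of ?s "w / r"] us w r by (simp add: norm_divide)
      ultimately have le: "cmod (disk_mob w ?s - a) \<le> (1 - r) * 2 / cmod (?s - w)"
        using r by (simp only:) (intro divide_right_mono mult_left_mono; simp)
      have "2 / 3 < cmod (disk_mob w ?s - a)"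
        by (rule power2_less_imp_less) (use that(2) in \<open>auto simp: power2_eq_square\<close>)
      then have "2 / 3 < (1 - r) * 2 / cmod (?s - w)" using le by linarith
      moreover have "cmod (?s - w) > 0" using us w1 by auto
      ultimately show ?thesis by (simp add: field_simps r_def)
    qed
    obtain \<xi>1 where x1: "cmod \<xi>1 = 1" "(cmod (disk_mob w (g \<xi>1) - a))\<^sup>2 > 1 / 2"
      using far[of 1] by (metis norm_one)
    obtain \<xi>2 where x2: "cmod \<xi>2 = 1" "cmod (\<xi>2 - \<xi>1) \<ge> 6 / 5" "(cmod (disk_mob w (g \<xi>2) - a))\<^sup>2 > 1 / 2"
      using far[OF x1(1)] by blast
    have "\<delta> \<le> cmod (g \<xi>2 - g \<xi>1)" using sep x1 x2 by blast
    also have "\<dots> \<le> cmod (g \<xi>2 - w) + cmod (g \<xi>1 - w)" by (metis norm_minus_commute norm_triangle_sub norm_diff_triangle_le order_refl)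
    also have "\<dots> < \<delta>" using close[OF x1] close[OF x2(1,3)] by simp
    finally show False by simp
  qed
  obtain w where "cmod w \<le> r" "V w = 0"
    using inward_field_has_zero[OF r(1) cV inw] by blast
  then have "bary g 0 w" using r unfolding bary_def V_def by (simp add: poisson_def circ_int_def)
  then show ?thesis using that by blast
qed

lemma bary_exists:
  assumes g: "circle_map g" and z: "cmod z < 1"
  obtains w where "bary g z w"
proof -
  have "circle_map (disk_mob 0 \<circ> g \<circ> disk_mob (- z))" by (intro circle_map_conj g z) simp
  then obtain w where w: "bary (disk_mob 0 \<circ> g \<circ> disk_mob (- z)) 0 w" using bary_exists_0 by blast
  then have "cmod w < 1" by (simp add: bary_def)
  then have "bary g z w" using bary_conj_iff[OF g z _ z, of w 0] w by simp
  then show ?thesis using that by blast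
qed

lemma de_disk_eq:
  assumes g: "circle_map g" and z: "cmod z < 1" and b: "bary g z w"
  shows "de_disk g z = w"
proof -
  have iff: "(v \<in> ball 0 1 \<and> 1 / (2 * pi) * integral {0..2 * pi}
       (\<lambda>t. (g (cis t) - v) / (1 - cnj v * g (cis t))
             * complex_of_real ((1 - (cmod z)\<^sup>2) / (cmod (z - cis t))\<^sup>2)) = 0) \<longleftrightarrow> bary g z v" for v
    unfolding bary_def circ_int_def disk_mob_def poisson_def by (simp add: scaleR_conv_of_real mult.commute)
  show ?thesis unfolding de_disk_def iff
    by (rule the_equality) (use b bary_unique[OF g z] in auto)
qed

section \<open>The extension at a centered boundary map\<close>

text \<open>Base point and image are both at the origin. The bounds below depend on \<open>g\<close>
  through \<open>\<delta>\<close> alone.\<close>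

locale centered_circle_map =
  fixes g :: "complex \<Rightarrow> complex" and \<delta> :: real
  assumes circle_map: "circle_map g" and mean_zero: "circ_int g = 0"
    and \<delta>_pos: "\<delta> > 0"
    and separation: "\<And>p q. cmod p = 1 \<Longrightarrow> cmod q = 1 \<Longrightarrow> cmod (p - q) \<ge> 6 / 5 \<Longrightarrow> cmod (g p - g q) \<ge> \<delta>"
begin

lemmas cont = circle_map_cont[OF circle_map]
lemmas unit = circle_map_unit[OF circle_map]

section \<open>The second moment of the boundary map\<close>

lemma \<delta>_le_2: "\<delta> \<le> 2"
  using separation[of 1 "-1"] norm_triangle_ineq4[of "g 1" "g (-1)"] unit[of 1] unit[of "-1"] by simp

text \<open>Small imaginary parts put both points near 1 or -1, and the sign condition near the same
  one. There the real parts are compared through the difference of their squares, because their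
  moduli sum to at least 1.\<close>

lemma near_pole_close:
  assumes "cmod u = 1" "cmod v = 1" "\<bar>Im u\<bar> \<le> \<delta> / 4" "\<bar>Im v\<bar> \<le> \<delta> / 4" "0 \<le> Re u * Re v"
  shows "cmod (u - v) < \<delta>"
proof -
  define d where "d = \<delta> / 4"
  have d: "0 < d" "d \<le> 1 / 2" using \<delta>_pos \<delta>_le_2 by (auto simp: d_def)
  have i: "(Im u)\<^sup>2 \<le> d\<^sup>2" "(Im v)\<^sup>2 \<le> d\<^sup>2" using assms d_def by (simp_all add: abs_le_square_iff[symmetric])
  have d2: "d\<^sup>2 \<le> 1 / 4" using d power_mono[of d "1/2" 2] by (simp add: power2_eq_square)
  have r: "(Re u)\<^sup>2 = 1 - (Im u)\<^sup>2" "(Re v)\<^sup>2 = 1 - (Im v)\<^sup>2"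
    using assms(1,2) by (metis cmod_power2 add_diff_cancel_right' one_power2)+
  have R: "\<bar>Re u\<bar> \<ge> 1 / 2" "\<bar>Re v\<bar> \<ge> 1 / 2"
    by (rule power2_le_imp_le; use r i d2 in \<open>simp add: power2_eq_square\<close>)+
  have s: "\<bar>Re u + Re v\<bar> = \<bar>Re u\<bar> + \<bar>Re v\<bar>"
    using assms(5) by (auto simp: zero_le_mult_iff)
  have "\<bar>Re u - Re v\<bar> * 1 \<le> \<bar>Re u - Re v\<bar> * \<bar>Re u + Re v\<bar>"
    using R s by (intro mult_left_mono) auto
  also have "\<dots> = \<bar>(Im v)\<^sup>2 - (Im u)\<^sup>2\<bar>"
  proof -
    have "(Re u - Re v) * (Re u + Re v) = (Im v)\<^sup>2 - (Im u)\<^sup>2"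
      using r by (simp add: power2_eq_square algebra_simps)
    then show ?thesis by (metis abs_mult)
  qed
  also have "\<dots> \<le> d\<^sup>2" using i by (smt (verit) zero_le_power2)
  also have "\<dots> \<le> d" using d by (simp add: power2_eq_square mult_left_le)
  finally have "\<bar>Re (u - v)\<bar> \<le> d" by simp
  moreover have "\<bar>Im (u - v)\<bar> \<le> 2 * d" using assms(3,4) d_def by simp
  ultimately have "cmod (u - v) \<le> 3 * d" using cmod_le[of "u - v"] by linarith
  then show ?thesis using d by (simp add: d_def)
qed

text \<open>Any two of \<open>\<zeta>\<close>, \<open>\<i> * \<zeta>\<close>,
  \<open>- \<zeta>\<close> are at distance at least sqrt 2 > 6/5, while a small integrand leaves
  room only near the two points \<open>e\<close> and \<open>- e\<close>. So three rotated copies of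
  the integrand sum to at least \<open>\<delta>\<^sup>2 / 16\<close> pointwise.\<close>

lemma circ_int_Im_sq:
  assumes e: "cmod e = 1"
  shows "circ_int (\<lambda>\<zeta>. (Im (cnj e * g \<zeta>))\<^sup>2) \<ge> pi * \<delta>\<^sup>2 / 24"
proof -
  define F where "F \<zeta> = (Im (cnj e * g \<zeta>))\<^sup>2" for \<zeta>
  have cF: "continuous_on (sphere 0 1) F" unfolding F_def by (intro continuous_intros cont)
  have cFr: "continuous_on (sphere 0 1) (\<lambda>\<zeta>. F (c * \<zeta>))" if "cmod c = 1" for c
    by (rule continuous_on_circle_compose[OF cF]) (use that in \<open>auto intro!: continuous_intros simp: norm_mult\<close>)
  have three: "\<delta>\<^sup>2 / 16 \<le> F \<zeta> + (F (\<i> * \<zeta>) + F (- 1 * \<zeta>))" if u: "cmod \<zeta> = 1" for \<zeta>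
  proof (rule ccontr)
    assume "\<not> ?thesis"
    then have lt: "F \<zeta> + (F (\<i> * \<zeta>) + F (- 1 * \<zeta>)) < \<delta>\<^sup>2 / 16" by simp
    have nn: "F x \<ge> 0" for x by (simp add: F_def)
    have sm: "\<bar>Im (cnj e * g x)\<bar> \<le> \<delta> / 4" if "F x < \<delta>\<^sup>2 / 16" for x
    proof -
      have "\<bar>Im (cnj e * g x)\<bar>\<^sup>2 \<le> (\<delta> / 4)\<^sup>2" using that by (simp add: F_def power_divide)
      then show ?thesis by (rule power2_le_imp_le) (use \<delta>_pos in simp)
    qed
    have s: "\<bar>Im (cnj e * g \<zeta>)\<bar> \<le> \<delta> / 4" "\<bar>Im (cnj e * g (\<i> * \<zeta>))\<bar> \<le> \<delta> / 4" "\<bar>Im (cnj e * g (- 1 * \<zeta>))\<bar> \<le> \<delta> / 4"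
      by (rule sm; use lt nn[of \<zeta>] nn[of "\<i> * \<zeta>"] nn[of "- 1 * \<zeta>"] in linarith)+
    have far: "cmod (cnj e * g x - cnj e * g y) \<ge> \<delta>" if "cmod x = 1" "cmod y = 1" "(cmod (x - y))\<^sup>2 \<ge> 2" for x y
    proof -
      have "cmod (x - y) \<ge> 6 / 5" by (rule power2_le_imp_le) (use that in \<open>auto simp: power2_eq_square\<close>)
      then have "cmod (g x - g y) \<ge> \<delta>" using separation that by blast
      then show ?thesis using e by (simp add: norm_mult flip: right_diff_distrib)
    qed
    have m: "cmod (cnj e * g x) = 1" if "cmod x = 1" for x using that unit e by (simp add: norm_mult)
    have opp: "Re (cnj e * g x) * Re (cnj e * g y) < 0"
      if "cmod x = 1" "cmod y = 1" "(cmod (x - y))\<^sup>2 \<ge> 2" "\<bar>Im (cnj e * g x)\<bar> \<le> \<delta> / 4" "\<bar>Im (cnj e * g y)\<bar> \<le> \<delta> / 4" for x y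
      using near_pole_close[OF m m, OF that(1,2,4,5)] far[OF that(1-3)] by linarith
    have z1: "(cmod (\<zeta> - \<i> * \<zeta>))\<^sup>2 = 2" "(cmod (\<zeta> - - 1 * \<zeta>))\<^sup>2 = 4" "(cmod (\<i> * \<zeta> - - 1 * \<zeta>))\<^sup>2 = 2"
    proof -
      have "\<zeta> - \<i> * \<zeta> = (1 - \<i>) * \<zeta>" "\<zeta> - - 1 * \<zeta> = 2 * \<zeta>" "\<i> * \<zeta> - - 1 * \<zeta> = (1 + \<i>) * \<zeta>"
        by (simp_all add: algebra_simps)
      then show "(cmod (\<zeta> - \<i> * \<zeta>))\<^sup>2 = 2" "(cmod (\<zeta> - - 1 * \<zeta>))\<^sup>2 = 4" "(cmod (\<i> * \<zeta> - - 1 * \<zeta>))\<^sup>2 = 2"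
        using u by (simp_all add: norm_mult power_mult_distrib cmod_power2)
    qed
    have "Re (cnj e * g \<zeta>) * Re (cnj e * g (\<i> * \<zeta>)) < 0" "Re (cnj e * g \<zeta>) * Re (cnj e * g (- 1 * \<zeta>)) < 0"
      "Re (cnj e * g (\<i> * \<zeta>)) * Re (cnj e * g (- 1 * \<zeta>)) < 0"
      by (rule opp; use s z1 u in \<open>simp add: norm_mult\<close>)+
    then show False by (smt (verit) mult_neg_neg mult_pos_pos mult_less_0_iff)
  qed
  have "circ_int (\<lambda>\<zeta>. \<delta>\<^sup>2 / 16) \<le> circ_int (\<lambda>\<zeta>. F \<zeta> + (F (\<i> * \<zeta>) + F (- 1 * \<zeta>)))"
    by (rule circ_int_mono, intro continuous_intros, intro continuous_intros cF cFr, simp, simp, rule three)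
  also have "\<dots> = circ_int F + (circ_int (\<lambda>\<zeta>. F (\<i> * \<zeta>)) + circ_int (\<lambda>\<zeta>. F (- 1 * \<zeta>)))"
    by (subst circ_int_add, intro cF, intro continuous_intros cFr, simp, simp)
       (subst circ_int_add; (intro cFr)?; simp)
  also have "\<dots> = 3 * circ_int F"
    by (subst (1 2) circ_int_rotate[OF cF]) auto
  finally show ?thesis by (simp add: F_def[abs_def])
qed

text \<open>The coefficients of the linearised barycentre equation. \<open>c1\<close> and
  \<open>c2\<close> are the Fourier coefficients of \<open>g\<close> at 1 and -1, that is, the two
  complex derivatives at the origin of the harmonic extension of \<open>g\<close>.\<close>

definition b where "b = circ_int (\<lambda>\<zeta>. (g \<zeta>)\<^sup>2) / (2 * pi)"
definition c1 where "c1 = circ_int (\<lambda>\<zeta>. cnj \<zeta> * g \<zeta>) / (2 * pi)"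
definition c2 where "c2 = circ_int (\<lambda>\<zeta>. \<zeta> * g \<zeta>) / (2 * pi)"

lemma circ_int_sq: "circ_int (\<lambda>\<zeta>. (g \<zeta>)\<^sup>2) = 2 * pi * b"
  and circ_int_c1: "circ_int (\<lambda>\<zeta>. cnj \<zeta> * g \<zeta>) = 2 * pi * c1"
  and circ_int_c2: "circ_int (\<lambda>\<zeta>. \<zeta> * g \<zeta>) = 2 * pi * c2"
  by (simp_all add: b_def c1_def c2_def)

lemma norm_mean_le_1:
  fixes f :: "complex \<Rightarrow> complex"
  assumes "continuous_on (sphere 0 1) f" "\<And>\<zeta>. cmod \<zeta> = 1 \<Longrightarrow> cmod (f \<zeta>) \<le> 1"
  shows "cmod (circ_int f / (2 * pi)) \<le> 1"
  using norm_circ_int_le[OF assms] by (simp add: norm_divide norm_mult)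

lemma norm_c1: "cmod c1 \<le> 1" unfolding c1_def
  by (rule norm_mean_le_1) (auto intro!: continuous_intros cont simp: norm_mult unit)

lemma norm_c2: "cmod c2 \<le> 1" unfolding c2_def
  by (rule norm_mean_le_1) (auto intro!: continuous_intros cont simp: norm_mult unit)

text \<open>Taking \<open>e\<^sup>2\<close> in the direction of \<open>b\<close> makes
  \<open>1 - |b|\<close> the mean of \<open>2 * (Im (cnj e * g \<zeta>))\<^sup>2\<close>, which is
  bounded below by the second moment estimate.\<close>

lemma norm_b: "cmod b \<le> 1 - \<delta>\<^sup>2 / 24"
proof -
  obtain e where e: "cmod e = 1" "b = of_real (cmod b) * e\<^sup>2"
  proof (cases "b = 0")
    case True then show ?thesis using that[of 1] by simp
  next
    case False
    let ?e = "csqrt (b / of_real (cmod b))"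
    have e2: "?e\<^sup>2 = b / of_real (cmod b)" by simp
    moreover have "cmod ?e = 1"
    proof -
      have "(cmod ?e)\<^sup>2 = 1" using False by (metis e2 norm_power norm_divide norm_of_real abs_norm_cancel divide_self norm_eq_zero)
      then show ?thesis by (simp add: power2_eq_1_iff)
    qed
    ultimately show ?thesis using that[of ?e] False by simp
  qed
  have "Re (cnj e ^ 2 * (g \<zeta>)\<^sup>2) = 1 - 2 * (Im (cnj e * g \<zeta>))\<^sup>2" if "cmod \<zeta> = 1" for \<zeta>
  proof -
    let ?y = "cnj e * g \<zeta>"
    have "cmod ?y = 1" using e(1) unit[OF that] by (simp add: norm_mult)
    then have "(Re ?y)\<^sup>2 + (Im ?y)\<^sup>2 = 1" using cmod_power2[of ?y] by simp
    moreover have "Re (?y\<^sup>2) = (Re ?y)\<^sup>2 - (Im ?y)\<^sup>2" by (simp add: power2_eq_square)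
    ultimately show ?thesis by (simp add: power_mult_distrib)
  qed
  then have "circ_int (\<lambda>\<zeta>. Re (cnj e ^ 2 * (g \<zeta>)\<^sup>2)) = circ_int (\<lambda>\<zeta>. 1 - 2 * (Im (cnj e * g \<zeta>))\<^sup>2)"
    by (rule circ_int_cong)
  also have "\<dots> = 2 * pi - circ_int (\<lambda>\<zeta>. 2 * (Im (cnj e * g \<zeta>))\<^sup>2)"
    by (subst circ_int_diff) (auto intro!: continuous_intros cont)
  also have "circ_int (\<lambda>\<zeta>. 2 * (Im (cnj e * g \<zeta>))\<^sup>2) = 2 * circ_int (\<lambda>\<zeta>. (Im (cnj e * g \<zeta>))\<^sup>2)"
    by (rule circ_int_linear) (auto intro!: continuous_intros cont bounded_linear_mult_right)
  also have "circ_int (\<lambda>\<zeta>. Re (cnj e ^ 2 * (g \<zeta>)\<^sup>2)) = Re (cnj e ^ 2 * circ_int (\<lambda>\<zeta>. (g \<zeta>)\<^sup>2))"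
    by (rule circ_int_linear[OF _ bounded_linear_compose[OF bounded_linear_Re bounded_linear_mult_right]])
       (intro continuous_intros cont)
  also have "cnj e ^ 2 * circ_int (\<lambda>\<zeta>. (g \<zeta>)\<^sup>2) = of_real (2 * pi * cmod b)"
  proof -
    have "(cnj e * e)\<^sup>2 = 1" using unit_mult_cnj[OF e(1)] by (simp add: mult.commute)
    moreover have "cnj e ^ 2 * circ_int (\<lambda>\<zeta>. (g \<zeta>)\<^sup>2) = 2 * pi * of_real (cmod b) * (cnj e * e)\<^sup>2"
      unfolding circ_int_sq by (subst e(2)) (simp add: power_mult_distrib mult_ac)
    ultimately show ?thesis by simp
  qed
  finally have "2 * pi * cmod b = 2 * pi - 2 * circ_int (\<lambda>\<zeta>. (Im (cnj e * g \<zeta>))\<^sup>2)" by simp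
  then have "2 * pi * cmod b \<le> 2 * pi - 2 * (pi * \<delta>\<^sup>2 / 24)" using circ_int_Im_sq[OF e(1)] by linarith
  also have "\<dots> = 2 * pi * (1 - \<delta>\<^sup>2 / 24)" by (simp add: algebra_simps)
  finally show ?thesis by (rule mult_left_le_imp_le) simp
qed

section \<open>The Jacobian of the harmonic extension at the origin\<close>

definition p where "p \<zeta> = g \<zeta> - g (- \<zeta>)"

lemma cont_neg: "continuous_on (sphere 0 1) (\<lambda>\<zeta>. g (- \<zeta>))"
  by (rule continuous_on_circle_compose[OF cont]) (auto intro!: continuous_intros)

lemma cont_p: "continuous_on (sphere 0 1) p"
  unfolding p_def by (intro continuous_intros cont cont_neg)

lemma cont_rot:
  assumes "continuous_on (sphere 0 1) f" "cmod \<xi> = 1"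
  shows "continuous_on (sphere 0 1) (\<lambda>\<zeta>. f (\<xi> * \<zeta>))"
  by (rule continuous_on_circle_compose[OF assms(1)]) (use assms(2) in \<open>auto intro!: continuous_intros simp: norm_mult\<close>)

lemma orient_axis: 
  assumes "cmod \<xi> = 1" "cmod \<eta> = 1"
  shows "orient \<xi> (\<xi> * \<eta>) (- \<xi>) = 2 * Im \<eta>" "orient \<xi> (- \<xi>) (- (\<xi> * \<eta>)) = 2 * Im \<eta>"
proof -
  have x: "\<xi> * cnj \<xi> = 1" by (rule unit_mult_cnj) fact
  have "\<xi> * \<eta> * cnj \<xi> + - \<xi> * cnj (\<xi> * \<eta>) + \<xi> * cnj (- \<xi>) = (\<xi> * cnj \<xi>) * (\<eta> - cnj \<eta> - 1)"
    "- \<xi> * cnj \<xi> + - (\<xi> * \<eta>) * cnj (- \<xi>) + \<xi> * cnj (- (\<xi> * \<eta>)) = (\<xi> * cnj \<xi>) * (\<eta> - cnj \<eta> - 1)"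
    by (simp_all add: algebra_simps)
  then show "orient \<xi> (\<xi> * \<eta>) (- \<xi>) = 2 * Im \<eta>" "orient \<xi> (- \<xi>) (- (\<xi> * \<eta>)) = 2 * Im \<eta>"
    unfolding orient_def x by simp_all
qed

text \<open>\<open>Im (cnj (p \<xi>) * p (\<xi> * \<eta>))\<close> is twice the signed area of the quadrilateral with vertices
  \<open>g \<xi>\<close>, \<open>g (\<xi> * \<eta>)\<close>, \<open>g (- \<xi>)\<close>, \<open>g (- \<xi> * \<eta>)\<close>, cut here along a diagonal.\<close>

lemma Im_chords: "Im (cnj (p \<xi>) * p (\<xi> * \<eta>)) =
    orient (g \<xi>) (g (\<xi> * \<eta>)) (g (- \<xi>)) + orient (g \<xi>) (g (- \<xi>)) (g (- (\<xi> * \<eta>)))"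
  by (simp add: p_def orient_def algebra_simps)

lemma Im_chords_nonneg:
  assumes "cmod \<xi> = 1" "cmod \<eta> = 1"
  shows "Im \<eta> * Im (cnj (p \<xi>) * p (\<xi> * \<eta>)) \<ge> 0"
proof -
  have pos: "Im (cnj (p \<xi>) * p (\<xi> * \<eta>)) \<ge> 0" if "Im \<eta> > 0" "cmod \<eta> = 1" for \<eta>
    unfolding Im_chords
    using circle_map_orient[OF circle_map, of \<xi> "\<xi> * \<eta>" "- \<xi>"] circle_map_orient[OF circle_map, of \<xi> "- \<xi>" "- (\<xi> * \<eta>)"]
      orient_axis[OF assms(1) that(2)] assms(1) that by (simp add: norm_mult)
  have odd: "p (- x) = - p x" for x by (simp add: p_def)
  consider "Im \<eta> > 0" | "Im \<eta> = 0" | "Im (- \<eta>) > 0" by fastforce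
  then show ?thesis
  proof cases
    case 3
    then have "Im (cnj (p \<xi>) * p (\<xi> * - \<eta>)) \<ge> 0" using pos[of "- \<eta>"] assms by simp
    then have "Im (cnj (p \<xi>) * p (\<xi> * \<eta>)) \<le> 0" using odd[of "\<xi> * \<eta>"] by simp
    with 3 show ?thesis by (simp add: mult_nonpos_nonpos)
  qed (use pos assms in auto)
qed

text \<open>The points \<open>\<xi>\<close>, \<open>\<xi> * \<eta>\<close> and their antipodes are
  pairwise at squared distance at least \<open>2 - 2 * 7 / 25\<close>, so all sides of the two image
  triangles have length at least \<open>\<delta>\<close> and \<open>abs_orient\<close>
  applies.\<close>

lemma Im_chords_ge:
  assumes "cmod \<xi> = 1" "cmod \<eta> = 1" "Im \<eta> > 0" "\<bar>Re \<eta>\<bar> \<le> 7 / 25"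
  shows "Im (cnj (p \<xi>) * p (\<xi> * \<eta>)) \<ge> \<delta> ^ 3"
proof -
  have d: "cmod (x - y) \<ge> 6 / 5" if "cmod x = 1" "cmod y = 1" "Re (x * cnj y) \<le> 7 / 25" for x y
    by (rule power2_le_imp_le) (use dist_unit_sq[OF that(1,2)] that(3) in \<open>auto simp: power2_eq_square\<close>)
  have x: "\<xi> * cnj \<xi> = 1" by (rule unit_mult_cnj) fact
  have e: "\<xi> * cnj (\<xi> * \<eta>) = (\<xi> * cnj \<xi>) * cnj \<eta>" "\<xi> * cnj (- (\<xi> * \<eta>)) = - ((\<xi> * cnj \<xi>) * cnj \<eta>)"
    "\<xi> * \<eta> * cnj (- \<xi>) = - ((\<xi> * cnj \<xi>) * \<eta>)" "- \<xi> * cnj (- (\<xi> * \<eta>)) = (\<xi> * cnj \<xi>) * cnj \<eta>"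
    "\<xi> * cnj (- \<xi>) = - (\<xi> * cnj \<xi>)" by simp_all
  have u: "cmod (\<xi> * \<eta>) = 1" "cmod (- \<xi>) = 1" "cmod (- (\<xi> * \<eta>)) = 1" using assms by (simp_all add: norm_mult)
  have s: "cmod (g \<xi> - g (\<xi> * \<eta>)) \<ge> \<delta>" "cmod (g (\<xi> * \<eta>) - g (- \<xi>)) \<ge> \<delta>" "cmod (g \<xi> - g (- \<xi>)) \<ge> \<delta>"
     "cmod (g (- \<xi>) - g (- (\<xi> * \<eta>))) \<ge> \<delta>" "cmod (g \<xi> - g (- (\<xi> * \<eta>))) \<ge> \<delta>"
    by (intro separation d assms u; unfold e x; use assms(4) in simp)+
  have prod3: "\<delta> ^ 3 \<le> A * B * C" if "A \<ge> \<delta>" "B \<ge> \<delta>" "C \<ge> \<delta>" for A B C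
  proof -
    have "\<delta> * \<delta> \<le> A * B" using that \<delta>_pos by (intro mult_mono) auto
    then have "(\<delta> * \<delta>) * \<delta> \<le> (A * B) * C" using that \<delta>_pos by (intro mult_mono) auto
    then show ?thesis by (simp add: power3_eq_cube)
  qed
  have o: "orient (g \<xi>) (g (\<xi> * \<eta>)) (g (- \<xi>)) > 0" "orient (g \<xi>) (g (- \<xi>)) (g (- (\<xi> * \<eta>))) > 0"
    by (rule circle_map_orient[OF circle_map]; use orient_axis[OF assms(1,2)] assms u in simp)+
  have "orient (g \<xi>) (g (\<xi> * \<eta>)) (g (- \<xi>)) \<ge> \<delta> ^ 3 / 2"
    using o(1) abs_orient[OF unit unit unit, OF assms(1) u(1,2)]
      prod3[OF s(1) s(2) s(3)] by (simp add: norm_minus_commute)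
  moreover have "orient (g \<xi>) (g (- \<xi>)) (g (- (\<xi> * \<eta>))) \<ge> \<delta> ^ 3 / 2"
    using o(2) abs_orient[OF unit unit unit, OF assms(1) u(2,3)]
      prod3[OF s(3) s(4) s(5)] by (simp add: norm_minus_commute)
  ultimately show ?thesis unfolding Im_chords by linarith
qed

text \<open>The derivative at the origin of the harmonic extension of \<open>g\<close> in the
  tangential direction \<open>\<i> * \<xi>\<close>.\<close>

definition L where "L \<xi> = c1 * (\<i> * \<xi>) + c2 * cnj (\<i> * \<xi>)"

text \<open>With \<open>\<zeta> = \<xi> * \<eta>\<close> the weight \<open>Im \<eta>\<close> is a
  combination of \<open>cnj \<zeta>\<close> and \<open>\<zeta>\<close>, so it extracts exactly the
  two Fourier coefficients. It is odd, so the two halves of \<open>p\<close> contribute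
  equally.\<close>

lemma L_eq:
  assumes "cmod \<xi> = 1"
  shows "circ_int (\<lambda>\<eta>. of_real (Im \<eta>) * p (\<xi> * \<eta>)) = 2 * pi * L \<xi>"
proof -
  have x: "\<xi> * cnj \<xi> = 1" by (rule unit_mult_cnj) fact
  have cn: "continuous_on (sphere 0 1) (\<lambda>\<eta>. complex_of_real (Im \<eta>) * g (\<xi> * \<eta>))"
    by (intro continuous_intros cont_rot cont assms)
  have cn': "continuous_on (sphere 0 1) (\<lambda>\<eta>. complex_of_real (Im \<eta>) * g (\<xi> * - \<eta>))"
    using cont_rot[OF cont_neg assms] by (intro continuous_intros) simp
  have cG: "continuous_on (sphere 0 1) (\<lambda>\<zeta>. cnj \<zeta> * g \<zeta>)" "continuous_on (sphere 0 1) (\<lambda>\<zeta>. \<zeta> * g \<zeta>)"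
    by (intro continuous_intros cont)+
  have "circ_int (\<lambda>\<eta>. of_real (Im \<eta>) * p (\<xi> * \<eta>)) =
     circ_int (\<lambda>\<eta>. of_real (Im \<eta>) * g (\<xi> * \<eta>) - of_real (Im \<eta>) * g (\<xi> * - \<eta>))"
    by (simp add: p_def algebra_simps)
  also have "\<dots> = circ_int (\<lambda>\<eta>. of_real (Im \<eta>) * g (\<xi> * \<eta>)) - circ_int (\<lambda>\<eta>. of_real (Im \<eta>) * g (\<xi> * - \<eta>))"
    by (rule circ_int_diff[OF cn cn'])
  also have "circ_int (\<lambda>\<eta>. of_real (Im \<eta>) * g (\<xi> * - \<eta>)) = - circ_int (\<lambda>\<eta>. of_real (Im \<eta>) * g (\<xi> * \<eta>))"
    using circ_int_uminus[OF cn'] circ_int_linear[OF cn bounded_linear_minus[OF bounded_linear_ident]] by simp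
  also have "circ_int (\<lambda>\<eta>. of_real (Im \<eta>) * g (\<xi> * \<eta>)) =
      circ_int (\<lambda>\<zeta>. (\<i> * \<xi> / 2) * (cnj \<zeta> * g \<zeta>) + (cnj (\<i> * \<xi>) / 2) * (\<zeta> * g \<zeta>))"
  proof -
    let ?h = "\<lambda>\<zeta>. (\<i> * \<xi> / 2) * (cnj \<zeta> * g \<zeta>) + (cnj (\<i> * \<xi>) / 2) * (\<zeta> * g \<zeta>)"
    have "circ_int ?h = circ_int (\<lambda>\<eta>. ?h (\<xi> * \<eta>))"
      by (rule circ_int_rotate[symmetric]) (intro continuous_intros cont, fact)
    also have "\<dots> = circ_int (\<lambda>\<eta>. of_real (Im \<eta>) * g (\<xi> * \<eta>))"
    proof (rule circ_int_cong)
      fix \<eta> :: complex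
      have "?h (\<xi> * \<eta>) = (\<xi> * cnj \<xi>) * (\<i> / 2 * (cnj \<eta> - \<eta>)) * g (\<xi> * \<eta>)"
        by (simp add: algebra_simps)
      also have "\<i> / 2 * (cnj \<eta> - \<eta>) = of_real (Im \<eta>)" by (simp add: complex_eq_iff)
      finally show "?h (\<xi> * \<eta>) = of_real (Im \<eta>) * g (\<xi> * \<eta>)" by (simp add: x)
    qed
    finally show ?thesis by simp
  qed
  also have "\<dots> = (\<i> * \<xi> / 2) * circ_int (\<lambda>\<zeta>. cnj \<zeta> * g \<zeta>) + (cnj (\<i> * \<xi>) / 2) * circ_int (\<lambda>\<zeta>. \<zeta> * g \<zeta>)"
    by (subst circ_int_add) (intro continuous_intros cont, intro continuous_intros cont,
       simp only: circ_int_cmult[OF cG(1)] circ_int_cmult[OF cG(2)])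
  finally show ?thesis unfolding circ_int_c1 circ_int_c2 L_def by (simp add: algebra_simps)
qed

lemma Im_L_ge:
  assumes \<xi>: "cmod \<xi> = 1"
  shows "Im (cnj (p \<xi>) * L \<xi>) \<ge> \<delta> ^ 3 / 16"
proof -
  define k where "k \<eta> = Im \<eta> * Im (cnj (p \<xi>) * p (\<xi> * \<eta>))" for \<eta>
  have ck: "continuous_on (sphere 0 1) k" unfolding k_def by (intro continuous_intros cont_rot cont_p \<xi>)
  have "circ_int k = Im (cnj (p \<xi>) * circ_int (\<lambda>\<eta>. of_real (Im \<eta>) * p (\<xi> * \<eta>)))"
  proof -
    have "circ_int k = circ_int (\<lambda>\<eta>. Im (cnj (p \<xi>) * (of_real (Im \<eta>) * p (\<xi> * \<eta>))))"
      by (rule circ_int_cong) (simp add: k_def algebra_simps)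
    also have "\<dots> = Im (cnj (p \<xi>) * circ_int (\<lambda>\<eta>. of_real (Im \<eta>) * p (\<xi> * \<eta>)))"
      by (rule circ_int_linear[OF _ bounded_linear_compose[OF bounded_linear_Im bounded_linear_mult_right]])
         (intro continuous_intros cont_rot cont_p \<xi>)
    finally show ?thesis .
  qed
  also have "\<dots> = 2 * pi * Im (cnj (p \<xi>) * L \<xi>)"
    unfolding L_eq[OF \<xi>] by (simp add: algebra_simps)
  finally have eq: "circ_int k = 2 * pi * Im (cnj (p \<xi>) * L \<xi>)" .
  \<comment> \<open>On this arc around \<open>\<i>\<close> one has
    \<open>|Re (cis x)| <= 1/4 < 7/25\<close>, so \<open>Im_chords_ge\<close> applies. Its length
    1/2 gives \<open>15 / 32 * \<delta> ^ 3\<close>, and division by \<open>44 / 7\<close> leaves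
    more than \<open>\<delta> ^ 3 / 16\<close>.\<close>
  define s where "s = pi / 2 - 1 / 4"
  define t where "t = pi / 2 + 1 / 4"
  have pi4: "pi > 3" "pi < 22 / 7" using pi_gt3 pi_approx by auto
  have "integral {s..t} (\<lambda>x. 15 / 16 * \<delta> ^ 3) \<le> integral {s..t} (\<lambda>x. k (cis x))"
  proof (rule integral_le)
    fix x assume x: "x \<in> {s..t}"
    define y where "y = pi / 2 - x"
    have y: "\<bar>y\<bar> \<le> 1 / 4" using x unfolding y_def s_def t_def by (simp only: abs_le_iff atLeastAtMost_iff) linarith
    have xy: "Re (cis x) = sin y" "Im (cis x) = cos y" by (simp_all add: y_def sin_diff cos_diff)
    have "\<bar>sin y\<bar> \<le> \<bar>y\<bar>" by (rule abs_sin_x_le_abs_x)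
    then have R: "\<bar>Re (cis x)\<bar> \<le> 1 / 4" using y xy by simp
    then have "(Re (cis x))\<^sup>2 \<le> (1 / 4)\<^sup>2" by (metis abs_le_square_iff abs_of_pos zero_less_divide_iff zero_less_one zero_less_numeral)
    then have I2: "(Im (cis x))\<^sup>2 \<ge> 15 / 16" using sin_cos_squared_add[of x] by (simp add: power2_eq_square)
    have I0: "Im (cis x) > 0" unfolding xy by (rule cos_gt_zero_pi) (use y pi4 in auto)
    have I1: "Im (cis x) \<le> 1" by simp
    have "15 / 16 \<le> (Im (cis x))\<^sup>2" by (rule I2)
    also have "\<dots> \<le> Im (cis x)" using I0 I1 unfolding power2_eq_square by (intro mult_left_le) auto
    finally have I: "15 / 16 \<le> Im (cis x)" .
    have "Im (cnj (p \<xi>) * p (\<xi> * cis x)) \<ge> \<delta> ^ 3" by (rule Im_chords_ge) (use \<xi> I0 R in auto)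
    then show "15 / 16 * \<delta> ^ 3 \<le> k (cis x)" unfolding k_def using I \<delta>_pos by (intro mult_mono) auto
  qed (auto intro: integrable_circle_cis[OF ck])
  also have "\<dots> \<le> integral {0..2 * pi} (\<lambda>x. k (cis x))"
  proof (rule integral_subset_le)
    show "{s..t} \<subseteq> {0..2 * pi}" using pi4 by (auto simp: s_def t_def)
    show "\<forall>x\<in>{0..2 * pi}. 0 \<le> k (cis x)" unfolding k_def by (intro ballI Im_chords_nonneg[OF \<xi>]) simp
  qed (intro integrable_circle_cis[OF ck])+
  finally have "15 / 32 * \<delta> ^ 3 \<le> circ_int k" by (simp add: circ_int_def s_def t_def)
  also have "\<dots> = 2 * pi * Im (cnj (p \<xi>) * L \<xi>)" by (rule eq)
  finally have h: "15 / 32 * \<delta> ^ 3 \<le> 2 * pi * Im (cnj (p \<xi>) * L \<xi>)" .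
  have "Im (cnj (p \<xi>) * L \<xi>) > 0"
    using h \<delta>_pos pi4 by (smt (verit, ccfv_SIG) zero_less_mult_pos zero_less_power divide_pos_pos mult_pos_pos)
  then have "2 * pi * Im (cnj (p \<xi>) * L \<xi>) \<le> 44 / 7 * Im (cnj (p \<xi>) * L \<xi>)"
    using pi4 by (intro mult_right_mono) auto
  then show ?thesis using h \<delta>_pos zero_less_power[OF \<delta>_pos, of 3] by linarith
qed

text \<open>The Fourier coefficients of \<open>p\<close> at 1 and -1 are twice those of
  \<open>g\<close>, so integrating \<open>Im (cnj (p \<xi>) * L \<xi>)\<close> over
  \<open>\<xi>\<close> gives \<open>4 * pi\<close> times the Jacobian, and the pointwise bound
  carries over.\<close>

lemma Jacobian_ge: "(cmod c1)\<^sup>2 - (cmod c2)\<^sup>2 \<ge> \<delta> ^ 3 / 32"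
proof -
  have cL: "continuous_on (sphere 0 1) L" unfolding L_def by (intro continuous_intros)
  have "circ_int (\<lambda>\<xi>. \<delta> ^ 3 / 16) \<le> circ_int (\<lambda>\<xi>. Im (cnj (p \<xi>) * L \<xi>))"
    by (rule circ_int_mono, intro continuous_intros, intro continuous_intros cont_p cL, rule Im_L_ge)
  also have "\<dots> = Im (circ_int (\<lambda>\<xi>. cnj (p \<xi>) * L \<xi>))"
    by (rule circ_int_linear[OF _ bounded_linear_Im]) (intro continuous_intros cont_p cL)
  also have "circ_int (\<lambda>\<xi>. cnj (p \<xi>) * L \<xi>) = (\<i> * c1) * cnj (circ_int (\<lambda>\<xi>. cnj \<xi> * p \<xi>)) + (- \<i> * c2) * cnj (circ_int (\<lambda>\<xi>. \<xi> * p \<xi>))"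
  proof -
    have "circ_int (\<lambda>\<xi>. cnj (p \<xi>) * L \<xi>) = circ_int (\<lambda>\<xi>. (\<i> * c1) * cnj (cnj \<xi> * p \<xi>) + (- \<i> * c2) * cnj (\<xi> * p \<xi>))"
      by (rule circ_int_cong) (simp add: L_def algebra_simps)
    also have "\<dots> = (\<i> * c1) * circ_int (\<lambda>\<xi>. cnj (cnj \<xi> * p \<xi>)) + (- \<i> * c2) * circ_int (\<lambda>\<xi>. cnj (\<xi> * p \<xi>))"
      by (subst circ_int_add, (intro continuous_intros cont_p)+, subst (1 2) circ_int_cmult) (rule refl | intro continuous_intros cont_p)+
    also have "circ_int (\<lambda>\<xi>. cnj (cnj \<xi> * p \<xi>)) = cnj (circ_int (\<lambda>\<xi>. cnj \<xi> * p \<xi>))"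
      by (rule circ_int_linear[OF _ bounded_linear_cnj]) (intro continuous_intros cont_p)
    also have "circ_int (\<lambda>\<xi>. cnj (\<xi> * p \<xi>)) = cnj (circ_int (\<lambda>\<xi>. \<xi> * p \<xi>))"
      by (rule circ_int_linear[OF _ bounded_linear_cnj]) (intro continuous_intros cont_p)
    finally show ?thesis .
  qed
  also have "circ_int (\<lambda>\<xi>. cnj \<xi> * p \<xi>) = 4 * pi * c1"
  proof -
    have c: "continuous_on (sphere 0 1) (\<lambda>\<xi>. cnj \<xi> * g \<xi>)" by (intro continuous_intros cont)
    have c': "continuous_on (sphere 0 1) (\<lambda>\<xi>. cnj (- \<xi>) * g (- \<xi>))" by (intro continuous_intros cont_neg)
    have "circ_int (\<lambda>\<xi>. cnj \<xi> * p \<xi>) = circ_int (\<lambda>\<xi>. cnj \<xi> * g \<xi> + cnj (- \<xi>) * g (- \<xi>))"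
      by (rule circ_int_cong) (simp add: p_def algebra_simps)
    then show ?thesis unfolding circ_int_add[OF c c'] circ_int_uminus[OF c] circ_int_c1 by simp
  qed
  also have "circ_int (\<lambda>\<xi>. \<xi> * p \<xi>) = 4 * pi * c2"
  proof -
    have c: "continuous_on (sphere 0 1) (\<lambda>\<xi>. \<xi> * g \<xi>)" by (intro continuous_intros cont)
    have c': "continuous_on (sphere 0 1) (\<lambda>\<xi>. (- \<xi>) * g (- \<xi>))" by (intro continuous_intros cont_neg)
    have "circ_int (\<lambda>\<xi>. \<xi> * p \<xi>) = circ_int (\<lambda>\<xi>. \<xi> * g \<xi> + (- \<xi>) * g (- \<xi>))"
      by (rule circ_int_cong) (simp add: p_def algebra_simps)
    then show ?thesis unfolding circ_int_add[OF c c'] circ_int_uminus[OF c] circ_int_c2 by simp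
  qed
  also have "Im ((\<i> * c1) * cnj (4 * pi * c1) + (- \<i> * c2) * cnj (4 * pi * c2)) = 4 * pi * ((cmod c1)\<^sup>2 - (cmod c2)\<^sup>2)"
    unfolding cmod_power2 by (simp add: power2_eq_square algebra_simps)
  finally have "2 * pi * (\<delta> ^ 3 / 16) \<le> 4 * pi * ((cmod c1)\<^sup>2 - (cmod c2)\<^sup>2)" by simp
  then have "2 * pi * (\<delta> ^ 3 / 16) \<le> 2 * pi * (2 * ((cmod c1)\<^sup>2 - (cmod c2)\<^sup>2))" by (simp add: algebra_simps)
  then have "\<delta> ^ 3 / 16 \<le> 2 * ((cmod c1)\<^sup>2 - (cmod c2)\<^sup>2)"
    by (rule mult_left_le_imp_le) simp
  then show ?thesis by simp
qed

section \<open>The linearised barycentre equation\<close>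

lemma norm_b_less_1: "cmod b < 1"
  using norm_b \<delta>_pos by (smt (verit) zero_less_power divide_pos_pos)

text \<open>First-order Taylor expansion in \<open>z\<close> and \<open>w\<close> with an explicit
  quadratic remainder, uniform in \<open>\<gamma>\<close> and \<open>\<zeta>\<close>; the derivative
  of the implicitly defined extension is read off from it. The second estimate is the zeroth-order
  one for the kernel alone.\<close>

lemma integrand_expansion:
  assumes u: "cmod \<gamma> = 1" "cmod \<zeta> = 1" and z: "cmod z \<le> 1 / 2" and w: "cmod w \<le> 1 / 2"
  shows "cmod (poisson z \<zeta> *\<^sub>R disk_mob w \<gamma> - (\<gamma> - w + cnj w * \<gamma>\<^sup>2 + of_real (2 * Re (z * cnj \<zeta>)) * \<gamma>))
    \<le> 8 * (cmod z + cmod w)\<^sup>2"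
    and "\<bar>1 - poisson z \<zeta>\<bar> \<le> 4 * cmod z"
proof -
  define s where "s = cnj z * \<zeta>"
  have s: "cmod s = cmod z" using u by (simp add: s_def norm_mult)
  have half: "cmod (1 - x) \<ge> 1 / 2" if "cmod x \<le> 1 / 2" for x
    using norm_triangle_ineq2[of 1 x] that by simp
  have n1: "cmod (1 - s) \<ge> 1 / 2" using half s z by simp
  then have s1: "1 - s \<noteq> 0" by auto
  have n2: "cmod (1 - cnj w * \<gamma>) \<ge> 1 / 2" by (rule half) (use w u in \<open>simp add: norm_mult\<close>)
  then have w1: "1 - cnj w * \<gamma> \<noteq> 0" by auto
  have Res: "Re s = Re (z * cnj \<zeta>)" by (simp add: s_def)
  have div2: "cmod (x / y) \<le> 2 * cmod x" if "cmod y \<ge> 1 / 2" for x y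
  proof -
    have "cmod x / cmod y \<le> cmod x / (1 / 2)" using that by (intro divide_left_mono) auto
    then show ?thesis by (simp add: norm_divide)
  qed
  have P: "poisson z \<zeta> = 1 + 2 * Re (s / (1 - s))"
  proof -
    have "cmod (z - \<zeta>) = cmod (1 - s)"
      using cmod_disk_mob_denom[OF u(2), of z] by (simp add: s_def norm_minus_commute)
    then have "poisson z \<zeta> = (1 - (cmod s)\<^sup>2) / (cmod (1 - s))\<^sup>2" by (simp add: poisson_def s)
    also have "1 - (cmod s)\<^sup>2 = (cmod (1 - s))\<^sup>2 + 2 * (Re s - (cmod s)\<^sup>2)"
      unfolding cmod_power2 by (simp add: power2_eq_square algebra_simps)
    also have "\<dots> / (cmod (1 - s))\<^sup>2 = 1 + 2 * ((Re s - (cmod s)\<^sup>2) / (cmod (1 - s))\<^sup>2)"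
      using s1 by (simp add: field_simps)
    also have "(Re s - (cmod s)\<^sup>2) / (cmod (1 - s))\<^sup>2 = Re (s / (1 - s))"
      unfolding cmod_power2 Re_divide by (simp add: power2_eq_square algebra_simps)
    finally show ?thesis .
  qed
  have E2: "\<bar>poisson z \<zeta> - 1 - 2 * Re s\<bar> \<le> 4 * (cmod z)\<^sup>2"
  proof -
    have "s / (1 - s) = s + s\<^sup>2 / (1 - s)" using s1 by (simp add: field_simps power2_eq_square)
    then have "Re (s / (1 - s)) = Re s + Re (s\<^sup>2 / (1 - s))" by simp
    then have "\<bar>poisson z \<zeta> - 1 - 2 * Re s\<bar> = 2 * \<bar>Re (s\<^sup>2 / (1 - s))\<bar>" unfolding P by simp
    also have "\<dots> \<le> 2 * (2 * cmod (s\<^sup>2))"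
      by (intro mult_left_mono order.trans[OF abs_Re_le_cmod div2[OF n1]]) simp
    finally show ?thesis by (simp add: norm_power s)
  qed
  show "\<bar>1 - poisson z \<zeta>\<bar> \<le> 4 * cmod z"
  proof -
    have "\<bar>1 - poisson z \<zeta>\<bar> = 2 * \<bar>Re (s / (1 - s))\<bar>" unfolding P by simp
    also have "\<dots> \<le> 2 * (2 * cmod s)"
      by (intro mult_left_mono order.trans[OF abs_Re_le_cmod div2[OF n1]]) simp
    finally show ?thesis by (simp add: s)
  qed
  define M where "M = disk_mob w \<gamma>"
  have uM: "cmod M = 1" unfolding M_def by (rule disk_mob_unit) (use w u in auto)
  have E1: "cmod (M - (\<gamma> - w + cnj w * \<gamma>\<^sup>2)) \<le> 4 * (cmod w)\<^sup>2"
  proof -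
    have "M - (\<gamma> - w + cnj w * \<gamma>\<^sup>2) = cnj w * (cnj w * \<gamma> ^ 3 - w * \<gamma>) / (1 - cnj w * \<gamma>)"
      unfolding M_def disk_mob_def using w1 by (simp add: field_simps power2_eq_square power3_eq_cube)
    then have "cmod (M - (\<gamma> - w + cnj w * \<gamma>\<^sup>2)) \<le> 2 * cmod (cnj w * (cnj w * \<gamma> ^ 3 - w * \<gamma>))"
      using div2[OF n2] by simp
    also have "\<dots> \<le> 2 * (cmod w * (2 * cmod w))"
      unfolding norm_mult complex_mod_cnj
      by (intro mult_left_mono order.trans[OF norm_triangle_ineq4]) (use u in \<open>auto simp: norm_mult norm_power\<close>)
    finally show ?thesis by (simp add: power2_eq_square)
  qed
  have R: "\<bar>Re s\<bar> \<le> cmod z" using abs_Re_le_cmod[of s] s by simp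
  \<comment> \<open>The error splits into the remainder of the kernel, the remainder of the
    automorphism and the product of the two first-order terms; each is quadratic.\<close>
  have "poisson z \<zeta> *\<^sub>R M - (\<gamma> - w + cnj w * \<gamma>\<^sup>2 + of_real (2 * Re s) * \<gamma>) =
      of_real (poisson z \<zeta> - 1 - 2 * Re s) * M + of_real (1 + 2 * Re s) * (M - (\<gamma> - w + cnj w * \<gamma>\<^sup>2))
      + of_real (2 * Re s) * (cnj w * \<gamma>\<^sup>2 - w)"
    by (simp add: scaleR_conv_of_real algebra_simps)
  also have "cmod \<dots> \<le> 4 * (cmod z)\<^sup>2 * 1 + 2 * (4 * (cmod w)\<^sup>2) + (2 * cmod z) * (2 * cmod w)"
  proof (intro order.trans[OF norm_triangle_ineq] add_mono)
    show "cmod (of_real (poisson z \<zeta> - 1 - 2 * Re s) * M) \<le> 4 * (cmod z)\<^sup>2 * 1"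
      unfolding norm_mult norm_of_real uM using E2 by simp
    have "\<bar>1 + 2 * Re s\<bar> \<le> 2" using R z by linarith
    then show "cmod (of_real (1 + 2 * Re s) * (M - (\<gamma> - w + cnj w * \<gamma>\<^sup>2))) \<le> 2 * (4 * (cmod w)\<^sup>2)"
      unfolding norm_mult norm_of_real using E1 by (intro mult_mono) auto
    have "cmod (cnj w * \<gamma>\<^sup>2 - w) \<le> 2 * cmod w"
      using norm_triangle_ineq4[of "cnj w * \<gamma>\<^sup>2" w] u by (simp add: norm_mult norm_power)
    then show "cmod (of_real (2 * Re s) * (cnj w * \<gamma>\<^sup>2 - w)) \<le> (2 * cmod z) * (2 * cmod w)"
      unfolding norm_mult norm_of_real using R by (intro mult_mono) auto
  qed
  also have "\<dots> \<le> 8 * (cmod z + cmod w)\<^sup>2"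
  proof -
    have "8 * (cmod z + cmod w)\<^sup>2 - (4 * (cmod z)\<^sup>2 * 1 + 2 * (4 * (cmod w)\<^sup>2) + (2 * cmod z) * (2 * cmod w)) =
      4 * (cmod z)\<^sup>2 + 12 * (cmod z * cmod w)" by (simp add: power2_eq_square algebra_simps)
    moreover have "\<dots> \<ge> 0" by simp
    ultimately show ?thesis by linarith
  qed
  finally show "cmod (poisson z \<zeta> *\<^sub>R disk_mob w \<gamma> - (\<gamma> - w + cnj w * \<gamma>\<^sup>2 + of_real (2 * Re (z * cnj \<zeta>)) * \<gamma>))
    \<le> 8 * (cmod z + cmod w)\<^sup>2" by (simp add: M_def Res)
qed

lemma bary_linearised:
  assumes bary: "bary g z w" and z: "cmod z \<le> 1 / 2" and w: "cmod w \<le> 1 / 2"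
  shows "cmod (cnj w * b - w + (c1 * z + c2 * cnj z)) \<le> 8 * (cmod z + cmod w)\<^sup>2"
proof -
  define l where "l \<zeta> = g \<zeta> - w + cnj w * (g \<zeta>)\<^sup>2 + of_real (2 * Re (z * cnj \<zeta>)) * g \<zeta>" for \<zeta>
  have cl: "continuous_on (sphere 0 1) l" unfolding l_def by (intro continuous_intros cont)
  have ci: "continuous_on (sphere 0 1) (\<lambda>\<zeta>. poisson z \<zeta> *\<^sub>R disk_mob w (g \<zeta>))"
    by (rule continuous_on_bary_integrand[OF circle_map]) (use z w in auto)
  have "circ_int l = 2 * pi * (cnj w * b - w + (c1 * z + c2 * cnj z))"
  proof -
    have c: "continuous_on (sphere 0 1) g" "continuous_on (sphere 0 1) (\<lambda>\<zeta>. cnj w * (g \<zeta>)\<^sup>2)"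
      "continuous_on (sphere 0 1) (\<lambda>\<zeta>. (g \<zeta>)\<^sup>2)" "continuous_on (sphere 0 1) (\<lambda>\<zeta>. w)"
      "continuous_on (sphere 0 1) (\<lambda>\<zeta>. cnj \<zeta> * g \<zeta>)" "continuous_on (sphere 0 1) (\<lambda>\<zeta>. \<zeta> * g \<zeta>)"
      "continuous_on (sphere 0 1) (\<lambda>\<zeta>. z * (cnj \<zeta> * g \<zeta>))" "continuous_on (sphere 0 1) (\<lambda>\<zeta>. cnj z * (\<zeta> * g \<zeta>))"
      "continuous_on (sphere 0 1) (\<lambda>\<zeta>. g \<zeta> - w)" "continuous_on (sphere 0 1) (\<lambda>\<zeta>. g \<zeta> - w + cnj w * (g \<zeta>)\<^sup>2)"
      "continuous_on (sphere 0 1) (\<lambda>\<zeta>. z * (cnj \<zeta> * g \<zeta>) + cnj z * (\<zeta> * g \<zeta>))"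
      by (intro continuous_intros cont)+
    have "l \<zeta> = (g \<zeta> - w + cnj w * (g \<zeta>)\<^sup>2) + (z * (cnj \<zeta> * g \<zeta>) + cnj z * (\<zeta> * g \<zeta>))" for \<zeta>
    proof -
      have "of_real (2 * Re (z * cnj \<zeta>)) = z * cnj \<zeta> + cnj z * \<zeta>" by (simp add: complex_eq_iff)
      then show ?thesis by (simp add: l_def algebra_simps)
    qed
    then have "circ_int l = circ_int (\<lambda>\<zeta>. (g \<zeta> - w + cnj w * (g \<zeta>)\<^sup>2) + (z * (cnj \<zeta> * g \<zeta>) + cnj z * (\<zeta> * g \<zeta>)))"
      by (intro circ_int_cong)
    also have "\<dots> = (circ_int g - circ_int (\<lambda>\<zeta>. w) + cnj w * circ_int (\<lambda>\<zeta>. (g \<zeta>)\<^sup>2)) +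
        (z * circ_int (\<lambda>\<zeta>. cnj \<zeta> * g \<zeta>) + cnj z * circ_int (\<lambda>\<zeta>. \<zeta> * g \<zeta>))"
      unfolding circ_int_add[OF c(10,11)] circ_int_add[OF c(9,2)] circ_int_add[OF c(7,8)] circ_int_diff[OF c(1,4)]
        circ_int_cmult[OF c(3)] circ_int_cmult[OF c(5)] circ_int_cmult[OF c(6)] ..
    finally show ?thesis unfolding mean_zero circ_int_sq circ_int_c1 circ_int_c2 circ_int_const
      by (simp add: scaleR_conv_of_real algebra_simps)
  qed
  moreover have "circ_int (\<lambda>\<zeta>. poisson z \<zeta> *\<^sub>R disk_mob w (g \<zeta>) - l \<zeta>) = - circ_int l"
    using circ_int_diff[OF ci cl] bary by (simp add: bary_def)
  moreover have "cmod (circ_int (\<lambda>\<zeta>. poisson z \<zeta> *\<^sub>R disk_mob w (g \<zeta>) - l \<zeta>)) \<le> 2 * pi * (8 * (cmod z + cmod w)\<^sup>2)"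
    by (rule norm_circ_int_le, intro continuous_intros ci cl, unfold l_def, rule integrand_expansion(1)) (use unit z w in auto)
  ultimately have "2 * pi * cmod (cnj w * b - w + (c1 * z + c2 * cnj z)) \<le> 2 * pi * (8 * (cmod z + cmod w)\<^sup>2)"
    by (simp add: norm_mult)
  then show ?thesis by (rule mult_left_le_imp_le) simp
qed

text \<open>The displacement identity of the uniqueness proof, made quantitative: its mean is at
  least a multiple of \<open>|w|^2\<close> by the second moment, and at most a multiple of
  \<open>|z| * |w|\<close> because the kernel differs from 1 by at most \<open>4 * |z|\<close>. This
  a priori bound brings \<open>w\<close> into the range of the expansion.\<close>

lemma bary_Lipschitz:
  assumes bary: "bary g z w" and z: "cmod z \<le> 1 / 2"
  shows "cmod w \<le> 384 / \<delta>\<^sup>2 * cmod z"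
proof (cases "w = 0")
  case False
  have w: "cmod w < 1" using bary by (simp add: bary_def)
  have z1: "cmod z < 1" using z by simp
  define e where "e = w / of_real (cmod w)"
  have e: "cmod e = 1" "w = of_real (cmod w) * e" using False by (simp_all add: e_def norm_divide)
  have cm: "continuous_on (sphere 0 1) (\<lambda>\<zeta>. disk_mob w (g \<zeta>))"
    by (intro continuous_on_disk_mob_comp cont w) (use unit in auto)
  define m where "m \<zeta> = Re (cnj w * disk_mob w (g \<zeta>))" for \<zeta>
  have c: "continuous_on (sphere 0 1) m" "continuous_on (sphere 0 1) (poisson z)"
    "continuous_on (sphere 0 1) (\<lambda>\<zeta>. Re (cnj w * g \<zeta>))" "continuous_on (sphere 0 1) (\<lambda>\<zeta>. Re (cnj w * g \<zeta>) - m \<zeta>)"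
    "continuous_on (sphere 0 1) (\<lambda>\<zeta>. (Im (cnj e * g \<zeta>))\<^sup>2)" "continuous_on (sphere 0 1) (\<lambda>\<zeta>. poisson z \<zeta> * m \<zeta>)"
    unfolding m_def by (intro continuous_intros cm continuous_on_poisson[OF z1] cont)+
  have i0: "circ_int (\<lambda>\<zeta>. Re (cnj w * g \<zeta>)) = 0"
    using circ_int_linear[OF cont bounded_linear_compose[OF bounded_linear_Re bounded_linear_mult_right[of "cnj w"]]]
    by (simp add: mean_zero)
  have iP: "circ_int (\<lambda>\<zeta>. poisson z \<zeta> * m \<zeta>) = 0"
  proof -
    have "circ_int (\<lambda>\<zeta>. poisson z \<zeta> * m \<zeta>) = circ_int (\<lambda>\<zeta>. Re (cnj w * (poisson z \<zeta> *\<^sub>R disk_mob w (g \<zeta>))))"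
      by (rule circ_int_cong) (simp add: m_def algebra_simps)
    also have "\<dots> = Re (cnj w * circ_int (\<lambda>\<zeta>. poisson z \<zeta> *\<^sub>R disk_mob w (g \<zeta>)))"
      by (rule circ_int_linear[OF continuous_on_bary_integrand bounded_linear_compose[OF bounded_linear_Re bounded_linear_mult_right]])
         (use circle_map z1 w in auto)
    finally show ?thesis using bary by (simp add: bary_def)
  qed
  have lower: "(cmod w)\<^sup>2 / 2 * (Im (cnj e * g \<zeta>))\<^sup>2 \<le> Re (cnj w * g \<zeta>) - m \<zeta>" if u: "cmod \<zeta> = 1" for \<zeta>
  proof -
    have n0: "1 - cnj w * g \<zeta> \<noteq> 0" using disk_mob_denom_nonzero[OF w] unit[OF u] by simp
    have "cmod (1 - cnj w * g \<zeta>) \<le> 2"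
      using norm_triangle_ineq4[of 1 "cnj w * g \<zeta>"] unit[OF u] w by (simp add: norm_mult)
    then have n2: "(cmod (1 - cnj w * g \<zeta>))\<^sup>2 \<le> 4" using power_mono[of "cmod (1 - cnj w * g \<zeta>)" 2 2] by simp
    have "Im (cnj w * g \<zeta>) = cmod w * Im (cnj e * g \<zeta>)" by (subst e(2)) (simp add: algebra_simps)
    then have "(cmod w)\<^sup>2 / 2 * (Im (cnj e * g \<zeta>))\<^sup>2 = 2 * (Im (cnj w * g \<zeta>))\<^sup>2 / 4" by (simp add: power_mult_distrib)
    also have "\<dots> \<le> 2 * (Im (cnj w * g \<zeta>))\<^sup>2 / (cmod (1 - cnj w * g \<zeta>))\<^sup>2"
      using n0 n2 by (intro divide_left_mono) auto
    also have "\<dots> = Re (cnj w * (g \<zeta> - disk_mob w (g \<zeta>)))" by (rule Re_cnj_diff_disk_mob[symmetric]) (use unit[OF u] w in auto)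
    finally show ?thesis by (simp add: m_def algebra_simps)
  qed
  have "(cmod w)\<^sup>2 / 2 * (pi * \<delta>\<^sup>2 / 24) \<le> (cmod w)\<^sup>2 / 2 * circ_int (\<lambda>\<zeta>. (Im (cnj e * g \<zeta>))\<^sup>2)"
    by (intro mult_left_mono circ_int_Im_sq e) simp
  also have "\<dots> = circ_int (\<lambda>\<zeta>. (cmod w)\<^sup>2 / 2 * (Im (cnj e * g \<zeta>))\<^sup>2)"
    by (rule circ_int_linear[OF c(5) bounded_linear_mult_right, symmetric])
  also have "\<dots> \<le> circ_int (\<lambda>\<zeta>. Re (cnj w * g \<zeta>) - m \<zeta>)"
    by (rule circ_int_mono[OF _ c(4) lower]) (intro continuous_intros c)
  also have "\<dots> = circ_int (\<lambda>\<zeta>. poisson z \<zeta> * m \<zeta>) - circ_int m"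
    unfolding circ_int_diff[OF c(3,1)] i0 iP ..
  also have "\<dots> = circ_int (\<lambda>\<zeta>. poisson z \<zeta> * m \<zeta> - m \<zeta>)" by (rule circ_int_diff[OF c(6,1), symmetric])
  also have "\<dots> \<le> norm (circ_int (\<lambda>\<zeta>. poisson z \<zeta> * m \<zeta> - m \<zeta>))" by simp
  also have "\<dots> \<le> 2 * pi * (4 * cmod z * cmod w)"
  proof (rule norm_circ_int_le)
    fix \<zeta> :: complex assume u: "cmod \<zeta> = 1"
    have "\<bar>m \<zeta>\<bar> \<le> cmod w"
      using abs_Re_le_cmod[of "cnj w * disk_mob w (g \<zeta>)"] disk_mob_unit[OF w unit[OF u]] by (simp add: m_def norm_mult)
    moreover have "\<bar>1 - poisson z \<zeta>\<bar> \<le> 4 * cmod z" by (rule integrand_expansion(2)[of 1 _ _ 0]) (use u z in auto)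
    ultimately have "\<bar>1 - poisson z \<zeta>\<bar> * \<bar>m \<zeta>\<bar> \<le> 4 * cmod z * cmod w" by (intro mult_mono) auto
    moreover have "poisson z \<zeta> * m \<zeta> - m \<zeta> = - ((1 - poisson z \<zeta>) * m \<zeta>)" by (simp add: algebra_simps)
    ultimately show "norm (poisson z \<zeta> * m \<zeta> - m \<zeta>) \<le> 4 * cmod z * cmod w" by (simp add: abs_mult)
  qed (intro continuous_intros c)
  finally have "(pi * cmod w / 48) * (cmod w * \<delta>\<^sup>2) \<le> (pi * cmod w / 48) * (384 * cmod z)"
    by (simp add: power2_eq_square algebra_simps)
  then have "cmod w * \<delta>\<^sup>2 \<le> 384 * cmod z" by (rule mult_left_le_imp_le) (use False in simp)
  then show ?thesis using \<delta>_pos by (simp add: field_simps)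
qed simp

text \<open>The equation \<open>w - b * cnj w = c1 * z + c2 * cnj z\<close> solved for
  \<open>w\<close>, by adding \<open>b\<close> times its conjugate.\<close>

definition \<alpha> where "\<alpha> = (c1 + b * cnj c2) / (1 - (cmod b)\<^sup>2)"
definition \<beta> where "\<beta> = (c2 + b * cnj c1) / (1 - (cmod b)\<^sup>2)"

lemma bary_second_order:
  assumes bary: "bary g z w" and z: "cmod z \<le> 1 / 2" and w: "cmod w \<le> 1 / 2"
  shows "cmod (w - (\<alpha> * z + \<beta> * cnj z)) \<le> 16 * (1 + 384 / \<delta>\<^sup>2)\<^sup>2 / (1 - (cmod b)\<^sup>2) * (cmod z)\<^sup>2"
proof -
  define D where "D = 1 - (cmod b)\<^sup>2"
  have D: "D > 0" using norm_b_less_1 by (simp add: D_def abs_square_less_1)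
  have Dc: "complex_of_real D = 1 - b * cnj b" unfolding D_def of_real_diff complex_norm_square by simp
  define r where "r = cnj w * b - w + (c1 * z + c2 * cnj z)"
  have "cmod r \<le> 8 * (cmod z + cmod w)\<^sup>2" unfolding r_def by (rule bary_linearised[OF assms])
  also have "\<dots> \<le> 8 * (cmod z + 384 / \<delta>\<^sup>2 * cmod z)\<^sup>2"
    using bary_Lipschitz[OF bary z] by (intro mult_left_mono power_mono add_left_mono) auto
  also have "\<dots> = 8 * (1 + 384 / \<delta>\<^sup>2)\<^sup>2 * (cmod z)\<^sup>2" by (simp add: power_mult_distrib[symmetric] algebra_simps)
  finally have r: "cmod r \<le> 8 * (1 + 384 / \<delta>\<^sup>2)\<^sup>2 * (cmod z)\<^sup>2" .
  have "of_real D * w = (c1 + b * cnj c2) * z + (c2 + b * cnj c1) * cnj z - (r + b * cnj r)"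
    unfolding Dc r_def by (simp add: algebra_simps)
  then have "w = ((c1 + b * cnj c2) * z + (c2 + b * cnj c1) * cnj z - (r + b * cnj r)) / of_real D"
    using D by (metis nonzero_mult_div_cancel_left of_real_eq_0_iff less_irrefl)
  moreover have "\<alpha> = (c1 + b * cnj c2) / of_real D" "\<beta> = (c2 + b * cnj c1) / of_real D"
    by (simp_all add: \<alpha>_def \<beta>_def D_def)
  ultimately have "w = \<alpha> * z + \<beta> * cnj z - (r + b * cnj r) / of_real D"
    by (simp add: add_divide_distrib diff_divide_distrib distrib_right)
  then have "cmod (w - (\<alpha> * z + \<beta> * cnj z)) = cmod (r + b * cnj r) / D"
    using D by (metis add_diff_cancel_left' diff_diff_eq2 add.commute minus_diff_eq norm_minus_cancel norm_divide norm_of_real abs_of_pos diff_add_cancel)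
  also have "\<dots> \<le> (2 * cmod r) / D"
  proof (rule divide_right_mono)
    have "cmod b * cmod r \<le> 1 * cmod r" using norm_b_less_1 by (intro mult_right_mono) auto
    then show "cmod (r + b * cnj r) \<le> 2 * cmod r"
      using norm_triangle_ineq[of r "b * cnj r"] by (simp add: norm_mult)
  qed (use D in simp)
  also have "\<dots> \<le> (2 * (8 * (1 + 384 / \<delta>\<^sup>2)\<^sup>2 * (cmod z)\<^sup>2)) / D"
    using r D by (intro divide_right_mono mult_left_mono) auto
  finally show ?thesis by (simp add: D_def)
qed

lemma bary_has_derivative:
  assumes f: "\<And>z. cmod z < 1 \<Longrightarrow> bary g z (f z)"
  shows "(f has_derivative (\<lambda>z. \<alpha> * z + \<beta> * cnj z)) (at 0)"
proof -
  define C where "C = 384 / \<delta>\<^sup>2"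
  have C: "C > 0" using \<delta>_pos by (simp add: C_def)
  define K where "K = 16 * (1 + 384 / \<delta>\<^sup>2)\<^sup>2 / (1 - (cmod b)\<^sup>2)"
  have f0: "f 0 = 0" using bary_Lipschitz[OF f[of 0]] by simp
  \<comment> \<open>The second entry lets the Lipschitz bound yield \<open>|f y| <= 1/2\<close>, the
    range of the expansion.\<close>
  define \<epsilon> where "\<epsilon> = min (1 / 2) (1 / (2 * C))"
  have e: "\<epsilon> > 0" using C by (simp add: \<epsilon>_def)
  show ?thesis
  proof (rule has_derivativeI_sandwich[of \<epsilon> _ _ _ _ "\<lambda>z. K * cmod z"])
    show "bounded_linear (\<lambda>z. \<alpha> * z + \<beta> * cnj z)"
      by (intro bounded_linear_add bounded_linear_mult_right bounded_linear_compose[OF bounded_linear_mult_right bounded_linear_cnj])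
    show "((\<lambda>z. K * cmod z) \<longlongrightarrow> 0) (at 0)" by (auto intro!: tendsto_eq_intros)
    fix y :: complex assume y: "y \<noteq> 0" "dist y 0 < \<epsilon>"
    then have y2: "cmod y \<le> 1 / 2" "cmod y \<le> 1 / (2 * C)" by (auto simp: \<epsilon>_def)
    have b1: "bary g y (f y)" using f y2 by simp
    have "cmod (f y) \<le> C * cmod y" using bary_Lipschitz[OF b1 y2(1)] by (simp add: C_def)
    also have "\<dots> \<le> C * (1 / (2 * C))" using y2 C by (intro mult_left_mono) auto
    finally have "cmod (f y) \<le> 1 / 2" using C by simp
    from bary_second_order[OF b1 y2(1) this]
    have "cmod (f y - (\<alpha> * y + \<beta> * cnj y)) \<le> K * (cmod y)\<^sup>2" by (simp add: K_def)
    then show "norm (f y - f 0 - (\<alpha> * (y - 0) + \<beta> * cnj (y - 0))) / norm (y - 0) \<le> K * cmod y"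
      using y(1) by (simp add: f0 field_simps power2_eq_square)
  qed (use e in auto)
qed

text \<open>The identity \<open>J\<close> multiplies the lower bounds \<open>\<delta>^2 / 24\<close>
  and \<open>\<delta>^3 / 32\<close>. Expanding the quotient by \<open>|A| + |B| <= 4\<close> then
  gives \<open>16 * 24 * 32 = 12288\<close>.\<close>

lemma dilatation_bound: "cmod \<beta> < cmod \<alpha>" "(cmod \<alpha> + cmod \<beta>) / (cmod \<alpha> - cmod \<beta>) \<le> 12288 / \<delta> ^ 5"
proof -
  define D where "D = 1 - (cmod b)\<^sup>2"
  define A where "A = c1 + b * cnj c2"
  define B where "B = c2 + b * cnj c1"
  have bb: "cmod b * cmod b \<le> cmod b * 1" using norm_b_less_1 by (intro mult_left_mono) auto
  have D1: "D \<ge> \<delta>\<^sup>2 / 24" using norm_b bb by (simp add: D_def power2_eq_square)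
  have d2: "\<delta>\<^sup>2 / 24 > 0" using \<delta>_pos by simp
  have D: "D > 0" using D1 d2 by linarith
  have J: "(cmod A)\<^sup>2 - (cmod B)\<^sup>2 = D * ((cmod c1)\<^sup>2 - (cmod c2)\<^sup>2)"
  proof -
    have "complex_of_real ((cmod A)\<^sup>2 - (cmod B)\<^sup>2) = of_real (D * ((cmod c1)\<^sup>2 - (cmod c2)\<^sup>2))"
      unfolding D_def of_real_diff of_real_mult complex_norm_square of_real_1 by (simp add: A_def B_def algebra_simps)
    then show ?thesis using of_real_eq_iff by blast
  qed
  have "\<delta>\<^sup>2 / 24 * (\<delta> ^ 3 / 32) \<le> D * ((cmod c1)\<^sup>2 - (cmod c2)\<^sup>2)"
    using D1 Jacobian_ge \<delta>_pos D by (intro mult_mono) auto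
  then have J1: "\<delta> ^ 5 / 768 \<le> (cmod A)\<^sup>2 - (cmod B)\<^sup>2" unfolding J by (simp add: power_numeral_reduce)
  have d5: "\<delta> ^ 5 > 0" using \<delta>_pos by simp
  then have "(cmod B)\<^sup>2 < (cmod A)\<^sup>2" using J1 by linarith
  then have BA: "cmod B < cmod A" by (rule power2_less_imp_less) simp
  have al: "\<alpha> = A / of_real D" "\<beta> = B / of_real D"
    unfolding \<alpha>_def \<beta>_def A_def B_def D_def by simp_all
  have n: "cmod \<alpha> = cmod A / D" "cmod \<beta> = cmod B / D" using D by (simp_all add: al norm_divide)
  show "cmod \<beta> < cmod \<alpha>" unfolding n using BA D by (simp add: divide_strict_right_mono)
  have le2: "cmod (x + b * cnj y) \<le> 2" if "cmod x \<le> 1" "cmod y \<le> 1" for x y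
  proof -
    have "cmod b * cmod y \<le> 1 * 1" using norm_b_less_1 that by (intro mult_mono) auto
    then show ?thesis using norm_triangle_ineq[of x "b * cnj y"] that by (simp add: norm_mult)
  qed
  have "cmod A \<le> 2" "cmod B \<le> 2" unfolding A_def B_def using le2 norm_c1 norm_c2 by auto
  then have s4: "(cmod A + cmod B)\<^sup>2 \<le> 4\<^sup>2" by (intro power_mono) auto
  have "(cmod \<alpha> + cmod \<beta>) / (cmod \<alpha> - cmod \<beta>) = (cmod A + cmod B) / (cmod A - cmod B)"
    unfolding n add_divide_distrib[symmetric] diff_divide_distrib[symmetric] using D by simp
  also have "\<dots> = (cmod A + cmod B)\<^sup>2 / ((cmod A)\<^sup>2 - (cmod B)\<^sup>2)"
    using BA by (smt (verit) norm_ge_zero power2_eq_square square_diff_square_factored mult_divide_mult_cancel_left)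
  also have "\<dots> \<le> 16 / (\<delta> ^ 5 / 768)"
    using s4 J1 d5 by (intro frac_le) auto
  finally show "(cmod \<alpha> + cmod \<beta>) / (cmod \<alpha> - cmod \<beta>) \<le> 12288 / \<delta> ^ 5" by simp
qed

end

text \<open>Near \<open>z\<close> the extension is the centred one between two automorphisms. These
  are conformal, so both coefficients are multiplied by numbers of the same modulus and the quotient
  is unaffected.\<close>

lemma de_disk_has_derivative:
  assumes g: "circle_map g" and z: "cmod z < 1" and bz: "bary g z w" and d: "\<delta> > 0"
    and sep: "\<And>p q. cmod p = 1 \<Longrightarrow> cmod q = 1 \<Longrightarrow> cmod (p - q) \<ge> 6 / 5 \<Longrightarrow>
      cmod ((disk_mob w \<circ> g \<circ> disk_mob (- z)) p - (disk_mob w \<circ> g \<circ> disk_mob (- z)) q) \<ge> \<delta>"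
  obtains A B where "(de_disk g has_derivative (\<lambda>h. A * h + B * cnj h)) (at z)"
    "cmod B < cmod A" "(cmod A + cmod B) / (cmod A - cmod B) \<le> 12288 / \<delta> ^ 5"
proof -
  define G where "G = disk_mob w \<circ> g \<circ> disk_mob (- z)"
  have w: "cmod w < 1" using bz by (simp add: bary_def)
  have G: "circle_map G" unfolding G_def by (intro circle_map_conj g z w)
  have "bary G 0 0" using bary_conj_iff[OF g z w z w] bz by (simp add: G_def)
  then have "circ_int G = 0" by (simp add: bary_def poisson_def circ_int_def)
  then interpret centered_circle_map G \<delta>
    using G d sep by unfold_locales (auto simp: G_def)
  define f where "f \<zeta> = disk_mob w (de_disk g (disk_mob (- z) \<zeta>))" for \<zeta>
  have zm: "cmod (- z) < 1" using z by simp
  have bar: "bary g y (de_disk g y)" if "cmod y < 1" for y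
    using bary_exists[OF g that] de_disk_eq[OF g that] by metis
  have bf: "bary G \<zeta> (f \<zeta>)" if "cmod \<zeta> < 1" for \<zeta>
  proof -
    have y: "cmod (disk_mob (- z) \<zeta>) < 1" by (rule disk_mob_ball[OF zm that])
    have "cmod (de_disk g (disk_mob (- z) \<zeta>)) < 1" using bar[OF y] by (simp add: bary_def)
    from bary_conj_iff[OF g y this z w] show ?thesis
      unfolding G_def f_def using bar[OF y] disk_mob_inverse'[OF z] that by simp
  qed
  have df: "(f has_derivative (\<lambda>h. \<alpha> * h + \<beta> * cnj h)) (at 0)" by (rule bary_has_derivative[OF bf])
  have f0: "f 0 = 0" using bary_Lipschitz[OF bf[of 0]] by simp
  define T where "T = complex_of_real (1 - (cmod z)\<^sup>2) / (1 - cnj z * z)\<^sup>2"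
  define S where "S = complex_of_real (1 - (cmod (- w))\<^sup>2) / (1 - cnj (- w) * 0)\<^sup>2"
  have nz: "1 - cnj z * z \<noteq> 0" using disk_mob_denom_nonzero[of z z] z by simp
  have sq: "(cmod z)\<^sup>2 < 1" "(cmod w)\<^sup>2 < 1" using z w by (simp_all add: abs_square_less_1)
  have pos: "complex_of_real (1 - (cmod z)\<^sup>2) \<noteq> 0" "complex_of_real (1 - (cmod (- w))\<^sup>2) \<noteq> 0"
    using sq unfolding of_real_eq_0_iff by auto
  have TS: "T \<noteq> 0" "S \<noteq> 0" using pos nz by (simp_all add: T_def S_def del: of_real_diff)
  have dT: "(disk_mob z has_derivative (*) T) (at z)"
    using disk_mob_has_field_derivative[OF nz] by (simp add: T_def has_field_derivative_def)
  have dS: "(disk_mob (- w) has_derivative (*) S) (at (f (disk_mob z z)))"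
    using disk_mob_has_field_derivative[of "- w" 0] by (simp add: S_def has_field_derivative_def f0)
  have "((disk_mob (- w) \<circ> (f \<circ> disk_mob z)) has_derivative ((*) S \<circ> ((\<lambda>h. \<alpha> * h + \<beta> * cnj h) \<circ> (*) T))) (at z)"
    by (intro diff_chain_at dT) (use df dS in simp_all)
  moreover have "((*) S \<circ> ((\<lambda>h. \<alpha> * h + \<beta> * cnj h) \<circ> (*) T)) = (\<lambda>h. (S * \<alpha> * T) * h + (S * \<beta> * cnj T) * cnj h)"
    by (auto simp: algebra_simps)
  moreover have "(disk_mob (- w) \<circ> (f \<circ> disk_mob z)) y = de_disk g y" if "y \<in> ball 0 1" for y
  proof -
    have y: "cmod y < 1" using that by simp
    have "cmod (de_disk g y) \<le> 1" using bar[OF y] by (simp add: bary_def)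
    then show ?thesis using disk_mob_inverse[OF z] disk_mob_inverse[OF w] y by (simp add: f_def)
  qed
  ultimately have der: "(de_disk g has_derivative (\<lambda>h. (S * \<alpha> * T) * h + (S * \<beta> * cnj T) * cnj h)) (at z)"
    using has_derivative_transform_within_open[of "disk_mob (- w) \<circ> (f \<circ> disk_mob z)" _ z UNIV "ball 0 1" "de_disk g"] z by simp
  define c where "c = cmod S * cmod T"
  have c: "c > 0" using TS by (simp add: c_def)
  have n: "cmod (S * \<alpha> * T) = c * cmod \<alpha>" "cmod (S * \<beta> * cnj T) = c * cmod \<beta>" by (simp_all add: c_def norm_mult)
  show ?thesis
  proof (rule that[OF der])
    show "cmod (S * \<beta> * cnj T) < cmod (S * \<alpha> * T)" unfolding n using dilatation_bound(1) c by simp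
    have "(c * cmod \<alpha> + c * cmod \<beta>) / (c * cmod \<alpha> - c * cmod \<beta>) = (cmod \<alpha> + cmod \<beta>) / (cmod \<alpha> - cmod \<beta>)"
      unfolding distrib_left[symmetric] right_diff_distrib[symmetric] using c by simp
    then show "(cmod (S * \<alpha> * T) + cmod (S * \<beta> * cnj T)) / (cmod (S * \<alpha> * T) - cmod (S * \<beta> * cnj T)) \<le> 12288 / \<delta> ^ 5"
      unfolding n using dilatation_bound(2) by simp
  qed
qed

section \<open>Homogeneous coordinates\<close>

definition vdet :: "real \<times> real \<Rightarrow> real \<times> real \<Rightarrow> real" where
  "vdet v w = fst v * snd w - snd v * fst w"

text \<open>Projectivisation. The zero vector is sent to \<open>None\<close> as well, hence the side
  conditions \<open>v \<noteq> 0\<close>.\<close>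

definition pt :: "real \<times> real \<Rightarrow> rhat" where
  "pt v = (if snd v = 0 then None else Some (fst v / snd v))"

fun hom_coord :: "rhat \<Rightarrow> real \<times> real" where
  "hom_coord None = (1, 0)"
| "hom_coord (Some x) = (x, 1)"

text \<open>The linear form \<open>p - q * z\<close> for \<open>v = (p, q)\<close>. It turns
  geodesics, reflections and visual distances into formulas homogeneous in \<open>v\<close> that
  treat infinity like any other point.\<close>

definition nv :: "real \<times> real \<Rightarrow> complex \<Rightarrow> complex" where
  "nv v z = of_real (fst v) - of_real (snd v) * z"

lemma vdet_add_left: "vdet (u + v) w = vdet u w + vdet v w"
  and vdet_add_right: "vdet w (u + v) = vdet w u + vdet w v"
  and vdet_diff_left: "vdet (u - v) w = vdet u w - vdet v w"
  and vdet_diff_right: "vdet w (u - v) = vdet w u - vdet w v"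
  and vdet_minus_left: "vdet (- u) w = - vdet u w"
  and vdet_minus_right: "vdet w (- u) = - vdet w u"
  and vdet_scale_left: "vdet (c *\<^sub>R u) w = c * vdet u w"
  and vdet_scale_right: "vdet w (c *\<^sub>R u) = c * vdet w u"
  and vdet_self: "vdet u u = 0"
  by (simp_all add: vdet_def algebra_simps)

lemmas vdet_simps = vdet_add_left vdet_add_right vdet_diff_left vdet_diff_right vdet_minus_left
  vdet_minus_right vdet_scale_left vdet_scale_right vdet_self

lemma vdet_swap: "vdet w v = - vdet v w"
  by (simp add: vdet_def)

lemma vdet_nonzero: "vdet v w \<noteq> 0 \<Longrightarrow> v \<noteq> 0 \<and> w \<noteq> 0"
  by (auto simp: vdet_def)

lemma vec_expand:
  assumes "vdet v w = 1"
  shows "u = vdet u w *\<^sub>R v + vdet v u *\<^sub>R w"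
proof -
  have "vdet u w * fst v + vdet v u * fst w = fst u * vdet v w"
    "vdet u w * snd v + vdet v u * snd w = snd u * vdet v w"
    by (simp_all add: vdet_def algebra_simps)
  then show ?thesis using assms by (simp add: prod_eq_iff)
qed

lemma pt_hom_coord [simp]: "pt (hom_coord a) = a"
  by (cases a) (auto simp: pt_def)

lemma hom_coord_nonzero [simp]: "hom_coord a \<noteq> 0"
  by (cases a) (auto simp: zero_prod_def)

lemma pt_scale: "c \<noteq> 0 \<Longrightarrow> pt (c *\<^sub>R v) = pt v"
  by (auto simp: pt_def)

lemma pt_minus [simp]: "pt (- v) = pt v"
  using pt_scale[of "-1" v] by simp

lemma hom_coord_pt:
  assumes "v \<noteq> 0"
  obtains c where "c \<noteq> 0" "v = c *\<^sub>R hom_coord (pt v)"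
proof (cases "snd v = 0")
  case True
  then show ?thesis using that[of "fst v"] assms by (auto simp: pt_def prod_eq_iff)
next
  case False
  then show ?thesis using that[of "snd v"] by (auto simp: pt_def prod_eq_iff)
qed

lemma pt_eq_iff:
  assumes "v \<noteq> 0" "w \<noteq> 0"
  shows "pt v = pt w \<longleftrightarrow> vdet v w = 0"
  using assms by (auto simp: pt_def vdet_def prod_eq_iff field_simps)

lemma nv_scale: "nv (c *\<^sub>R v) z = of_real c * nv v z"
  by (simp add: nv_def algebra_simps)

lemma nv_add: "nv (u + v) z = nv u z + nv v z"
  by (simp add: nv_def algebra_simps)

lemma ccw_hom_coord:
  "ccw a b c \<longleftrightarrow> vdet (hom_coord b) (hom_coord a) * vdet (hom_coord c) (hom_coord b) * vdet (hom_coord c) (hom_coord a) > 0"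
proof (cases a; cases b; cases c)
  fix x y z assume e: "a = Some x" "b = Some y" "c = Some z"
  show ?thesis
    unfolding e by (simp add: vdet_def zero_less_mult_iff mult_less_0_iff) linarith
qed (auto simp: vdet_def)

text \<open>Each vector occurs in exactly two of the determinants, so the sign of the product does
  not depend on the representatives.\<close>

lemma ccw_pt_iff:
  assumes "u \<noteq> 0" "v \<noteq> 0" "w \<noteq> 0"
  shows "ccw (pt u) (pt v) (pt w) \<longleftrightarrow> vdet v u * vdet w v * vdet w u > 0"
proof -
  obtain c where c: "c \<noteq> 0" "u = c *\<^sub>R hom_coord (pt u)" using hom_coord_pt[OF assms(1)] .
  obtain d where d: "d \<noteq> 0" "v = d *\<^sub>R hom_coord (pt v)" using hom_coord_pt[OF assms(2)] .
  obtain e where e: "e \<noteq> 0" "w = e *\<^sub>R hom_coord (pt w)" using hom_coord_pt[OF assms(3)] .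
  let ?T = "vdet (hom_coord (pt v)) (hom_coord (pt u)) * vdet (hom_coord (pt w)) (hom_coord (pt v)) * vdet (hom_coord (pt w)) (hom_coord (pt u))"
  have "vdet v u * vdet w v * vdet w u = (c * d * e)\<^sup>2 * ?T"
    by (subst (1 2) d(2), subst (1 2) c(2), subst (1 2) e(2)) (simp only: vdet_simps power2_eq_square mult_ac)
  moreover have "(c * d * e)\<^sup>2 > 0" using c d e by simp
  ultimately show ?thesis unfolding ccw_hom_coord by (simp add: zero_less_mult_iff)
qed

section \<open>Geodesics\<close>

text \<open>The theorem of Thales: \<open>z\<close> lies on the semicircle over two real points iff
  it sees them at a right angle. At infinity \<open>nv\<close> is 1 and the condition compares real
  parts.\<close>

lemma mem_geod_hom_coord:
  "z \<in> geod a b \<longleftrightarrow> Im z > 0 \<and> Re (nv (hom_coord a) z * cnj (nv (hom_coord b) z)) = 0"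
proof (cases a; cases b)
  fix x y assume e: "a = Some x" "b = Some y"
  have "cmod (z - complex_of_real ((x + y) / 2)) = \<bar>x - y\<bar> / 2 \<longleftrightarrow>
      (cmod (z - complex_of_real ((x + y) / 2)))\<^sup>2 = (\<bar>x - y\<bar> / 2)\<^sup>2"
    by (metis abs_ge_zero divide_nonneg_nonneg norm_ge_zero power2_eq_iff_nonneg zero_le_numeral)
  also have "\<dots> \<longleftrightarrow> (Re z - (x + y) / 2)\<^sup>2 + (Im z)\<^sup>2 = ((x - y) / 2)\<^sup>2"
    unfolding cmod_power2 by (simp add: power_divide)
  also have "\<dots> \<longleftrightarrow> (x - Re z) * (y - Re z) + (Im z)\<^sup>2 = 0"
  proof -
    have "(Re z - (x + y) / 2)\<^sup>2 + (Im z)\<^sup>2 - ((x - y) / 2)\<^sup>2 = (x - Re z) * (y - Re z) + (Im z)\<^sup>2"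
      by (simp add: power2_eq_square field_simps)
    then show ?thesis by (metis eq_iff_diff_eq_0)
  qed
  finally show ?thesis unfolding e by (simp add: UHP_def nv_def power2_eq_square)
qed (auto simp: UHP_def nv_def)

lemma mem_geod_pt:
  assumes "v \<noteq> 0" "w \<noteq> 0"
  shows "z \<in> geod (pt v) (pt w) \<longleftrightarrow> Im z > 0 \<and> Re (nv v z * cnj (nv w z)) = 0"
proof -
  obtain c where c: "c \<noteq> 0" "v = c *\<^sub>R hom_coord (pt v)" using hom_coord_pt[OF assms(1)] .
  obtain d where d: "d \<noteq> 0" "w = d *\<^sub>R hom_coord (pt w)" using hom_coord_pt[OF assms(2)] .
  have "Re (nv v z * cnj (nv w z)) = c * d * Re (nv (hom_coord (pt v)) z * cnj (nv (hom_coord (pt w)) z))"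
    by (subst c(2), subst d(2)) (simp add: nv_scale algebra_simps)
  then show ?thesis unfolding mem_geod_hom_coord using c d by simp
qed

lemma geod_commute: "geod a b = geod b a"
proof (rule set_eqI)
  fix z show "z \<in> geod a b \<longleftrightarrow> z \<in> geod b a" unfolding mem_geod_hom_coord by (simp add: mult.commute)
qed

lemma geod_same [simp]: "geod a a = {}"
proof -
  have "nv (hom_coord a) z \<noteq> 0" if "Im z > 0" for z
    using that by (cases a) (auto simp: nv_def complex_eq_iff)
  then have "z \<notin> geod a a" for z
    unfolding mem_geod_hom_coord by (metis complex_norm_square Re_complex_of_real norm_eq_zero power_eq_0_iff)
  then show ?thesis by blast
qed

lemma Re_geod_Some_None: "Re ` geod (Some x) None = {x}"
  by (auto simp: UHP_def image_iff intro!: exI[of _ "Complex x 1"])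

lemma Re_geod_Some_Some:
  assumes "x < y"
  shows "Re ` geod (Some x) (Some y) = {x<..<y}"
proof
  have mem: "z \<in> geod (Some x) (Some y) \<longleftrightarrow> Im z > 0 \<and> (x - Re z) * (y - Re z) + (Im z)\<^sup>2 = 0" for z
    unfolding mem_geod_hom_coord by (simp add: nv_def power2_eq_square)
  show "Re ` geod (Some x) (Some y) \<subseteq> {x<..<y}"
  proof
    fix t assume "t \<in> Re ` geod (Some x) (Some y)"
    then obtain z where z: "t = Re z" "Im z > 0" "(x - Re z) * (y - Re z) + (Im z)\<^sup>2 = 0" using mem by auto
    have "(Im z)\<^sup>2 > 0" using z by simp
    then have "(x - Re z) * (y - Re z) < 0" using z(3) by linarith
    then show "t \<in> {x<..<y}" using assms z(1) by (auto simp: mult_less_0_iff)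
  qed
  show "{x<..<y} \<subseteq> Re ` geod (Some x) (Some y)"
  proof
    fix t assume t: "t \<in> {x<..<y}"
    then have p: "(t - x) * (y - t) > 0" by simp
    have "Complex t (sqrt ((t - x) * (y - t))) \<in> geod (Some x) (Some y)"
      unfolding mem using p by (simp add: algebra_simps)
    then show "t \<in> Re ` geod (Some x) (Some y)" by (metis complex.sel(1) image_eqI)
  qed
qed

lemma Ioo_eq_Ioo:
  fixes x y :: real
  assumes "x < y" "{x<..<y} = {x'<..<y'}"
  shows "x = x' \<and> y = y'"
proof -
  have "x' < y'" using assms by (metis greaterThanLessThan_empty_iff not_le)
  then show ?thesis using assms cInf_greaterThanLessThan cSup_greaterThanLessThan by metis
qed

lemma geod_ends:
  assumes "a \<noteq> b"
  obtains x where "{a, b} = {Some x, None}" "geod a b = geod (Some x) None"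
  | x y where "x < y" "{a, b} = {Some x, Some y}" "geod a b = geod (Some x) (Some y)"
proof (cases a; cases b)
  fix x y assume "a = Some x" "b = Some y"
  then show ?thesis using that(2)[of x y] that(2)[of y x] assms geod_commute[of a b] by (cases "x < y") auto
next
  fix y assume "a = None" "b = Some y"
  then show ?thesis using that(1)[of y] geod_commute[of a b] by (auto simp del: geod.simps)
qed (use that(1) assms in auto)

lemma geod_nonempty: "a \<noteq> b \<Longrightarrow> geod a b \<noteq> {}"
  using Re_geod_Some_None Re_geod_Some_Some
  by (elim geod_ends[of a b]) (metis image_is_empty insert_not_empty greaterThanLessThan_empty_iff not_le)+

text \<open>The projection of a geodesic to the real axis is a single point or an open interval, and
  the endpoints can be read off from it.\<close>

lemma geod_eqD:
  assumes eq: "geod a b = geod c d" and ab: "a \<noteq> b"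
  shows "{a, b} = {c, d}"
proof -
  have cd: "c \<noteq> d" using eq geod_nonempty[OF ab] by auto
  have ne: "{x<..<y} \<noteq> {z}" if "x < y" for x y z :: real
    using that infinite_Ioo[of x y] by (metis finite.emptyI finite.insertI)
  from ab show ?thesis
  proof (cases rule: geod_ends)
    case (1 x)
    note ab = 1
    from cd show ?thesis
    proof (cases rule: geod_ends)
      case (1 x')
      then show ?thesis using ab eq Re_geod_Some_None by (metis singleton_inject)
    next
      case (2 x' y')
      then show ?thesis using ab eq Re_geod_Some_None Re_geod_Some_Some ne by metis
    qed
  next
    case (2 x y)
    note ab = 2
    from cd show ?thesis
    proof (cases rule: geod_ends)
      case (1 x')
      then show ?thesis using ab eq Re_geod_Some_None Re_geod_Some_Some ne by metis
    next
      case (2 x' y')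
      then show ?thesis using ab eq Re_geod_Some_Some Ioo_eq_Ioo by metis
    qed
  qed
qed

section \<open>The reflection group\<close>

definition lin :: "real \<times> real \<Rightarrow> real \<times> real \<Rightarrow> real \<times> real \<Rightarrow> real \<times> real" where
  "lin c d u = fst u *\<^sub>R c + snd u *\<^sub>R d"

text \<open>The matrix with columns \<open>c\<close>, \<open>d\<close> describes the action of
  \<open>g\<close> on endpoints. Only the effect on geodesics is recorded, since edges and triangles
  are defined through images of sides.\<close>

definition farey_rep :: "(complex \<Rightarrow> complex) \<Rightarrow> real \<times> real \<Rightarrow> real \<times> real \<Rightarrow> bool" where
  "farey_rep g c d \<longleftrightarrow> (\<forall>u v. u \<noteq> 0 \<longrightarrow> v \<noteq> 0 \<longrightarrow>
     g ` geod (pt u) (pt v) = geod (pt (lin c d u)) (pt (lin c d v)))"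

definition int_vec :: "real \<times> real \<Rightarrow> bool" where
  "int_vec v \<longleftrightarrow> fst v \<in> \<int> \<and> snd v \<in> \<int>"

lemma int_vec_simps [simp]:
  "int_vec v \<Longrightarrow> int_vec w \<Longrightarrow> int_vec (v + w)" "int_vec v \<Longrightarrow> int_vec w \<Longrightarrow> int_vec (v - w)"
  "int_vec v \<Longrightarrow> int_vec (- v)" "int_vec v \<Longrightarrow> int_vec (of_int n *\<^sub>R v)"
  by (auto simp: int_vec_def)

lemma int_vec_vdet: "int_vec v \<Longrightarrow> int_vec w \<Longrightarrow> vdet v w \<in> \<int>"
  by (auto simp: int_vec_def vdet_def)

lemma lin_nonzero:
  assumes "vdet c d \<noteq> 0" "u \<noteq> 0"
  shows "lin c d u \<noteq> 0"
proof
  assume "lin c d u = 0"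
  then have "vdet (lin c d u) d = 0" "vdet c (lin c d u) = 0" by (simp_all add: vdet_def)
  then have "fst u * vdet c d = 0" "snd u * vdet c d = 0" by (simp_all add: lin_def vdet_simps)
  then show False using assms by (auto simp: prod_eq_iff)
qed

text \<open>A reflection multiplies \<open>nv\<close> by a factor \<open>l\<close> common to all
  vectors, up to conjugation, which preserves the right-angle condition. Involutivity yields the
  reverse inclusion.\<close>

lemma refl_image:
  assumes R: "\<And>z. Im z > 0 \<Longrightarrow> Im (R z) > 0 \<and> R (R z) = z \<and> (\<exists>l. l \<noteq> 0 \<and> (\<forall>v. nv (m v) (R z) = l * cnj (nv v z)))"
    and m: "\<And>v. v \<noteq> 0 \<Longrightarrow> m v \<noteq> 0" and uv: "u \<noteq> 0" "v \<noteq> 0"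
  shows "R ` geod (pt u) (pt v) = geod (pt (m u)) (pt (m v))"
proof -
  have iff: "R z \<in> geod (pt (m u)) (pt (m v)) \<longleftrightarrow> z \<in> geod (pt u) (pt v)" if z: "Im z > 0" for z
  proof -
    obtain l where l: "l \<noteq> 0" "\<And>v. nv (m v) (R z) = l * cnj (nv v z)" using R[OF z] by blast
    have Rc: "Re (of_real c * cnj x) = c * Re x" for c x by simp
    have "nv (m u) (R z) * cnj (nv (m v) (R z)) = (l * cnj l) * cnj (nv u z * cnj (nv v z))"
      by (simp add: l(2) mult_ac)
    also have "\<dots> = of_real ((cmod l)\<^sup>2) * cnj (nv u z * cnj (nv v z))" by (simp only: complex_norm_square)
    finally have "Re (nv (m u) (R z) * cnj (nv (m v) (R z))) = (cmod l)\<^sup>2 * Re (nv u z * cnj (nv v z))"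
      by (simp only: Rc)
    then show ?thesis using R[OF z] z l(1) m uv by (simp add: mem_geod_pt)
  qed
  have sub: "Im z > 0" if "z \<in> geod a b" for z a b using that unfolding mem_geod_hom_coord by simp
  show ?thesis
  proof (intro equalityI subsetI)
    fix y assume "y \<in> R ` geod (pt u) (pt v)"
    then show "y \<in> geod (pt (m u)) (pt (m v))" using iff sub by blast
  next
    fix y assume y: "y \<in> geod (pt (m u)) (pt (m v))"
    then have "Im y > 0" using sub by blast
    then have "R (R y) = y" "Im (R y) > 0" using R by auto
    then show "y \<in> R ` geod (pt u) (pt v)" using iff[of "R y"] y by (metis image_eqI)
  qed
qed

lemma refl_0_inf_image:
  assumes "u \<noteq> 0" "v \<noteq> 0"
  shows "hyp_reflection (Some 0) None ` geod (pt u) (pt v) = geod (pt (- fst u, snd u)) (pt (- fst v, snd v))"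
proof (rule refl_image[where m = "\<lambda>v. (- fst v, snd v)", OF _ _ assms])
  fix z :: complex assume "Im z > 0"
  then show "Im (hyp_reflection (Some 0) None z) > 0 \<and> hyp_reflection (Some 0) None (hyp_reflection (Some 0) None z) = z \<and>
      (\<exists>l. l \<noteq> 0 \<and> (\<forall>v. nv (- fst v, snd v) (hyp_reflection (Some 0) None z) = l * cnj (nv v z)))"
    by (auto simp: nv_def intro!: exI[of _ "-1"])
qed (auto simp: prod_eq_iff)

lemma refl_1_inf_image:
  assumes "u \<noteq> 0" "v \<noteq> 0"
  shows "hyp_reflection (Some 1) None ` geod (pt u) (pt v) = geod (pt (2 * snd u - fst u, snd u)) (pt (2 * snd v - fst v, snd v))"
proof (rule refl_image[where m = "\<lambda>v. (2 * snd v - fst v, snd v)", OF _ _ assms])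
  fix z :: complex assume "Im z > 0"
  then show "Im (hyp_reflection (Some 1) None z) > 0 \<and> hyp_reflection (Some 1) None (hyp_reflection (Some 1) None z) = z \<and>
      (\<exists>l. l \<noteq> 0 \<and> (\<forall>v. nv (2 * snd v - fst v, snd v) (hyp_reflection (Some 1) None z) = l * cnj (nv v z)))"
    by (auto simp: nv_def algebra_simps intro!: exI[of _ "-1"])
qed (auto simp: prod_eq_iff)

lemma refl_0_1_eq:
  assumes "Im z > 0"
  shows "hyp_reflection (Some 0) (Some 1) z = cnj z / (2 * cnj z - 1)"
proof -
  have n: "2 * cnj z - 1 \<noteq> 0" "cnj z - 1 / 2 \<noteq> 0" using assms by (auto simp: complex_eq_iff)
  have e: "(cnj z - 1 / 2) = (2 * cnj z - 1) / 2" by (simp add: field_simps)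
  show ?thesis using n by (simp add: power2_eq_square e) (simp add: field_simps)
qed

lemma refl_0_1_image:
  assumes "u \<noteq> 0" "v \<noteq> 0"
  shows "hyp_reflection (Some 0) (Some 1) ` geod (pt u) (pt v) = geod (pt (fst u, 2 * fst u - snd u)) (pt (fst v, 2 * fst v - snd v))"
proof (rule refl_image[where m = "\<lambda>v. (fst v, 2 * fst v - snd v)", OF _ _ assms])
  fix z :: complex assume z: "Im z > 0"
  let ?R = "hyp_reflection (Some 0) (Some 1)"
  have n: "2 * cnj z - 1 \<noteq> 0" using z by (auto simp: complex_eq_iff)
  have n': "2 * z - 1 \<noteq> 0" using z by (auto simp: complex_eq_iff)
  have Rz: "?R z = cnj z / (2 * cnj z - 1)" by (rule refl_0_1_eq[OF z])
  have "Im (?R z) = Im (cnj z * (2 * z - 1)) / (cmod (2 * cnj z - 1))\<^sup>2"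
    unfolding Rz by (simp add: Im_divide cmod_power2)
  also have "Im (cnj z * (2 * z - 1)) = Im z" by (simp add: algebra_simps)
  finally have I: "Im (?R z) > 0" using z n by simp
  have "?R (?R z) = z"
    unfolding refl_0_1_eq[OF I] unfolding Rz using n n' by (simp add: field_simps)
  moreover have "nv (fst v, 2 * fst v - snd v) (?R z) = (- 1 / (2 * cnj z - 1)) * cnj (nv v z)" for v
    unfolding Rz nv_def using n by (simp add: field_simps)
  moreover have "- 1 / (2 * cnj z - 1) \<noteq> 0" using n by simp
  ultimately show "Im (?R z) > 0 \<and> ?R (?R z) = z \<and> (\<exists>l. l \<noteq> 0 \<and> (\<forall>v. nv (fst v, 2 * fst v - snd v) (?R z) = l * cnj (nv v z)))"
    using I by blast
qed (auto simp: prod_eq_iff)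

text \<open>Each generator has an integral matrix of determinant -1, so only the absolute value of
  the determinant is invariant.\<close>

lemma farey_group_rep:
  assumes "g \<in> farey_group"
  obtains c d where "int_vec c" "int_vec d" "\<bar>vdet c d\<bar> = 1" "farey_rep g c d"
proof -
  have "\<exists>c d. int_vec c \<and> int_vec d \<and> \<bar>vdet c d\<bar> = 1 \<and> farey_rep g c d"
    using assms
  proof induction
    case id
    show ?case
      by (rule exI[of _ "(1, 0)"], rule exI[of _ "(0, 1)"]) (simp add: int_vec_def vdet_def farey_rep_def lin_def)
  next
    case (refl_0_1 g)
    then obtain c d where cd: "int_vec c" "int_vec d" "\<bar>vdet c d\<bar> = 1" "farey_rep g c d" by blast
    then have n: "vdet c d \<noteq> 0" by auto
    have "farey_rep (hyp_reflection (Some 0) (Some 1) \<circ> g) (fst c, 2 * fst c - snd c) (fst d, 2 * fst d - snd d)"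
      using cd(4) lin_nonzero[OF n] unfolding farey_rep_def image_comp[symmetric]
      by (auto simp: refl_0_1_image simp del: hyp_reflection.simps) (simp_all add: lin_def algebra_simps)
    moreover have "vdet (fst c, 2 * fst c - snd c) (fst d, 2 * fst d - snd d) = - vdet c d" by (simp add: vdet_def algebra_simps)
    moreover have "int_vec (fst c, 2 * fst c - snd c)" "int_vec (fst d, 2 * fst d - snd d)" using cd by (auto simp: int_vec_def)
    ultimately show ?case using cd(3) by (metis abs_minus_cancel)
  next
    case (refl_1_inf g)
    then obtain c d where cd: "int_vec c" "int_vec d" "\<bar>vdet c d\<bar> = 1" "farey_rep g c d" by blast
    then have n: "vdet c d \<noteq> 0" by auto
    have "farey_rep (hyp_reflection (Some 1) None \<circ> g) (2 * snd c - fst c, snd c) (2 * snd d - fst d, snd d)"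
      using cd(4) lin_nonzero[OF n] unfolding farey_rep_def image_comp[symmetric]
      by (auto simp: refl_1_inf_image simp del: hyp_reflection.simps) (simp_all add: lin_def algebra_simps)
    moreover have "vdet (2 * snd c - fst c, snd c) (2 * snd d - fst d, snd d) = - vdet c d" by (simp add: vdet_def algebra_simps)
    moreover have "int_vec (2 * snd c - fst c, snd c)" "int_vec (2 * snd d - fst d, snd d)" using cd by (auto simp: int_vec_def)
    ultimately show ?case using cd(3) by (metis abs_minus_cancel)
  next
    case (refl_0_inf g)
    then obtain c d where cd: "int_vec c" "int_vec d" "\<bar>vdet c d\<bar> = 1" "farey_rep g c d" by blast
    then have n: "vdet c d \<noteq> 0" by auto
    have "farey_rep (hyp_reflection (Some 0) None \<circ> g) (- fst c, snd c) (- fst d, snd d)"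
      using cd(4) lin_nonzero[OF n] unfolding farey_rep_def image_comp[symmetric]
      by (auto simp: refl_0_inf_image simp del: hyp_reflection.simps) (simp_all add: lin_def algebra_simps)
    moreover have "vdet (- fst c, snd c) (- fst d, snd d) = - vdet c d" by (simp add: vdet_def algebra_simps)
    moreover have "int_vec (- fst c, snd c)" "int_vec (- fst d, snd d)" using cd by (auto simp: int_vec_def)
    ultimately show ?case using cd(3) by (metis abs_minus_cancel)
  qed
  then show ?thesis using that by blast
qed

text \<open>The inductive definition composes on the left, whereas crossing a side of a triangle
  needs composition on the right.\<close>

lemma farey_group_comp: "g \<in> farey_group \<Longrightarrow> k \<in> farey_group \<Longrightarrow> g \<circ> k \<in> farey_group"
  by (induction rule: farey_group.induct) (auto simp: comp_assoc intro: farey_group.intros simp del: hyp_reflection.simps)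

lemma farey_rep_comp_refl:
  assumes rep: "farey_rep g c d" and m: "\<And>u. u \<noteq> 0 \<Longrightarrow> m u \<noteq> 0"
    and R: "\<And>u v. u \<noteq> 0 \<Longrightarrow> v \<noteq> 0 \<Longrightarrow> R ` geod (pt u) (pt v) = geod (pt (m u)) (pt (m v))"
    and l: "\<And>u. lin c d (m u) = lin c' d' u"
  shows "farey_rep (g \<circ> R) c' d'"
  using rep m R l unfolding farey_rep_def image_comp[symmetric] by metis

text \<open>Up to the order and a common sign of the vectors, \<open>v\<close>, \<open>w\<close>, \<open>- v - w\<close> are the images of the
  vertices \<open>\<infinity>\<close>, \<open>0\<close>, \<open>1\<close> of the base triangle.\<close>

definition orb :: "real \<times> real \<Rightarrow> real \<times> real \<Rightarrow> bool" where
  "orb v w \<longleftrightarrow> (\<exists>g c d. g \<in> farey_group \<and> farey_rep g c d \<and>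
     (v, w) \<in> {(c, d), (d, c), (c, - c - d), (- c - d, c), (d, - c - d), (- c - d, d)})"

lemma orbI: "g \<in> farey_group \<Longrightarrow> farey_rep g c d \<Longrightarrow>
  (v, w) \<in> {(c, d), (d, c), (c, - c - d), (- c - d, c), (d, - c - d), (- c - d, d)} \<Longrightarrow> orb v w"
  unfolding orb_def by blast

lemma orb_swap: "orb v w \<Longrightarrow> orb w v"
  unfolding orb_def by fast

lemma orb_third: "orb v w \<Longrightarrow> orb v (- v - w)"
proof -
  assume "orb v w"
  then obtain g c d where g: "g \<in> farey_group" "farey_rep g c d"
    and m: "(v, w) \<in> {(c, d), (d, c), (c, - c - d), (- c - d, c), (d, - c - d), (- c - d, d)}"
    unfolding orb_def by blast
  show ?thesis by (rule orbI[OF g]) (use m in auto)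
qed

lemma farey_rep_minus: "farey_rep g c d \<Longrightarrow> farey_rep g (- c) (- d)"
proof -
  have "lin (- c) (- d) u = - lin c d u" for u by (simp add: lin_def)
  then show "farey_rep g c d \<Longrightarrow> farey_rep g (- c) (- d)" by (simp add: farey_rep_def)
qed

lemma orb_minus: "orb v w \<Longrightarrow> orb (- v) (- w)"
proof -
  assume "orb v w"
  then obtain g c d where g: "g \<in> farey_group" "farey_rep g c d"
    and m: "(v, w) \<in> {(c, d), (d, c), (c, - c - d), (- c - d, c), (d, - c - d), (- c - d, d)}"
    unfolding orb_def by blast
  show ?thesis by (rule orbI[OF g(1) farey_rep_minus[OF g(2)]]) (use m in auto)
qed

lemma refl_in_farey_group:
  "hyp_reflection (Some 0) (Some 1) \<in> farey_group" "hyp_reflection (Some 1) None \<in> farey_group"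
  "hyp_reflection (Some 0) None \<in> farey_group"
  using farey_group.intros(2)[OF farey_group.id] farey_group.intros(3)[OF farey_group.id] farey_group.intros(4)[OF farey_group.id]
  by (simp_all del: hyp_reflection.simps)

text \<open>Crossing an edge of a triangle: the group element of the triangle is composed on the right
  with the reflection in the corresponding side of the base triangle.\<close>

lemma orb_flip: "orb v w \<Longrightarrow> orb (- v) w"
proof -
  assume "orb v w"
  then obtain g c d where g: "g \<in> farey_group" "farey_rep g c d"
    and m: "(v, w) \<in> {(c, d), (d, c), (c, - c - d), (- c - d, c), (d, - c - d), (- c - d, d)}"
    unfolding orb_def by blast
  \<comment> \<open>The reflections in the three sides change the columns to
    \<open>(- c, d)\<close>, \<open>(- c, 2 c + d)\<close> and \<open>(c + 2 d, - d)\<close>; each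
    keeps two of the three vertex vectors up to sign. Swapping and negating give the other
    cases.\<close>
  have 1: "orb (- c) d"
  proof (rule orbI)
    show "g \<circ> hyp_reflection (Some 0) None \<in> farey_group" by (intro farey_group_comp g refl_in_farey_group)
    show "farey_rep (g \<circ> hyp_reflection (Some 0) None) (- c) d"
      by (rule farey_rep_comp_refl[OF g(2) _ refl_0_inf_image]) (auto simp: prod_eq_iff lin_def)
  qed simp
  have 2: "orb (- c) (- c - d)"
  proof (rule orbI)
    show "g \<circ> hyp_reflection (Some 1) None \<in> farey_group" by (intro farey_group_comp g refl_in_farey_group)
    show "farey_rep (g \<circ> hyp_reflection (Some 1) None) (- c) (2 *\<^sub>R c + d)"
      by (rule farey_rep_comp_refl[OF g(2) _ refl_1_inf_image]) (auto simp: prod_eq_iff lin_def algebra_simps)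
  qed (simp add: scaleR_2)
  have 3: "orb (- d) (- c - d)"
  proof (rule orbI)
    show "g \<circ> hyp_reflection (Some 0) (Some 1) \<in> farey_group" by (intro farey_group_comp g refl_in_farey_group)
    show "farey_rep (g \<circ> hyp_reflection (Some 0) (Some 1)) (c + 2 *\<^sub>R d) (- d)"
      by (rule farey_rep_comp_refl[OF g(2) _ refl_0_1_image]) (auto simp: prod_eq_iff lin_def algebra_simps)
  qed (simp add: scaleR_2)
  show ?thesis
    using m 1 2 3 orb_minus[OF orb_swap[OF 1]] orb_minus[OF orb_swap[OF 2]] orb_minus[OF orb_swap[OF 3]]
    by auto
qed

lemma orb_flip2: "orb v w \<Longrightarrow> orb v (- w)"
  using orb_flip orb_swap by blast

lemma orb_add: "orb v w \<Longrightarrow> orb v (w + v)"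
  using orb_flip2[OF orb_third[of v w]] by (simp add: add.commute)

lemma orb_diff: "orb v w \<Longrightarrow> orb v (w - v)"
  using orb_flip[OF orb_add[OF orb_flip[of v w]]] by simp

lemma orb_add_int: "orb v w \<Longrightarrow> orb v (w + of_int n *\<^sub>R v)"
proof (induction n rule: int_induct[where k = 0])
  case (step1 i)
  then show ?case using orb_add[of v "w + of_int i *\<^sub>R v"] by (simp add: algebra_simps)
next
  case (step2 i)
  then show ?case using orb_diff[of v "w + of_int i *\<^sub>R v"] by (simp add: algebra_simps)
qed simp

lemma orb_base: "orb (1, 0) (0, 1)"
  by (rule orbI[OF farey_group.id, of "(1, 0)" "(0, 1)"]) (simp_all add: farey_rep_def lin_def)

text \<open>The Euclidean algorithm on the second coordinates: adding one vector to the other or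
  subtracting it reduces to the case in which one of them is zero.\<close>

lemma orb_int:
  fixes p q r s :: int
  assumes "\<bar>p * s - q * r\<bar> = 1"
  shows "orb (of_int p, of_int q) (of_int r, of_int s)"
  using assms
proof (induction "nat \<bar>q\<bar> + nat \<bar>s\<bar>" arbitrary: p q r s rule: less_induct)
  case less
  have base: "orb (of_int p, of_int q) (of_int r, of_int s)" if "\<bar>p * s - q * r\<bar> = 1" "q = 0" for p q r s :: int
  proof -
    have "\<bar>p\<bar> = 1" "\<bar>s\<bar> = 1" using abs_zmult_eq_1[of p s] abs_zmult_eq_1[of s p] that by (simp_all add: mult.commute)
    then have ps: "p = 1 \<or> p = -1" "s = 1 \<or> s = -1" by linarith+
    have "orb (1, 0) (0, of_int s)" using ps(2) orb_base orb_flip2[OF orb_base] by auto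
    from orb_add_int[OF this, of r] have "orb (1, 0) (of_int r, of_int s)" by simp
    then show ?thesis using ps(1) orb_flip[of "(1, 0)" "(of_int r, of_int s)"] that(2) by auto
  qed
  have step: "orb (of_int p, of_int q) (of_int r, of_int s)"
    if IH: "\<And>p' q' r' s'. nat \<bar>q'\<bar> + nat \<bar>s'\<bar> < nat \<bar>q\<bar> + nat \<bar>s\<bar> \<Longrightarrow> \<bar>p' * s' - q' * r'\<bar> = 1 \<Longrightarrow>
        orb (of_int p', of_int q') (of_int r', of_int s')"
      and d: "\<bar>p * s - q * r\<bar> = 1" and nz: "q \<noteq> 0" "s \<noteq> 0" and le: "\<bar>q\<bar> \<le> \<bar>s\<bar>" for p q r s :: int
  proof (cases "q * s > 0")
    case True
    then have "\<bar>s - q\<bar> < \<bar>s\<bar>" using le nz by (auto simp: zero_less_mult_iff)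
    then have "orb (of_int p, of_int q) (of_int (r - p), of_int (s - q))"
      using d by (intro IH) (auto simp: algebra_simps)
    from orb_add[OF this] show ?thesis by simp
  next
    case False
    then have "q * s < 0" using nz by (simp add: not_less order_le_less)
    then have "\<bar>s + q\<bar> < \<bar>s\<bar>" using le nz by (auto simp: mult_less_0_iff)
    then have "orb (of_int p, of_int q) (of_int (r + p), of_int (s + q))"
      using d by (intro IH) (auto simp: algebra_simps)
    from orb_diff[OF this] show ?thesis by simp
  qed
  consider "q = 0" | "s = 0" | "q \<noteq> 0" "s \<noteq> 0" "\<bar>q\<bar> \<le> \<bar>s\<bar>" | "q \<noteq> 0" "s \<noteq> 0" "\<bar>s\<bar> \<le> \<bar>q\<bar>" by linarith
  then show ?case
  proof cases
    case 1 then show ?thesis using base less.prems by blast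
  next
    case 2
    have "\<bar>r * q - s * p\<bar> = 1" using less.prems by (simp add: abs_minus_commute mult.commute)
    then show ?thesis using base[of r q s p] 2 orb_swap by blast
  next
    case 3 then show ?thesis using step less by blast
  next
    case 4
    have d: "\<bar>r * q - s * p\<bar> = 1" using less.prems by (simp add: abs_minus_commute mult.commute)
    have "orb (of_int r, of_int s) (of_int p, of_int q)"
      by (rule step[OF _ d]) (use 4 less.hyps in \<open>auto simp: add.commute\<close>)
    then show ?thesis by (rule orb_swap)
  qed
qed

lemma orb_unimodular:
  assumes "int_vec v" "int_vec w" "\<bar>vdet v w\<bar> = 1"
  shows "orb v w"
proof -
  obtain p q r s where e: "v = (of_int p, of_int q)" "w = (of_int r, of_int s)"
    using assms(1,2) unfolding int_vec_def by (metis Ints_cases prod.collapse)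
  have "\<bar>of_int (p * s - q * r) :: real\<bar> = 1" using assms(3) by (simp add: e vdet_def)
  then have "\<bar>p * s - q * r\<bar> = 1" by (metis of_int_abs of_int_eq_1_iff)
  then show ?thesis unfolding e by (rule orb_int)
qed

section \<open>Edges, triangles and fans\<close>

lemma farey_rep_base_sides:
  assumes "farey_rep g c d"
  shows "(\<lambda>e. g ` e) ` base_sides = {geod (pt d) (pt (c + d)), geod (pt c) (pt (c + d)), geod (pt c) (pt d)}"
proof -
  have rep: "g ` geod (pt u) (pt v) = geod (pt (lin c d u)) (pt (lin c d v))" if "u \<noteq> 0" "v \<noteq> 0" for u v
    using assms that unfolding farey_rep_def by blast
  have b: "Some 0 = pt (0, 1)" "Some 1 = pt (1, 1)" "None = pt (1, 0)" by (simp_all add: pt_def)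
  have n: "(0, 1) \<noteq> (0 :: real \<times> real)" "(1, 1) \<noteq> (0 :: real \<times> real)" "(1, 0) \<noteq> (0 :: real \<times> real)"
    by (simp_all add: prod_eq_iff)
  have l: "lin c d (0, 1) = d" "lin c d (1, 1) = c + d" "lin c d (1, 0) = c" by (simp_all add: lin_def)
  show ?thesis
    unfolding base_sides_def b image_insert image_empty rep[OF n(1,2)] rep[OF n(2,3)] rep[OF n(1,3)] l
      geod_commute[of "pt (c + d)"] geod_commute[of "pt d" "pt c"] ..
qed

lemma unimodular_triangle:
  assumes "int_vec v" "int_vec w" "\<bar>vdet v w\<bar> = 1"
  shows "farey_triangle (pt v) (pt w) (pt (v + w))"
proof -
  obtain g c d where g: "g \<in> farey_group" "farey_rep g c d"
    and m: "(v, w) \<in> {(c, d), (d, c), (c, - c - d), (- c - d, c), (d, - c - d), (- c - d, d)}"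
    using orb_unimodular[OF assms] unfolding orb_def by blast
  have "pt (- c - d) = pt (c + d)" "pt (d + c) = pt (c + d)" using pt_minus[of "c + d"] by (simp_all add: algebra_simps)
  moreover have "pt (- c - d + c) = pt d" "pt (c + (- c - d)) = pt d" "pt (- c - d + d) = pt c" "pt (d + (- c - d)) = pt c"
    using pt_minus[of d] pt_minus[of c] by (simp_all add: algebra_simps)
  ultimately have "{geod (pt v) (pt w), geod (pt w) (pt (v + w)), geod (pt v) (pt (v + w))} =
      {geod (pt d) (pt (c + d)), geod (pt c) (pt (c + d)), geod (pt c) (pt d)}"
    using m geod_commute[of "pt d" "pt c"] geod_commute[of "pt (c + d)" "pt c"] geod_commute[of "pt (c + d)" "pt d"]
    by (elim insertE emptyE Pair_inject; simp only: insert_commute)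
  then have "{geod (pt v) (pt w), geod (pt w) (pt (v + w)), geod (pt v) (pt (v + w))} = (\<lambda>e. g ` e) ` base_sides"
    unfolding farey_rep_base_sides[OF g(2)] .
  then show ?thesis unfolding farey_triangle_def using g(1) by blast
qed

lemma farey_triangle_edges:
  assumes "farey_triangle a b c"
  shows "geod a b \<in> farey" "geod b c \<in> farey" "geod a c \<in> farey"
proof -
  obtain g where g: "g \<in> farey_group" "{geod a b, geod b c, geod a c} = (\<lambda>e. g ` e) ` base_sides"
    using assms unfolding farey_triangle_def by blast
  have "{geod a b, geod b c, geod a c} \<subseteq> farey" unfolding g(2) farey_def using g(1) by blast
  then show "geod a b \<in> farey" "geod b c \<in> farey" "geod a c \<in> farey" by simp_all
qed

lemma unimodular_edge:
  assumes "int_vec v" "int_vec w" "\<bar>vdet v w\<bar> = 1"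
  shows "geod (pt v) (pt w) \<in> farey"
  using farey_triangle_edges[OF unimodular_triangle[OF assms]] by blast

lemma farey_edgeE:
  assumes "l \<in> farey"
  obtains v w where "int_vec v" "int_vec w" "\<bar>vdet v w\<bar> = 1" "l = geod (pt v) (pt w)"
proof -
  obtain g e where g: "g \<in> farey_group" "e \<in> base_sides" "l = g ` e" using assms unfolding farey_def by blast
  obtain c d where cd: "int_vec c" "int_vec d" "\<bar>vdet c d\<bar> = 1" "farey_rep g c d" using farey_group_rep[OF g(1)] .
  have "l \<in> (\<lambda>e. g ` e) ` base_sides" using g by blast
  then have "l \<in> {geod (pt d) (pt (c + d)), geod (pt c) (pt (c + d)), geod (pt c) (pt d)}"
    unfolding farey_rep_base_sides[OF cd(4)] .
  moreover have "\<bar>vdet d (c + d)\<bar> = 1" "\<bar>vdet c (c + d)\<bar> = 1"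
    using cd(3) vdet_swap[of d c] by (simp_all add: vdet_simps)
  ultimately show ?thesis using that cd(1-3) int_vec_simps(1)[OF cd(1,2)] by blast
qed

lemma abs_Ints_mult_1:
  fixes x y :: real
  assumes "x \<in> \<int>" "y \<in> \<int>" "\<bar>x * y\<bar> = 1"
  shows "\<bar>y\<bar> = 1"
proof -
  obtain m n where e: "x = of_int m" "y = of_int n" using assms(1,2) by (elim Ints_cases)
  have "\<bar>m * n\<bar> = 1" using assms(3) unfolding e by (metis of_int_abs of_int_eq_1_iff of_int_mult)
  then have "\<bar>n\<bar> = 1" by (metis abs_zmult_eq_1 mult.commute)
  then show ?thesis unfolding e by (metis of_int_1 of_int_abs)
qed

text \<open>Expand a vector of the neighbour in the basis \<open>v\<close>, \<open>w\<close>: being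
  an edge forces the coefficient of \<open>w\<close> to be 1 or -1, and a change of sign, which
  leaves the boundary point alone, makes it 1.\<close>

lemma farey_neighbour:
  assumes v: "int_vec v" and w: "int_vec w" and vw: "vdet v w = 1" and e: "geod (pt v) b \<in> farey"
  obtains n :: int where "b = pt (of_int n *\<^sub>R v + w)"
proof -
  obtain a c where ac: "int_vec a" "int_vec c" "\<bar>vdet a c\<bar> = 1" "geod (pt v) b = geod (pt a) (pt c)"
    using farey_edgeE[OF e] .
  have nz: "v \<noteq> 0" "w \<noteq> 0" using vdet_nonzero[of v w] vw by auto
  have key: "\<exists>n :: int. b = pt (of_int n *\<^sub>R v + w)"
    if ac: "int_vec a" "int_vec c" "\<bar>vdet a c\<bar> = 1" and pa: "pt v = pt a" "b = pt c" for a c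
  proof -
    have anz: "a \<noteq> 0" using vdet_nonzero[of a c] ac by auto
    have "vdet v a = 0" using pt_eq_iff[OF nz(1) anz] pa by simp
    then have a: "a = vdet a w *\<^sub>R v" using vec_expand[OF vw, of a] by simp
    have "vdet a c = vdet a w * vdet v c" by (subst a) (simp add: vdet_simps)
    then have "\<bar>vdet v c\<bar> = 1" using abs_Ints_mult_1[of "vdet a w" "vdet v c"] int_vec_vdet ac v w by metis
    obtain n where n: "vdet c w = of_int n" using int_vec_vdet[OF ac(2) w] by (elim Ints_cases)
    have c: "c = of_int n *\<^sub>R v + vdet v c *\<^sub>R w" using vec_expand[OF vw, of c] n by simp
    from \<open>\<bar>vdet v c\<bar> = 1\<close> have "vdet v c = 1 \<or> vdet v c = - 1" by linarith
    then show ?thesis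
    proof
      assume "vdet v c = 1"
      then show ?thesis using c pa by (intro exI[of _ n]) simp
    next
      assume "vdet v c = - 1"
      then have "- c = of_int (- n) *\<^sub>R v + w" by (subst c) simp
      then show ?thesis using pa pt_minus[of c] by metis
    qed
  qed
  have "pt a \<noteq> pt c" using ac(3) vdet_nonzero[of a c] pt_eq_iff[of a c] by auto
  then have "{pt v, b} = {pt a, pt c}" using geod_eqD[OF ac(4)[symmetric]] by simp
  then consider "pt v = pt a" "b = pt c" | "pt v = pt c" "b = pt a" by (auto simp: doubleton_eq_iff)
  then show ?thesis
  proof cases
    case 1 then show ?thesis using key[OF ac(1-3)] that by blast
  next
    case 2
    have "\<bar>vdet c a\<bar> = 1" using ac(3) vdet_swap[of c a] by simp
    then show ?thesis using key[OF ac(2,1)] 2 that by blast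
  qed
qed

lemma vdet_fan: "vdet v w = 1 \<Longrightarrow> vdet v (c *\<^sub>R v + w) = 1"
  "vdet v w = 1 \<Longrightarrow> vdet (c *\<^sub>R v + w) (d *\<^sub>R v + w) = c - d"
  using vdet_swap[of w v] by (simp_all add: vdet_simps)

lemma fan_nonzero: "vdet v w = 1 \<Longrightarrow> c *\<^sub>R v + w \<noteq> 0"
  using vdet_fan(1)[of v w c] vdet_nonzero by (metis zero_neq_one)

lemma is_fan_unimodular:
  assumes v: "int_vec v" and w: "int_vec w" and vw: "vdet v w = 1"
  shows "is_fan (pt v) (\<lambda>n. geod (pt v) (pt (of_int n *\<^sub>R v + w)))"
proof -
  let ?e = "\<lambda>n :: int. geod (pt v) (pt (of_int n *\<^sub>R v + w))"
  have nz: "v \<noteq> 0" using vdet_nonzero[of v w] vw by auto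
  have "inj ?e"
  proof (rule injI)
    fix m n :: int assume "?e m = ?e n"
    moreover have "pt v \<noteq> pt (of_int m *\<^sub>R v + w)"
      using vdet_fan(1)[OF vw, of "of_int m"] pt_eq_iff[OF nz fan_nonzero[OF vw]] by auto
    ultimately have "{pt v, pt (of_int m *\<^sub>R v + w)} = {pt v, pt (of_int n *\<^sub>R v + w)}" by (rule geod_eqD)
    then have "pt (of_int m *\<^sub>R v + w) = pt (of_int n *\<^sub>R v + w)" by (auto simp: doubleton_eq_iff)
    then have "vdet (of_int m *\<^sub>R v + w) (of_int n *\<^sub>R v + w) = 0"
      using pt_eq_iff[OF fan_nonzero[OF vw] fan_nonzero[OF vw]] by blast
    then show "m = n" using vdet_fan(2)[OF vw] by simp
  qed
  moreover have "range ?e = {l \<in> farey. \<exists>q. l = geod (pt v) q}"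
  proof (intro equalityI subsetI)
    fix l assume "l \<in> range ?e"
    then obtain n where n: "l = ?e n" by blast
    have "?e n \<in> farey" by (rule unimodular_edge) (use v w vdet_fan(1)[OF vw] in auto)
    then show "l \<in> {l \<in> farey. \<exists>q. l = geod (pt v) q}" using n by blast
  next
    fix l assume "l \<in> {l \<in> farey. \<exists>q. l = geod (pt v) q}"
    then obtain q where q: "l = geod (pt v) q" "geod (pt v) q \<in> farey" by blast
    obtain n where "q = pt (of_int n *\<^sub>R v + w)" using farey_neighbour[OF v w vw q(2)] .
    then show "l \<in> range ?e" using q by blast
  qed
  moreover have "\<exists>\<tau>. strict_mono \<tau> \<and> (\<forall>n :: int. horocycle (pt v) (\<tau> n) \<in> ?e n)"
  proof (cases "snd v = 0")
    case True
    have ps: "fst v * snd w = 1" using vw True by (simp add: vdet_def)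
    then have f: "fst v \<noteq> 0" "snd w \<noteq> 0" by auto
    have "fst v \<in> \<int>" "snd w \<in> \<int>" using v w by (auto simp: int_vec_def)
    then have "\<bar>snd w\<bar> = 1" using abs_Ints_mult_1[of "fst v" "snd w"] ps by simp
    then have s2: "snd w * snd w = 1" by (metis abs_mult_self_eq mult_1)
    then have fs: "fst v = snd w" using ps f by (metis mult_right_cancel)
    let ?\<tau> = "\<lambda>n :: int. of_int n + fst w * snd w"
    have "strict_mono ?\<tau>" by (rule strict_monoI) simp
    moreover have "horocycle (pt v) (?\<tau> n) \<in> ?e n" for n
    proof -
      have h: "horocycle (pt v) (?\<tau> n) = Complex (?\<tau> n) 1" using True by (simp add: pt_def)
      have "fst w - snd w * (fst w * snd w) = 0" using s2 by (simp add: algebra_simps)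
      then have "nv (of_int n *\<^sub>R v + w) (Complex (?\<tau> n) 1) = Complex 0 (- snd w)"
        by (simp add: nv_def True fs complex_eq_iff algebra_simps)
      then show ?thesis unfolding h mem_geod_pt[OF nz fan_nonzero[OF vw]]
        by (simp add: nv_def True)
    qed
    ultimately show ?thesis by blast
  next
    case False
    let ?q = "snd v"
    \<comment> \<open>The real point that \<open>z \<mapsto> x - 1 / z\<close> sends to the other
      endpoint of the \<open>n\<close>-th edge; the edge is the image of the vertical line above it.
      The increment is the square of \<open>snd v\<close>, so the order does not depend on its
      sign.\<close>
    let ?\<tau> = "\<lambda>n :: int. (of_int n * ?q + snd w) * ?q"
    have "strict_mono ?\<tau>"
    proof (rule strict_monoI)
      fix m n :: int assume "m < n"
      then have "of_int m * ?q\<^sup>2 < of_int n * ?q\<^sup>2" using False by simp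
      then show "?\<tau> m < ?\<tau> n" by (simp add: power2_eq_square algebra_simps)
    qed
    moreover have "horocycle (pt v) (?\<tau> n) \<in> ?e n" for n
    proof -
      define u where "u = of_int n *\<^sub>R v + w"
      define t where "t = ?\<tau> n"
      define T where "T = Complex t 1"
      define z where "z = of_real (fst v / ?q) - 1 / T"
      have h: "horocycle (pt v) (?\<tau> n) = z" using False by (simp add: pt_def z_def T_def t_def)
      have T0: "T \<noteq> 0" by (simp add: T_def complex_eq_iff)
      have vu: "fst v * snd u - snd v * fst u = 1" using vdet_fan(1)[OF vw, of "of_int n"] by (simp add: u_def vdet_def)
      have tu: "t = snd u * ?q" by (simp add: t_def u_def)
      have "Im z = 1 / (cmod T)\<^sup>2" unfolding z_def by (simp add: Im_divide cmod_power2 T_def)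
      then have Iz: "Im z > 0" using T0 by simp
      have q0: "complex_of_real ?q \<noteq> 0" using False by simp
      have n1: "nv v z = of_real ?q / T" unfolding nv_def z_def using q0 T0 by (simp add: field_simps)
      have "of_real ?q * nv u z = of_real (snd v * fst u - fst v * snd u) + of_real (snd u * ?q) / T"
        unfolding nv_def z_def using q0 T0 by (simp add: field_simps)
      also have "\<dots> = (of_real t - T) / T" using vu T0 by (simp add: tu field_simps)
      also have "of_real t - T = - \<i>" by (simp add: T_def complex_eq_iff)
      finally have n2: "of_real ?q * nv u z = - \<i> / T" .
      have "nv v z * cnj (nv u z) = (of_real ?q * cnj (nv u z)) / T" by (simp add: n1)
      also have "of_real ?q * cnj (nv u z) = cnj (of_real ?q * nv u z)" by simp
      also have "\<dots> / T = \<i> / of_real ((cmod T)\<^sup>2)" unfolding n2 complex_norm_square by (simp add: mult.commute)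
      also have "Re \<dots> = 0" by (simp only: Re_divide_of_real) simp
      finally have "z \<in> geod (pt v) (pt u)"
        unfolding mem_geod_pt[OF nz fan_nonzero[OF vw, of "of_int n", folded u_def]] using Iz by simp
      then show ?thesis unfolding h u_def .
    qed
    ultimately show ?thesis by blast
  qed
  ultimately show ?thesis unfolding is_fan_def bij_betw_def by blast
qed

lemma farey_point_unimodular:
  assumes "int_vec v" "int_vec w" "vdet v w = 1"
  shows "pt v \<in> farey_points"
  unfolding farey_points_def using unimodular_edge[of v w] assms by auto

section \<open>Shears of the edges\<close>

lemma cross_ratio_rotate: "cross_ratio c d a b = cross_ratio a b c d"
  by (cases a; cases b; cases c; cases d)
     (simp_all add: divide_simps, simp_all add: algebra_simps)

text \<open>An edge has only two common neighbours: comparing the fans at both ends gives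
  \<open>n * (- m) = 1\<close> in the integers. Orientation decides between \<open>w + v\<close> and
  \<open>w - v\<close>.\<close>

lemma farey_third_vertex:
  assumes v: "int_vec v" and w: "int_vec w" and vw: "vdet v w = 1"
    and e: "geod (pt v) b \<in> farey" "geod (pt w) b \<in> farey" and ccw: "ccw (pt v) b (pt w)"
  shows "b = pt (w - v)"
proof -
  obtain n where n: "b = pt (of_int n *\<^sub>R v + w)" using farey_neighbour[OF v w vw e(1)] .
  have wv: "vdet w (- v) = 1" using vw vdet_swap[of w v] by (simp add: vdet_simps)
  obtain m where m: "b = pt (of_int m *\<^sub>R w + - v)"
    using farey_neighbour[OF w int_vec_simps(3)[OF v] wv e(2)] .
  have "vdet (of_int n *\<^sub>R v + w) (of_int m *\<^sub>R w + - v) = 0"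
    using pt_eq_iff[OF fan_nonzero[OF vw] fan_nonzero[OF wv]] n m by metis
  then have "of_int (n * m + 1) = (0 :: real)" using vw vdet_swap[of w v] by (simp add: vdet_simps mult.commute)
  then have "n * (- m) = 1" by (metis add_eq_0_iff of_int_eq_0_iff minus_minus mult_minus_right add.commute)
  then have "n = 1 \<or> n = - 1" using zmult_eq_1_iff by blast
  then show ?thesis
  proof
    assume "n = 1"
    then have "ccw (pt v) (pt (v + w)) (pt w)" using ccw n by simp
    moreover have "v + w \<noteq> 0" "v \<noteq> 0" "w \<noteq> 0"
      using fan_nonzero[OF vw, of 1] vdet_nonzero[of v w] vw by auto
    ultimately show ?thesis using vw vdet_swap[of w v] by (simp add: ccw_pt_iff vdet_simps)
  next
    assume "n = - 1"
    then show ?thesis using n by simp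
  qed
qed

text \<open>The definite description is evaluated: \<open>geod_eqD\<close> fixes the endpoints up to
  exchange, \<open>farey_third_vertex\<close> fixes the apexes, and exchanging the endpoints only
  rotates the cross ratio.\<close>

lemma shear_eq:
  assumes v: "int_vec v" and w: "int_vec w" and vw: "vdet v w = 1"
  shows "shear h (geod (pt v) (pt w)) =
    ln (cross_ratio (h (pt v)) (h (pt (w - v))) (h (pt w)) (h (pt (w + v))))"
  unfolding shear_def
proof (rule the_equality)
  have wv: "vdet w v = - 1" using vw vdet_swap[of w v] by simp
  have nz: "v \<noteq> 0" "w \<noteq> 0" "w - v \<noteq> 0" "w + v \<noteq> 0"
    using fan_nonzero[OF vw, of 1] fan_nonzero[OF vw, of "-1"] vdet_nonzero[of v w] vw by (auto simp: add.commute)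
  have "ccw4 (pt v) (pt (w - v)) (pt w) (pt (w + v))"
    unfolding ccw4_def using nz vw wv by (simp add: ccw_pt_iff vdet_simps)
  moreover have "farey_triangle (pt v) (pt w) (pt (w + v))"
    using unimodular_triangle[OF v w] vw by (simp add: add.commute)
  moreover have "farey_triangle (pt v) (pt (w - v)) (pt w)"
    using unimodular_triangle[of v "w - v"] v w vw by (simp add: vdet_simps)
  ultimately show "\<exists>a b c d. geod (pt v) (pt w) = geod a c \<and> ccw4 a b c d \<and> farey_triangle a b c \<and> farey_triangle a c d \<and>
       ln (cross_ratio (h (pt v)) (h (pt (w - v))) (h (pt w)) (h (pt (w + v)))) = ln (cross_ratio (h a) (h b) (h c) (h d))"
    by blast
  fix t assume "\<exists>a b c d. geod (pt v) (pt w) = geod a c \<and> ccw4 a b c d \<and> farey_triangle a b c \<and> farey_triangle a c d \<and>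
       t = ln (cross_ratio (h a) (h b) (h c) (h d))"
  then obtain a b c d where g: "geod (pt v) (pt w) = geod a c" and c4: "ccw4 a b c d"
    and tri: "farey_triangle a b c" "farey_triangle a c d" and t: "t = ln (cross_ratio (h a) (h b) (h c) (h d))" by blast
  note e1 = farey_triangle_edges[OF tri(1)] and e2 = farey_triangle_edges[OF tri(2)]
  have e: "geod a b \<in> farey" "geod c b \<in> farey" "geod c d \<in> farey" "geod a d \<in> farey"
    using e1 e2 geod_commute[of b c] by simp_all
  have cc: "ccw a b c" "ccw c d a" using c4 by (auto simp: ccw4_def)
  have mw: "vdet w (- v) = 1" "int_vec (- v)" using wv v by (simp_all add: vdet_simps)
  have pv: "pt (- v - w) = pt (w + v)" using pt_minus[of "w + v"] by (simp add: algebra_simps)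
  have "pt v \<noteq> pt w" using pt_eq_iff[OF nz(1,2)] vw by simp
  from geod_eqD[OF g this] consider "a = pt v" "c = pt w" | "a = pt w" "c = pt v" by (auto simp: doubleton_eq_iff)
  then show "t = ln (cross_ratio (h (pt v)) (h (pt (w - v))) (h (pt w)) (h (pt (w + v))))"
  proof cases
    case 1
    have "b = pt (w - v)" by (rule farey_third_vertex[OF v w vw]) (use 1 e cc in auto)
    moreover have "d = pt (- v - w)" by (rule farey_third_vertex[OF w mw(2,1)]) (use 1 e cc in auto)
    ultimately show ?thesis using t 1 pv by simp
  next
    case 2
    have "d = pt (w - v)" by (rule farey_third_vertex[OF v w vw]) (use 2 e cc in auto)
    moreover have "b = pt (- v - w)" by (rule farey_third_vertex[OF w mw(2,1)]) (use 2 e cc in auto)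
    ultimately show ?thesis using t 2 pv cross_ratio_rotate by simp
  qed
qed

lemma fan_ratio_le_shear_norm:
  assumes "int_vec v" "int_vec w" "vdet v w = 1"
  shows "ereal \<bar>ln (fan_ratio (\<lambda>n. s (geod (pt v) (pt (of_int n *\<^sub>R v + w)))) m k)\<bar> \<le> shear_norm s"
  unfolding shear_norm_def
  by (rule SUP_upper2[OF farey_point_unimodular[OF assms]],
      rule SUP_upper2[where i = "\<lambda>n. geod (pt v) (pt (of_int n *\<^sub>R v + w))"],
      simp add: is_fan_unimodular[OF assms], rule SUP_upper2[OF UNIV_I], rule SUP_upper2[OF UNIV_I], rule order_refl)

section \<open>The boundary circle\<close>

text \<open>For \<open>v = (p, q)\<close> this is \<open>q - \<i> * p\<close>, a homogeneous
  denominator of the Cayley transform at \<open>p / q\<close> that also covers infinity. Its modulus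
  is the Euclidean length of \<open>v\<close>.\<close>

definition bdry_den :: "real \<times> real \<Rightarrow> complex" where
  "bdry_den v = Complex (snd v) (- fst v)"

lemma bdry_den_nonzero: "v \<noteq> 0 \<Longrightarrow> bdry_den v \<noteq> 0"
  by (auto simp: bdry_den_def complex_eq_iff prod_eq_iff)

lemma cayley_bdry_pt:
  assumes "v \<noteq> 0"
  shows "cayley_bdry (pt v) = cnj (bdry_den v) / bdry_den v"
proof (cases "snd v = 0")
  case True
  then have "cnj (bdry_den v) = - bdry_den v" by (simp add: bdry_den_def complex_eq_iff)
  then show ?thesis using True bdry_den_nonzero[OF assms] by (simp add: pt_def)
next
  case False
  let ?p = "complex_of_real (fst v)" and ?q = "complex_of_real (snd v)"
  have D: "bdry_den v = ?q - \<i> * ?p" "cnj (bdry_den v) = ?q + \<i> * ?p"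
    by (simp_all add: bdry_den_def complex_eq_iff)
  have n: "?p + \<i> * ?q \<noteq> 0" "?q - \<i> * ?p \<noteq> 0" "?q \<noteq> 0" "?p / ?q + \<i> \<noteq> 0"
    using False by (auto simp: complex_eq_iff)
  have "cayley_bdry (pt v) = - ((?p / ?q - \<i>) / (?p / ?q + \<i>))"
    using False by (simp add: pt_def cayley_def)
  also have "\<dots> = (?q + \<i> * ?p) / (?q - \<i> * ?p)"
    using n by (simp add: divide_simps) (simp add: algebra_simps)
  finally show ?thesis by (simp add: D)
qed

lemma cmod_cayley_bdry [simp]: "cmod (cayley_bdry a) = 1"
proof -
  have "cayley_bdry a = cnj (bdry_den (hom_coord a)) / bdry_den (hom_coord a)"
    using cayley_bdry_pt[of "hom_coord a"] by simp
  then show ?thesis using bdry_den_nonzero[of "hom_coord a"] by (simp add: norm_divide)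
qed

lemma cayley_bdry_diff:
  assumes "u \<noteq> 0" "v \<noteq> 0"
  shows "cayley_bdry (pt u) - cayley_bdry (pt v) = 2 * \<i> * of_real (vdet u v) / (bdry_den u * bdry_den v)"
proof -
  have "cnj (bdry_den u) * bdry_den v - cnj (bdry_den v) * bdry_den u = 2 * \<i> * of_real (vdet u v)"
    by (simp add: bdry_den_def vdet_def complex_eq_iff algebra_simps)
  then show ?thesis
    unfolding cayley_bdry_pt[OF assms(1)] cayley_bdry_pt[OF assms(2)]
    using bdry_den_nonzero[OF assms(1)] bdry_den_nonzero[OF assms(2)] by (simp add: diff_frac_eq)
qed

lemma dist_cayley_bdry:
  assumes "u \<noteq> 0" "v \<noteq> 0"
  shows "cmod (cayley_bdry (pt u) - cayley_bdry (pt v)) = 2 * \<bar>vdet u v\<bar> / (cmod (bdry_den u) * cmod (bdry_den v))"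
  unfolding cayley_bdry_diff[OF assms] by (simp add: norm_divide norm_mult)

lemma dist_cayley_bdry_Some: "cmod (cayley_bdry (Some x) - cayley_bdry (Some y)) = 2 * \<bar>x - y\<bar> / (sqrt (1 + x\<^sup>2) * sqrt (1 + y\<^sup>2))"
  using dist_cayley_bdry[of "(x, 1)" "(y, 1)"]
  by (simp add: pt_def vdet_def bdry_den_def cmod_def prod_eq_iff del: cayley_bdry.simps)

lemma dist_cayley_bdry_None: "cmod (cayley_bdry (Some x) - cayley_bdry None) = 2 / sqrt (1 + x\<^sup>2)"
  using dist_cayley_bdry[of "(x, 1)" "(1, 0)"]
  by (simp add: pt_def vdet_def bdry_den_def cmod_def prod_eq_iff del: cayley_bdry.simps)

lemma inj_cayley_bdry: "inj cayley_bdry"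
proof (rule injI)
  fix a b assume "cayley_bdry a = cayley_bdry b"
  then have "vdet (hom_coord a) (hom_coord b) = 0"
    using dist_cayley_bdry[of "hom_coord a" "hom_coord b"] bdry_den_nonzero[of "hom_coord a"] bdry_den_nonzero[of "hom_coord b"] by simp
  then show "a = b" using pt_eq_iff[of "hom_coord a" "hom_coord b"] by simp
qed

lemma cayley_bdry_surj:
  assumes "cmod \<zeta> = 1"
  obtains a where "cayley_bdry a = \<zeta>"
proof (cases "\<zeta> = -1")
  case True then show ?thesis using that[of None] by simp
next
  case False
  have u: "(Re \<zeta>)\<^sup>2 + (Im \<zeta>)\<^sup>2 = 1" using assms by (simp flip: cmod_power2)
  have "1 + Re \<zeta> \<noteq> 0"
  proof
    assume "1 + Re \<zeta> = 0"
    then have "Re \<zeta> = -1" "Im \<zeta> = 0" using u by (auto simp: add_eq_0_iff)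
    then show False using False by (simp add: complex_eq_iff)
  qed
  then have v: "(Im \<zeta>, 1 + Re \<zeta>) \<noteq> 0" by (simp add: prod_eq_iff)
  have "\<zeta> * bdry_den (Im \<zeta>, 1 + Re \<zeta>) = cnj (bdry_den (Im \<zeta>, 1 + Re \<zeta>))"
    using u by (simp add: bdry_den_def complex_eq_iff algebra_simps power2_eq_square)
  then have "cayley_bdry (pt (Im \<zeta>, 1 + Re \<zeta>)) = \<zeta>"
    unfolding cayley_bdry_pt[OF v] using bdry_den_nonzero[OF v] by (simp add: field_simps)
  then show ?thesis using that by blast
qed

lemma range_cayley_bdry: "range cayley_bdry = sphere 0 1"
proof
  show "range cayley_bdry \<subseteq> sphere 0 1" using cmod_cayley_bdry by (auto simp del: cayley_bdry.simps)
  show "sphere 0 1 \<subseteq> range cayley_bdry" using cayley_bdry_surj by (metis dist_0_norm mem_sphere rangeI subsetI)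
qed

lemma inv_cayley_bdry: "inv cayley_bdry (cayley_bdry a) = a" "cmod \<zeta> = 1 \<Longrightarrow> cayley_bdry (inv cayley_bdry \<zeta>) = \<zeta>"
  using inj_cayley_bdry by (simp_all del: cayley_bdry.simps) (metis f_inv_into_f range_cayley_bdry dist_0_norm mem_sphere)

lemma orient_cayley_bdry_pt:
  assumes "u \<noteq> 0" "v \<noteq> 0" "w \<noteq> 0"
  shows "orient (cayley_bdry (pt u)) (cayley_bdry (pt v)) (cayley_bdry (pt w)) =
    4 * (vdet v u * vdet w v * vdet w u) / ((cmod (bdry_den u))\<^sup>2 * (cmod (bdry_den v))\<^sup>2 * (cmod (bdry_den w))\<^sup>2)"
proof -
  have n: "bdry_den u \<noteq> 0" "bdry_den v \<noteq> 0" "bdry_den w \<noteq> 0" using assms bdry_den_nonzero by auto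
  have eq: "- (2 * \<i> * x / (A * B) * (2 * \<i> * y / (B * C)) * (2 * \<i> * t / (C * A))) / (A' / A * (B' / B) * (C' / C)) =
     (4 * (x * y * t) / ((A * A') * (B * B') * (C * C'))) * (2 * \<i>)"
    if "A \<noteq> 0" "B \<noteq> 0" "C \<noteq> 0" "A' \<noteq> 0" "B' \<noteq> 0" "C' \<noteq> 0" for x y t A B C A' B' C' :: complex
    using that by (simp add: divide_simps)
  have "of_real (orient (cayley_bdry (pt u)) (cayley_bdry (pt v)) (cayley_bdry (pt w))) * (2 * \<i>) =
     (4 * (of_real (vdet u v) * of_real (vdet v w) * of_real (vdet w u)) /
       ((bdry_den u * cnj (bdry_den u)) * (bdry_den v * cnj (bdry_den v)) * (bdry_den w * cnj (bdry_den w)))) * (2 * \<i>)"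
    unfolding orient_eq[OF cmod_cayley_bdry cmod_cayley_bdry cmod_cayley_bdry]
      cayley_bdry_diff[OF assms(1,2)] cayley_bdry_diff[OF assms(2,3)] cayley_bdry_diff[OF assms(3,1)]
    unfolding cayley_bdry_pt[OF assms(1)] cayley_bdry_pt[OF assms(2)] cayley_bdry_pt[OF assms(3)]
    by (rule eq) (use n in auto)
  also have "\<dots> = of_real (4 * (vdet u v * vdet v w * vdet w u) / ((cmod (bdry_den u))\<^sup>2 * (cmod (bdry_den v))\<^sup>2 * (cmod (bdry_den w))\<^sup>2)) * (2 * \<i>)"
    unfolding of_real_mult of_real_divide complex_norm_square by simp
  finally have "orient (cayley_bdry (pt u)) (cayley_bdry (pt v)) (cayley_bdry (pt w)) =
    4 * (vdet u v * vdet v w * vdet w u) / ((cmod (bdry_den u))\<^sup>2 * (cmod (bdry_den v))\<^sup>2 * (cmod (bdry_den w))\<^sup>2)"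
    by (metis complex_i_not_zero mult_cancel_right mult_eq_0_iff of_real_eq_iff zero_neq_numeral)
  then show ?thesis by (simp add: vdet_swap[of v u] vdet_swap[of w v])
qed

lemma orient_cayley_bdry: "orient (cayley_bdry a) (cayley_bdry b) (cayley_bdry c) > 0 \<longleftrightarrow> ccw a b c"
proof -
  let ?u = "hom_coord a" and ?v = "hom_coord b" and ?w = "hom_coord c"
  have "(cmod (bdry_den ?u))\<^sup>2 * (cmod (bdry_den ?v))\<^sup>2 * (cmod (bdry_den ?w))\<^sup>2 > 0"
    using bdry_den_nonzero[of ?u] bdry_den_nonzero[of ?v] bdry_den_nonzero[of ?w] by simp
  then show ?thesis
    using orient_cayley_bdry_pt[of ?u ?v ?w] ccw_pt_iff[of ?u ?v ?w] by (simp add: zero_less_divide_iff mult_ac del: cayley_bdry.simps)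
qed

text \<open>A continuous bijection from a compact to a Hausdorff space is a homeomorphism.
  Continuity at infinity comes from the chord length \<open>2 / sqrt (1 + x\<^sup>2)\<close> to the
  point -1, which bounds the complement of a neighbourhood.\<close>

lemma homeomorphic_map_cayley_bdry:
  "homeomorphic_map (Alexandroff_compactification euclideanreal) (top_of_set (sphere 0 1)) cayley_bdry"
proof (rule continuous_imp_homeomorphic_map)
  let ?A = "Alexandroff_compactification euclideanreal"
  have top: "topspace ?A = UNIV" by (auto simp: notin_range_Some)
  have cont: "continuous_on UNIV (\<lambda>x. cayley_bdry (Some x))"
  proof -
    have "x + \<i> \<noteq> 0" for x :: real by (simp add: complex_eq_iff)
    then show ?thesis by (auto simp: cayley_def intro!: continuous_intros)
  qed
  show "continuous_map ?A (top_of_set (sphere 0 1)) cayley_bdry"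
  proof (rule continuous_map_into_subtopology)
    show "continuous_map ?A euclidean cayley_bdry"
      unfolding continuous_map_def
    proof (intro conjI strip)
      fix W :: "complex set" assume "openin euclidean W"
      then have W: "open W" by simp
      define V where "V = (\<lambda>x. cayley_bdry (Some x)) -` W"
      have V: "open V" unfolding V_def using W cont by (rule open_vimage)
      show "openin ?A {x \<in> topspace ?A. cayley_bdry x \<in> W}"
      proof (cases "-1 \<in> W")
        case False
        have "x \<in> {x \<in> topspace ?A. cayley_bdry x \<in> W} \<longleftrightarrow> x \<in> Some ` V" for x
          using False unfolding top by (cases x) (auto simp: V_def)
        then have "{x \<in> topspace ?A. cayley_bdry x \<in> W} = Some ` V" by blast
        then show ?thesis using V by simp
      next
        case True
        then obtain e where e: "e > 0" "ball (-1) e \<subseteq> W" using W openE by blast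
        have "- V \<subseteq> cball 0 (2 / e)"
        proof
          fix x assume "x \<in> - V"
          then have "cayley_bdry (Some x) \<notin> ball (-1) e" using e(2) by (auto simp: V_def)
          then have "e \<le> 2 / sqrt (1 + x\<^sup>2)"
            using dist_cayley_bdry_None[of x] norm_minus_commute[of "-1" "cayley_bdry (Some x)"]
            by (simp add: dist_norm del: cayley_bdry.simps(1))
          moreover have pos: "sqrt (1 + x\<^sup>2) > 0" by (simp add: add_pos_nonneg)
          ultimately have "sqrt (1 + x\<^sup>2) \<le> 2 / e" using e(1) by (simp add: field_simps)
          moreover have "\<bar>x\<bar> \<le> sqrt (1 + x\<^sup>2)" by (simp add: real_le_rsqrt)
          ultimately show "x \<in> cball 0 (2 / e)" by simp
        qed
        then have "compact (- V)"
          using V by (metis bounded_cball bounded_subset closed_Compl compact_eq_bounded_closed double_complement open_closed)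
        moreover have "{x \<in> topspace ?A. cayley_bdry x \<in> W} = insert None (Some ` (topspace euclideanreal - (- V)))"
        proof -
          have "x \<in> {x \<in> topspace ?A. cayley_bdry x \<in> W} \<longleftrightarrow> x \<in> insert None (Some ` (topspace euclideanreal - (- V)))" for x
            using True unfolding top by (cases x) (auto simp: V_def)
          then show ?thesis by blast
        qed
        ultimately show ?thesis
          unfolding openin_Alexandroff_compactification using V by (intro disjI2 exI[of _ "- V"]) auto
      qed
    qed simp
    show "cayley_bdry \<in> topspace ?A \<rightarrow> sphere 0 1" by (auto simp del: cayley_bdry.simps)
  qed
  show "compact_space ?A" by simp
  show "Hausdorff_space (top_of_set (sphere 0 1 :: complex set))" by (simp add: Hausdorff_space_subtopology)
  show "cayley_bdry ` topspace ?A = topspace (top_of_set (sphere 0 1))" unfolding top using range_cayley_bdry by simp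
  show "inj_on cayley_bdry (topspace ?A)" unfolding top by (rule inj_cayley_bdry)
qed

lemma circle_map_boundary:
  assumes "orientation_preserving_homeo h"
  shows "circle_map (cayley_bdry \<circ> h \<circ> inv cayley_bdry)"
proof -
  let ?A = "Alexandroff_compactification euclideanreal" and ?S = "top_of_set (sphere 0 1 :: complex set)"
  have h: "homeomorphic_map ?A ?A h" "\<And>a b c. ccw a b c \<Longrightarrow> ccw (h a) (h b) (h c)"
    using assms by (auto simp: orientation_preserving_homeo_def)
  obtain k where k: "homeomorphic_maps ?A ?S cayley_bdry k"
    using homeomorphic_map_cayley_bdry unfolding homeomorphic_map_maps by blast
  have "continuous_map ?S ?S (cayley_bdry \<circ> (h \<circ> k))"
    by (intro continuous_map_compose[of _ ?A] homeomorphic_imp_continuous_map[OF h(1)]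
        homeomorphic_imp_continuous_map[OF homeomorphic_map_cayley_bdry]) (use k in \<open>simp add: homeomorphic_maps_def\<close>)
  then have "continuous_map ?S euclidean (cayley_bdry \<circ> (h \<circ> k))" by (rule continuous_map_into_fulltopology)
  then have c: "continuous_on (sphere 0 1) (cayley_bdry \<circ> (h \<circ> k))" by simp
  have "k \<zeta> = inv cayley_bdry \<zeta>" if "\<zeta> \<in> sphere 0 1" for \<zeta>
    using k that inv_cayley_bdry(1)[of "k \<zeta>"] by (simp add: homeomorphic_maps_def)
  then have "continuous_on (sphere 0 1) (cayley_bdry \<circ> h \<circ> inv cayley_bdry)"
    by (intro continuous_on_eq[OF c]) simp
  moreover have "orient ((cayley_bdry \<circ> h \<circ> inv cayley_bdry) p) ((cayley_bdry \<circ> h \<circ> inv cayley_bdry) q) ((cayley_bdry \<circ> h \<circ> inv cayley_bdry) r) > 0"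
    if u: "cmod p = 1" "cmod q = 1" "cmod r = 1" and o: "orient p q r > 0" for p q r
  proof -
    have "ccw (inv cayley_bdry p) (inv cayley_bdry q) (inv cayley_bdry r)"
      using o orient_cayley_bdry[of "inv cayley_bdry p" "inv cayley_bdry q" "inv cayley_bdry r"]
      by (simp add: inv_cayley_bdry(2) u)
    then show ?thesis using h(2) orient_cayley_bdry by simp
  qed
  ultimately show ?thesis unfolding circle_map_def by (simp del: cayley_bdry.simps)
qed

lemma cayley_eq: "Im z > 0 \<Longrightarrow> cayley z = (1 + \<i> * z) / (1 - \<i> * z)" and
  cayley_den_nonzero: "Im z > 0 \<Longrightarrow> 1 - \<i> * z \<noteq> 0"
proof -
  assume z: "Im z > 0"
  show n: "1 - \<i> * z \<noteq> 0" using z by (auto simp: complex_eq_iff)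
  have n2: "z + \<i> \<noteq> 0" using z by (auto simp: complex_eq_iff)
  have "(1 + \<i> * z) * (z + \<i>) = - (z - \<i>) * (1 - \<i> * z)" by (simp add: algebra_simps)
  then have "(1 + \<i> * z) / (1 - \<i> * z) = - (z - \<i>) / (z + \<i>)" using n n2 by (subst frac_eq_eq) (auto simp: mult.commute)
  then show "cayley z = (1 + \<i> * z) / (1 - \<i> * z)" unfolding cayley_def by (simp only: minus_divide_left)
qed

lemma one_minus_cmod_cayley_sq:
  assumes "Im z > 0"
  shows "1 - (cmod (cayley z))\<^sup>2 = 4 * Im z / (cmod (1 - \<i> * z))\<^sup>2"
proof -
  have "(cmod (1 - \<i> * z))\<^sup>2 - (cmod (1 + \<i> * z))\<^sup>2 = 4 * Im z"
    unfolding cmod_power2 by (simp add: power2_eq_square algebra_simps)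
  moreover have "(cmod (1 - \<i> * z))\<^sup>2 > 0" using cayley_den_nonzero[OF assms] by simp
  ultimately show ?thesis
    unfolding cayley_eq[OF assms] norm_divide power_divide by (simp add: field_simps)
qed

lemma cmod_cayley_less_1: "Im z > 0 \<Longrightarrow> cmod (cayley z) < 1"
proof -
  assume z: "Im z > 0"
  then have "1 - (cmod (cayley z))\<^sup>2 > 0"
    unfolding one_minus_cmod_cayley_sq[OF z] using cayley_den_nonzero[OF z] by simp
  then show ?thesis by (simp add: abs_square_less_1)
qed

lemma cayley_inverse: "Im z > 0 \<Longrightarrow> \<i> * (1 - cayley z) / (1 + cayley z) = z"
proof -
  assume z: "Im z > 0"
  have "1 - cayley z = - 2 * \<i> * z / (1 - \<i> * z)" "1 + cayley z = 2 / (1 - \<i> * z)"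
    unfolding cayley_eq[OF z] using cayley_den_nonzero[OF z] by (simp_all add: field_simps)
  then have "\<i> * (1 - cayley z) / (1 + cayley z) = \<i> * (- 2 * \<i> * z / (1 - \<i> * z)) / (2 / (1 - \<i> * z))"
    by (simp only:)
  also have "\<dots> = z" using cayley_den_nonzero[OF z] by (simp add: field_simps)
  finally show ?thesis .
qed

lemma cayley_surj:
  assumes "cmod \<zeta> < 1"
  shows "Im (\<i> * (1 - \<zeta>) / (1 + \<zeta>)) > 0" "cayley (\<i> * (1 - \<zeta>) / (1 + \<zeta>)) = \<zeta>"
proof -
  have n: "1 + \<zeta> \<noteq> 0" using assms by (metis add.commute add_eq_0_iff norm_minus_cancel norm_one less_irrefl)
  have "Im (\<i> * (1 - \<zeta>) / (1 + \<zeta>)) = Im (\<i> * (1 - \<zeta>) * cnj (1 + \<zeta>)) / (cmod (1 + \<zeta>))\<^sup>2"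
    by (simp add: Im_divide cmod_power2)
  also have "Im (\<i> * (1 - \<zeta>) * cnj (1 + \<zeta>)) = 1 - (cmod \<zeta>)\<^sup>2"
    unfolding cmod_power2 by (simp add: power2_eq_square algebra_simps)
  finally show I: "Im (\<i> * (1 - \<zeta>) / (1 + \<zeta>)) > 0" using n assms by (simp add: abs_square_less_1)
  have a: "1 + \<i> * (\<i> * (1 - \<zeta>) / (1 + \<zeta>)) = 2 * \<zeta> / (1 + \<zeta>)" "1 - \<i> * (\<i> * (1 - \<zeta>) / (1 + \<zeta>)) = 2 / (1 + \<zeta>)"
    using n by (simp_all add: field_simps)
  show "cayley (\<i> * (1 - \<zeta>) / (1 + \<zeta>)) = \<zeta>"
    unfolding cayley_eq[OF I] a using n by simp
qed

text \<open>The chord between two boundary points once \<open>z\<close> has been moved to the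
  origin. The factors of the Cayley transform cancel and only the linear forms \<open>nv\<close>
  remain, so the formula can be rewritten in any unimodular basis.\<close>

lemma visual_distance:
  assumes z: "Im z > 0" and "u \<noteq> 0" "v \<noteq> 0"
  shows "cmod (disk_mob (cayley z) (cayley_bdry (pt u)) - disk_mob (cayley z) (cayley_bdry (pt v))) =
    2 * Im z * \<bar>vdet u v\<bar> / (cmod (nv u z) * cmod (nv v z))"
proof -
  have d: "cmod (1 - cnj (cayley z) * cayley_bdry (pt x)) = 2 * cmod (nv x z) / (cmod (bdry_den x) * cmod (1 - \<i> * z))"
    if "x \<noteq> 0" for x
  proof -
    have "cnj (bdry_den x) * (1 - \<i> * z) - (1 + \<i> * z) * bdry_den x = 2 * \<i> * nv x z"
      by (simp add: bdry_den_def nv_def complex_eq_iff algebra_simps)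
    then have "cayley_bdry (pt x) - cayley z = 2 * \<i> * nv x z / (bdry_den x * (1 - \<i> * z))"
      unfolding cayley_bdry_pt[OF that] cayley_eq[OF z]
      using bdry_den_nonzero[OF that] cayley_den_nonzero[OF z] by (simp add: diff_frac_eq)
    then show ?thesis
      using cmod_disk_mob_denom[of "cayley_bdry (pt x)" "cayley z"] by (simp add: norm_divide norm_mult del: cayley_bdry.simps)
  qed
  have nz: "1 - cnj (cayley z) * cayley_bdry (pt x) \<noteq> 0" for x
    using disk_mob_denom_nonzero[OF cmod_cayley_less_1[OF z]] by simp
  have n: "cmod (bdry_den u) \<noteq> 0" "cmod (bdry_den v) \<noteq> 0" "cmod (1 - \<i> * z) \<noteq> 0" "cmod (nv u z) \<noteq> 0" "cmod (nv v z) \<noteq> 0"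
    using bdry_den_nonzero assms cayley_den_nonzero[OF z] nz[of u] nz[of v] d[of u] d[of v] by (auto simp del: cayley_bdry.simps)
  have p: "cmod (of_real (1 - (cmod (cayley z))\<^sup>2)) = 4 * Im z / (cmod (1 - \<i> * z))\<^sup>2"
    unfolding norm_of_real one_minus_cmod_cayley_sq[OF z] using z by simp
  show ?thesis
    unfolding disk_mob_diff[OF nz nz] norm_divide norm_mult p dist_cayley_bdry[OF assms(2,3)] d[OF assms(2)] d[OF assms(3)]
    using n by (simp add: divide_simps power2_eq_square)
qed

section \<open>Separation of boundary points\<close>

lemma sqrt_one_plus_sq_add: "sqrt (1 + (x + t)\<^sup>2) \<le> sqrt (1 + x\<^sup>2) + \<bar>t\<bar>"
proof (rule real_le_lsqrt[THEN order.trans[OF _ order_refl]])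
  have x: "\<bar>x\<bar> \<le> sqrt (1 + x\<^sup>2)" by (simp add: real_le_rsqrt)
  have "x * t \<le> \<bar>x\<bar> * \<bar>t\<bar>" by (metis abs_ge_self abs_mult)
  also have "\<dots> \<le> sqrt (1 + x\<^sup>2) * \<bar>t\<bar>" using x by (intro mult_right_mono) auto
  finally show "1 + (x + t)\<^sup>2 \<le> (sqrt (1 + x\<^sup>2) + \<bar>t\<bar>)\<^sup>2"
    by (simp add: power2_sum algebra_simps)
qed auto

text \<open>Here \<open>P\<close>, \<open>Q\<close> parametrise the circle by the boundary of the upper half plane, \<open>Q\<close> being the point
  at infinity, such that \<open>z\<close> corresponds to the origin; \<open>G\<close> is \<open>f\<close> in the stereographic coordinates with
  pole \<open>f Q\<close>. Two lattice cells always have visual size less than \<open>6/5\<close>, so two points at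
  distance \<open>6/5\<close> are separated by complete cells.\<close>

lemma separation_of_lattice:
  fixes P :: "real \<Rightarrow> complex" and G :: "real \<Rightarrow> real" and f :: "complex \<Rightarrow> complex"
  defines "s \<equiv> \<lambda>a. sqrt (1 + (G a)\<^sup>2)"
  assumes y: "Im z > 0"
    and P: "\<And>a. cmod (P a) = 1" "cmod Q = 1" "\<And>\<xi>. cmod \<xi> = 1 \<Longrightarrow> \<xi> = Q \<or> (\<exists>a. \<xi> = P a)"
    and PP: "\<And>a b. cmod (P a - P b) = 2 * Im z * \<bar>a - b\<bar> / (cmod (of_real a - z) * cmod (of_real b - z))"
    and PQ: "\<And>a. cmod (P a - Q) = 2 * Im z / cmod (of_real a - z)"
    and G: "strict_mono G"
    and f: "\<And>\<xi>. cmod \<xi> = 1 \<Longrightarrow> cmod (f \<xi>) = 1"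
    and fPP: "\<And>a b. cmod (f (P a) - f (P b)) = 2 * \<bar>G a - G b\<bar> / (s a * s b)"
    and fPQ: "\<And>a. cmod (f (P a) - f Q) = 2 / s a"
    and far: "\<And>\<xi> \<alpha>. cmod \<xi> = 1 \<Longrightarrow> cmod \<alpha> = 1 \<Longrightarrow> \<exists>\<eta>. cmod \<eta> = 1 \<and> cmod (\<eta> - \<xi>) \<ge> 6 / 5 \<and> (cmod (f \<eta> - \<alpha>))\<^sup>2 > 1 / 2"
    and d: "d > 0" "d \<le> 29 / 100 * Im z" and lo: "lo \<le> Re z - 7 / 2 * Im z - 2 * d" and hi: "Re z + 7 / 2 * Im z + 2 * d \<le> hi"
    and \<kappa>: "\<kappa> \<ge> 1"
    and cells: "\<And>i :: int. lo \<le> of_int i * d \<Longrightarrow> of_int (i + 1) * d \<le> hi \<Longrightarrow> G hi - G lo \<le> \<kappa> * (G (of_int (i + 1) * d) - G (of_int i * d))"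
    and \<xi>\<eta>: "cmod \<xi> = 1" "cmod \<eta> = 1" "cmod (\<xi> - \<eta>) \<ge> 6 / 5"
  shows "cmod (f \<xi> - f \<eta>) \<ge> 1 / (950 * \<kappa> ^ 3)"
proof -
  define Y where "Y = Im z"
  have Y: "Y > 0" using y by (simp add: Y_def)
  define L where "L = G hi - G lo"
  have lohi: "lo < hi" using lo hi d Y by (simp add: Y_def)
  have Gm: "G a \<le> G b" if "a \<le> b" for a b using G that by (simp add: strict_mono_less_eq)
  have Lp: "L > 0" using G lohi by (simp add: L_def strict_mono_less)
  have s1: "s a \<ge> 1" for a by (simp add: s_def)
  have sG: "\<bar>G a\<bar> \<le> s a" for a by (simp add: s_def real_le_rsqrt)
  have Im_le: "Y \<le> cmod (of_real a - z)" for a using abs_Im_le_cmod[of "of_real a - z"] Y by (simp add: Y_def)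
  have pos: "0 < cmod (of_real a - z)" for a using Im_le[of a] Y by linarith
  have Re_le: "\<bar>a - Re z\<bar> \<le> cmod (of_real a - z)" for a using abs_Re_le_cmod[of "of_real a - z"] by simp
  \<comment> \<open>An interval of length \<open>2 * d\<close> contains a whole cell, the one
    starting at the first multiple of \<open>d\<close> not below \<open>a\<close>.\<close>
  have cell: "L / \<kappa> \<le> G (a + 2 * d) - G a" if "lo \<le> a" "a + 2 * d \<le> hi" for a
  proof -
    define i where "i = \<lceil>a / d\<rceil>"
    have "a / d \<le> of_int i" "of_int i < a / d + 1" unfolding i_def by linarith+
    then have i: "a \<le> of_int i * d" "of_int (i + 1) * d \<le> a + 2 * d" using d by (simp_all add: field_simps)
    have "L \<le> \<kappa> * (G (of_int (i + 1) * d) - G (of_int i * d))"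
      unfolding L_def by (rule cells) (use i that in linarith)+
    also have "\<dots> \<le> \<kappa> * (G (a + 2 * d) - G a)"
      using Gm[OF i(1)] Gm[OF i(2)] \<kappa> by (intro mult_left_mono) auto
    finally show ?thesis using \<kappa> by (simp add: field_simps)
  qed
  \<comment> \<open>Points at least \<open>7/2 * Y\<close> from \<open>Re z\<close> are seen within
    4/7 of \<open>Q\<close>. Two such points are at distance at most 8/7 < 6/5, so of two separated
    points one lies in the window.\<close>
  have ends: "cmod (P a - Q) \<le> 4 / 7" if "7 / 2 * Y \<le> \<bar>a - Re z\<bar>" for a
  proof -
    have "2 * Y / cmod (of_real a - z) \<le> 2 * Y / (7 / 2 * Y)"
      using that Re_le[of a] Y by (intro divide_left_mono mult_pos_pos) auto
    then show ?thesis using Y unfolding PQ Y_def[symmetric] by simp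
  qed
  have ends2: False if "7 / 2 * Y \<le> \<bar>a - Re z\<bar>" "7 / 2 * Y \<le> \<bar>b - Re z\<bar>" "cmod (P a - P b) \<ge> 6 / 5" for a b
    using ends[OF that(1)] ends[OF that(2)] that(3) norm_triangle_ineq4[of "P a - Q" "P b - Q"] by simp
  \<comment> \<open>The visual distance is at most \<open>2 * |a - b| / Y\<close>, so separated
    points satisfy \<open>b - a >= 3/5 * Y\<close>, and \<open>2 * d <= 58/100 * Y\<close>.\<close>
  have wide: "b - a \<ge> 2 * d" if "a < b" "cmod (P a - P b) \<ge> 6 / 5" for a b
  proof -
    have "6 / 5 \<le> 2 * Y * \<bar>a - b\<bar> / (cmod (of_real a - z) * cmod (of_real b - z))"
      using that(2) unfolding PP Y_def .
    also have "\<dots> \<le> 2 * Y * \<bar>a - b\<bar> / (Y * Y)"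
      using Y Im_le by (intro divide_left_mono mult_mono mult_pos_pos pos) auto
    also have "\<dots> = 2 * (b - a) / Y" using Y that(1) by simp
    finally have "3 / 5 * Y \<le> b - a" using Y by (simp add: field_simps)
    then show ?thesis using d(2) Y by (simp add: Y_def)
  qed
  have main: "G b - G a \<ge> L / \<kappa> \<and> ((lo \<le> a \<and> a \<le> hi) \<or> (lo \<le> b \<and> b \<le> hi))" if ab: "a < b" "cmod (P a - P b) \<ge> 6 / 5" for a b
  proof (cases "lo \<le> a")
    case True
    have "a \<le> Re z + 7 / 2 * Y"
    proof (rule ccontr)
      assume "\<not> ?thesis"
      then show False using ends2[OF _ _ ab(2)] ab(1) by linarith
    qed
    then have "a + 2 * d \<le> hi" using hi by (simp add: Y_def)
    then show ?thesis using cell[OF True] Gm[of "a + 2 * d" b] wide[OF ab] True d by auto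
  next
    case False
    then have a: "7 / 2 * Y \<le> \<bar>a - Re z\<bar>" using lo d by (simp add: Y_def)
    then have "\<not> 7 / 2 * Y \<le> \<bar>b - Re z\<bar>" using ends2 ab(2) by blast
    then have b: "lo \<le> b - 2 * d" "b \<le> hi" using lo hi d by (simp_all add: Y_def abs_if split: if_splits)
    then have "L / \<kappa> \<le> G (b - 2 * d + 2 * d) - G (b - 2 * d)" by (intro cell) auto
    then show ?thesis using Gm[of a "b - 2 * d"] wide[OF ab] b d by auto
  qed
  have chord: "2 / 3 < c" if "c\<^sup>2 > 1 / 2" "c \<ge> 0" for c :: real
    by (rule power2_less_imp_less) (use that in \<open>auto simp: power2_eq_square\<close>)
  have mid: "lo \<le> a \<and> a \<le> hi" if "cmod (P a - Q) \<ge> 6 / 5" for a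
  proof -
    have "\<not> 7 / 2 * Y \<le> \<bar>a - Re z\<bar>" using ends[of a] that by linarith
    then show ?thesis using lo hi d by (simp add: Y_def abs_if split: if_splits)
  qed
  \<comment> \<open>The mass is not concentrated near \<open>f (P lo)\<close>: some point far from
    \<open>Q\<close>, hence in the window, has its image more than 2/3 away. As the window has image
    length \<open>L\<close>, this length cannot be small compared with \<open>s lo\<close>.\<close>
  have slo: "s lo < 3 * L"
  proof -
    obtain \<xi>1 where x: "cmod \<xi>1 = 1" "cmod (\<xi>1 - Q) \<ge> 6 / 5" "(cmod (f \<xi>1 - f (P lo)))\<^sup>2 > 1 / 2"
      using far[OF P(2) f[OF P(1)[of lo]]] by blast
    have "\<xi>1 \<noteq> Q" using x(2) by auto
    then obtain a where a: "\<xi>1 = P a" using P(3)[OF x(1)] by blast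
    have al: "lo \<le> a" "a \<le> hi" using mid x(2) a by auto
    have "2 / 3 < cmod (f (P a) - f (P lo))" using chord x(3) a by simp
    also have "\<dots> = 2 * (G a - G lo) / (s a * s lo)" unfolding fPP using Gm[OF al(1)] by simp
    also have "\<dots> \<le> 2 * L / (1 * s lo)"
      using Gm[OF al(1)] Gm[OF al(2)] s1[of a] s1[of lo] by (intro frac_le mult_right_mono) (auto simp: L_def)
    finally show ?thesis using s1[of lo] by (simp add: field_simps)
  qed
  \<comment> \<open>Nor is it concentrated near \<open>f Q\<close>: two separated points have
    stereographic coordinates of modulus below 3, and by \<open>main\<close> the gap between them is
    at least \<open>L / \<kappa>\<close>.\<close>
  have L6: "L < 6 * \<kappa>"
  proof -
    have near: "\<exists>a. x = P a \<and> \<bar>G a\<bar> < 3" if "cmod x = 1" "(cmod (f x - f Q))\<^sup>2 > 1 / 2" for x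
    proof -
      have "x \<noteq> Q" using that(2) by auto
      moreover have "x = Q \<or> (\<exists>a. x = P a)" using P(3) that(1) by blast
      ultimately obtain a where a: "x = P a" by blast
      have "1 / 2 < (2 / s a)\<^sup>2" using that(2) unfolding a fPQ .
      then have "2 / 3 < 2 / s a" using s1[of a] by (intro chord) auto
      then have "s a < 3" using s1[of a] by (simp add: field_simps)
      then show ?thesis using a sG[of a] by auto
    qed
    obtain x1 where x1: "cmod x1 = 1" "(cmod (f x1 - f Q))\<^sup>2 > 1 / 2" using far[OF P(2) f[OF P(2)]] by blast
    obtain x2 where x2: "cmod x2 = 1" "cmod (x2 - x1) \<ge> 6 / 5" "(cmod (f x2 - f Q))\<^sup>2 > 1 / 2"
      using far[OF x1(1) f[OF P(2)]] by blast
    obtain a where a: "x1 = P a" "\<bar>G a\<bar> < 3" using near[OF x1] by blast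
    obtain b where b: "x2 = P b" "\<bar>G b\<bar> < 3" using near[OF x2(1,3)] by blast
    have ne: "a \<noteq> b" using x2(2) a b by auto
    have "\<bar>G b - G a\<bar> \<ge> L / \<kappa>"
    proof (cases "a < b")
      case True
      then show ?thesis using main[OF True] x2(2) a b by (auto simp: norm_minus_commute)
    next
      case False
      then show ?thesis using main[of b a] x2(2) a b ne by auto
    qed
    then have "L / \<kappa> < 6" using a b by linarith
    then show ?thesis using \<kappa> by (simp add: field_simps)
  qed
  have L3: "1 / (3 * \<kappa>) \<le> L / \<kappa>" using slo s1[of lo] \<kappa> by (simp add: field_simps)
  have sb: "s a \<le> 25 * \<kappa>" if "lo \<le> a" "a \<le> hi" for a
  proof -
    have "\<bar>G a\<bar> \<le> \<bar>G lo\<bar> + L" using Gm[OF that(1)] Gm[OF that(2)] by (auto simp: L_def)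
    also have "\<dots> \<le> 24 * \<kappa>" using sG[of lo] slo L6 by linarith
    finally have g: "\<bar>G a\<bar> \<le> 24 * \<kappa>" .
    have "s a \<le> 1 + \<bar>G a\<bar>" using sqrt_one_plus_sq_add[of 0 "G a"] by (simp add: s_def)
    then show ?thesis using g \<kappa> by linarith
  qed
  have \<kappa>3: "\<kappa> \<le> \<kappa> ^ 3" "1 \<le> \<kappa> ^ 3" "1 \<le> \<kappa>\<^sup>2" using \<kappa> by (simp_all add: self_le_power one_le_power)
  \<comment> \<open>\<open>S\<close> and \<open>T\<close> are the stereographic factors of two
    points, only one of which need lie in the window; the other factor exceeds it by at most
    \<open>D\<close>. The constant is \<open>(25 * 25 * 3 + 25) / 2 = 950\<close>.\<close>
  have final: "1 / (950 * \<kappa> ^ 3) \<le> 2 * D / (S * T)"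
    if "1 \<le> S" "S \<le> 25 * \<kappa>" "0 < T" "T \<le> S + D" "1 / (3 * \<kappa>) \<le> D" for S T D
  proof -
    have D: "D > 0" using that(5) \<kappa> by (smt (verit) divide_pos_pos mult_pos_pos)
    have "S * T \<le> S * (S + D)" using that by (intro mult_left_mono) auto
    also have "\<dots> \<le> 25 * \<kappa> * (25 * \<kappa> * (3 * \<kappa> * D) + D * \<kappa>\<^sup>2)"
    proof (intro mult_mono add_mono)
      have "25 * \<kappa> * 1 \<le> 25 * \<kappa> * (3 * \<kappa> * D)" using that(5) \<kappa> by (intro mult_left_mono) (auto simp: field_simps)
      then show "S \<le> 25 * \<kappa> * (3 * \<kappa> * D)" using that(2) by linarith
      show "D \<le> D * \<kappa>\<^sup>2" using D \<kappa>3(3) by simp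
    qed (use that D \<kappa> in auto)
    also have "\<dots> = 2 * D * (950 * \<kappa> ^ 3)" by (simp add: power2_eq_square power3_eq_cube)
    finally have "S * T \<le> 2 * D * (950 * \<kappa> ^ 3)" .
    moreover have "S * T > 0" using that by simp
    moreover have "950 * \<kappa> ^ 3 > 0" using \<kappa> by simp
    ultimately show ?thesis by (simp add: field_simps)
  qed
  have withQ: "1 / (950 * \<kappa> ^ 3) \<le> cmod (f (P a) - f Q)" if "cmod (P a - Q) \<ge> 6 / 5" for a
  proof -
    have "s a \<le> 25 * \<kappa>" using sb mid[OF that] by blast
    then have "s a \<le> 2 * (950 * \<kappa> ^ 3)" using \<kappa>3 by linarith
    then have "2 / (2 * (950 * \<kappa> ^ 3)) \<le> 2 / s a"
      using s1[of a] \<kappa>3(2) by (intro divide_left_mono mult_pos_pos) linarith+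
    then show ?thesis unfolding fPQ by simp
  qed
  have both: "1 / (950 * \<kappa> ^ 3) \<le> cmod (f (P a) - f (P b))" if ab: "a < b" "cmod (P a - P b) \<ge> 6 / 5" for a b
  proof -
    define D where "D = G b - G a"
    have m: "D \<ge> L / \<kappa>" "(lo \<le> a \<and> a \<le> hi) \<or> (lo \<le> b \<and> b \<le> hi)" using main[OF ab] by (auto simp: D_def)
    have D: "D > 0" using G ab(1) by (simp add: D_def strict_mono_less)
    have D3: "1 / (3 * \<kappa>) \<le> D" using m(1) L3 by linarith
    have sab: "s b \<le> s a + D" "s a \<le> s b + D"
      using sqrt_one_plus_sq_add[of "G a" D] sqrt_one_plus_sq_add[of "G b" "- D"] D by (simp_all add: s_def D_def)
    have eq: "cmod (f (P a) - f (P b)) = 2 * D / (s a * s b)" unfolding fPP using D by (simp add: D_def)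
    from m(2) show ?thesis
    proof
      assume "lo \<le> a \<and> a \<le> hi"
      then show ?thesis unfolding eq by (intro final s1 sb sab D3) (use s1[of b] in auto)
    next
      assume "lo \<le> b \<and> b \<le> hi"
      then have "1 / (950 * \<kappa> ^ 3) \<le> 2 * D / (s b * s a)" by (intro final s1 sb sab D3) (use s1[of a] in auto)
      then show ?thesis unfolding eq by (simp add: mult.commute)
    qed
  qed
  consider "\<xi> = Q" "\<eta> = Q" | a where "\<xi> = Q" "\<eta> = P a" | a where "\<xi> = P a" "\<eta> = Q" | a b where "\<xi> = P a" "\<eta> = P b"
    using P(3)[OF \<xi>\<eta>(1)] P(3)[OF \<xi>\<eta>(2)] by blast
  then show ?thesis
  proof cases
    case 1 then show ?thesis using \<xi>\<eta>(3) by simp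
  next
    case (2 a) then show ?thesis using withQ[of a] \<xi>\<eta>(3) by (simp add: norm_minus_commute)
  next
    case (3 a) then show ?thesis using withQ[of a] \<xi>\<eta>(3) by simp
  next
    case (4 a b)
    then have "a \<noteq> b" using \<xi>\<eta>(3) by auto
    then consider "a < b" | "b < a" by linarith
    then show ?thesis
      using both[of a b] both[of b a] 4 \<xi>\<eta>(3) by cases (auto simp: norm_minus_commute)
  qed
qed

section \<open>Normalising the boundary map\<close>

lemma orient_rotate:
  assumes "cmod c = 1"
  shows "orient (c * p) (c * q) (c * r) = orient p q r"
proof -
  have "c * q * cnj (c * p) + c * r * cnj (c * q) + c * p * cnj (c * r) = (c * cnj c) * (q * cnj p + r * cnj q + p * cnj r)"
    by (simp add: algebra_simps)
  then show ?thesis unfolding orient_def unit_mult_cnj[OF assms] by simp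
qed

lemma cross_ratio_hom_coord:
  assumes "ccw4 a b c d"
  shows "cross_ratio a b c d = vdet (hom_coord b) (hom_coord a) * vdet (hom_coord d) (hom_coord c) /
     (vdet (hom_coord c) (hom_coord b) * vdet (hom_coord d) (hom_coord a))"
  using assms by (cases a; cases b; cases c; cases d) (auto simp: ccw4_def vdet_def field_simps)

text \<open>In terms of chords the invariance under disk automorphisms is immediate, since by
  \<open>disk_mob_diff\<close> every endpoint contributes the same factor above and below. Cyclic
  order makes the cross ratio positive, so moduli suffice.\<close>

lemma cross_ratio_chords:
  assumes "ccw4 a b c d"
  shows "cross_ratio a b c d = (cmod (cayley_bdry b - cayley_bdry a) * cmod (cayley_bdry d - cayley_bdry c)) /
     (cmod (cayley_bdry c - cayley_bdry b) * cmod (cayley_bdry d - cayley_bdry a))"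
proof -
  let ?v = "\<lambda>x y. vdet (hom_coord x) (hom_coord y)"
  let ?D = "\<lambda>x. cmod (bdry_den (hom_coord x))"
  have D: "?D x \<noteq> 0" for x using bdry_den_nonzero[of "hom_coord x"] by simp
  have ch: "cmod (cayley_bdry x - cayley_bdry y) = 2 * \<bar>?v x y\<bar> / (?D x * ?D y)" for x y
    using dist_cayley_bdry[of "hom_coord x" "hom_coord y"] by simp
  have "?v b a * ?v c b * ?v c a > 0" "?v d c * ?v a d * ?v a c > 0"
    using assms unfolding ccw4_def by (auto simp: ccw_hom_coord)
  then have "(?v b a * ?v c b * ?v c a) * (?v d c * ?v a d * ?v a c) > 0" by (rule mult_pos_pos)
  also have "(?v b a * ?v c b * ?v c a) * (?v d c * ?v a d * ?v a c) = (?v b a * ?v d c * (?v c b * ?v d a)) * (?v c a)\<^sup>2"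
    by (simp add: vdet_swap[of "hom_coord a"] power2_eq_square mult_ac)
  finally have pos: "?v b a * ?v d c * (?v c b * ?v d a) > 0"
    by (simp add: zero_less_mult_iff)
  then have "?v b a * ?v d c / (?v c b * ?v d a) > 0" by (simp only: zero_less_divide_iff zero_less_mult_iff[of "?v b a * ?v d c" "?v c b * ?v d a"])
  then have "?v b a * ?v d c / (?v c b * ?v d a) = \<bar>?v b a * ?v d c / (?v c b * ?v d a)\<bar>"
    by (rule abs_of_pos[symmetric])
  also have "\<dots> = \<bar>?v b a\<bar> * \<bar>?v d c\<bar> / (\<bar>?v c b\<bar> * \<bar>?v d a\<bar>)" by (simp add: abs_mult)
  finally show ?thesis unfolding cross_ratio_hom_coord[OF assms] ch using D pos
    by (simp add: divide_simps)
qed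

text \<open>\<open>k\<close> is \<open>h\<close> followed by the automorphism that moves
  \<open>w\<close> to the origin of the disk and a rotation that carries the image of
  \<open>p\<close> to infinity. Its finite values are stereographic coordinates, and its Farey cross
  ratios, hence the shears, are those of \<open>h\<close>.\<close>

lemma normalised_boundary_map:
  fixes h :: "rhat \<Rightarrow> rhat"
  assumes h: "\<And>a b c. ccw a b c \<Longrightarrow> ccw (h a) (h b) (h c)" and w: "cmod w < 1"
  obtains k where "\<And>a b c. ccw a b c \<Longrightarrow> ccw (k a) (k b) (k c)" "k p = None"
    "\<And>a b. cmod (cayley_bdry (k a) - cayley_bdry (k b)) = cmod (disk_mob w (cayley_bdry (h a)) - disk_mob w (cayley_bdry (h b)))"
    "\<And>a b c d. ccw4 a b c d \<Longrightarrow> cross_ratio (k a) (k b) (k c) (k d) = cross_ratio (h a) (h b) (h c) (h d)"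
proof -
  define E where "E a = disk_mob w (cayley_bdry (h a))" for a
  have uE: "cmod (E a) = 1" for a unfolding E_def by (rule disk_mob_unit[OF w cmod_cayley_bdry])
  define c where "c = - cnj (E p)"
  have c: "cmod c = 1" using uE by (simp add: c_def)
  define k where "k a = inv cayley_bdry (c * E a)" for a
  have kE: "cayley_bdry (k a) = c * E a" for a
    unfolding k_def by (rule inv_cayley_bdry(2)) (simp add: norm_mult c uE)
  have "c * E p = - 1" using unit_mult_cnj[OF uE[of p]] by (simp add: c_def mult.commute)
  then have "cayley_bdry (k p) = cayley_bdry None" by (simp add: kE del: cayley_bdry.simps(1))
  then have kp: "k p = None" using inj_cayley_bdry by (metis injD)
  have kccw: "ccw (k x) (k y) (k z)" if "ccw x y z" for x y z
  proof -
    have "orient (cayley_bdry (h x)) (cayley_bdry (h y)) (cayley_bdry (h z)) > 0"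
      unfolding orient_cayley_bdry by (rule h[OF that])
    then have "orient (E x) (E y) (E z) > 0"
      unfolding E_def using orient_disk_mob_pos_iff[OF w cmod_cayley_bdry cmod_cayley_bdry cmod_cayley_bdry] by blast
    then show ?thesis using orient_rotate[OF c] unfolding orient_cayley_bdry[symmetric] kE by simp
  qed
  have dist: "cmod (cayley_bdry (k a) - cayley_bdry (k b)) = cmod (E a - E b)" for a b
    unfolding kE using c by (simp add: norm_mult flip: right_diff_distrib)
  define n where "n a = cmod (1 - cnj w * cayley_bdry (h a))" for a
  have n: "n a \<noteq> 0" for a using disk_mob_denom_nonzero[OF w, of "cayley_bdry (h a)"] by (simp add: n_def)
  define K where "K = cmod (of_real (1 - (cmod w)\<^sup>2))"
  have "(cmod w)\<^sup>2 < 1" using w by (simp add: abs_square_less_1)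
  then have K: "K \<noteq> 0" unfolding K_def norm_of_real by simp
  have distE: "cmod (E a - E b) = K * cmod (cayley_bdry (h a) - cayley_bdry (h b)) / (n a * n b)" for a b
    unfolding E_def n_def K_def
    by (subst disk_mob_diff) (use disk_mob_denom_nonzero[OF w] in \<open>auto simp: norm_mult norm_divide simp del: cayley_bdry.simps\<close>)
  have cr: "cross_ratio (k a) (k b) (k c) (k d) = cross_ratio (h a) (h b) (h c) (h d)" if "ccw4 a b c d" for a b c d
  proof -
    have "ccw4 (k a) (k b) (k c) (k d)" "ccw4 (h a) (h b) (h c) (h d)" using that kccw h by (auto simp: ccw4_def)
    then show ?thesis unfolding cross_ratio_chords[OF \<open>ccw4 (k a) _ _ _\<close>] cross_ratio_chords[OF \<open>ccw4 (h a) _ _ _\<close>] dist distE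
      using K n by simp
  qed
  show ?thesis by (rule that[OF kccw kp _ cr]) (simp_all only: dist E_def)
qed

section \<open>Comparing the gaps of the normalised map\<close>

text \<open>\<open>A\<close>, \<open>q\<close>, \<open>t\<close>, \<open>m\<close>, \<open>B\<close> are the images of \<open>0\<close>, \<open>1/4\<close>, \<open>1/3\<close>, \<open>1/2\<close>, \<open>1\<close>, and the last five
  hypotheses express bounds on the shears of the edges from \<open>0\<close> to \<open>1\<close>, \<open>1/2\<close> and \<open>1/3\<close>.\<close>

lemma quarter_gap_bounds:
  fixes A q t m B \<Lambda> :: real
  assumes o: "A < q" "q < t" "t < m" "m < B" and \<Lambda>: "\<Lambda> \<ge> 1"
    and e1: "m - A \<le> \<Lambda> * (B - m)" "B - m \<le> \<Lambda> * (m - A)"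
    and e2: "(B - m) * (t - A) \<le> \<Lambda> * ((B - A) * (m - t))" "(B - A) * (m - t) \<le> \<Lambda> * ((B - m) * (t - A))"
    and e3: "(m - A) * (t - q) \<le> \<Lambda> * ((m - t) * (q - A))"
  shows "B - A \<le> (1 + \<Lambda>) ^ 3 * (q - A)" "B - A \<le> (1 + \<Lambda>) ^ 3 * (m - q)"
proof -
  have 1: "B - A \<le> (1 + \<Lambda>) * (m - A)" using e1(2) by (simp add: algebra_simps)
  \<comment> \<open>Replacing \<open>B - A\<close> by the smaller \<open>B - m\<close> lets a factor
    cancel and turns a bound on a cross ratio into a comparison of adjacent gaps. Each of the three
    refinements costs a factor \<open>1 + \<Lambda>\<close>.\<close>
  have "(B - m) * (m - t) \<le> (B - A) * (m - t)" using o by (intro mult_right_mono) auto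
  also have "\<dots> \<le> (B - m) * (\<Lambda> * (t - A))" using e2(2) by (simp add: mult_ac)
  finally have "m - t \<le> \<Lambda> * (t - A)" using o by (simp add: mult_le_cancel_left_pos)
  then have 2: "m - A \<le> (1 + \<Lambda>) * (t - A)" by (simp add: algebra_simps)
  have "(m - t) * (t - q) \<le> (m - A) * (t - q)" using o by (intro mult_right_mono) auto
  also have "\<dots> \<le> (m - t) * (\<Lambda> * (q - A))" using e3 by (simp add: mult_ac)
  finally have "t - q \<le> \<Lambda> * (q - A)" using o by (simp add: mult_le_cancel_left_pos)
  then have 3: "t - A \<le> (1 + \<Lambda>) * (q - A)" by (simp add: algebra_simps)
  have "B - A \<le> (1 + \<Lambda>) * ((1 + \<Lambda>) * (t - A))" using 1 2 \<Lambda> by (meson add_nonneg_nonneg mult_left_mono order.trans zero_le_one)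
  also have "\<dots> \<le> (1 + \<Lambda>) * ((1 + \<Lambda>) * ((1 + \<Lambda>) * (q - A)))" using 3 \<Lambda> by (intro mult_left_mono) auto
  finally show "B - A \<le> (1 + \<Lambda>) ^ 3 * (q - A)" by (simp add: power3_eq_cube mult.assoc)
  have "B - A \<le> (1 + \<Lambda>) * (B - m)" using e1(1) by (simp add: algebra_simps)
  then have "\<Lambda> * ((B - A) * (m - t)) \<le> \<Lambda> * (((1 + \<Lambda>) * (B - m)) * (m - t))"
    using o \<Lambda> by (intro mult_left_mono mult_right_mono) auto
  then have "(B - m) * (t - A) \<le> (B - m) * (\<Lambda> * (1 + \<Lambda>) * (m - t))" using e2(1) by (simp add: mult_ac)
  then have "t - A \<le> \<Lambda> * (1 + \<Lambda>) * (m - t)" using o by (simp only: mult_le_cancel_left_pos[of "B - m"])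
  then have "m - A \<le> (1 + \<Lambda> + \<Lambda>\<^sup>2) * (m - t)" by (simp add: algebra_simps power2_eq_square)
  also have "\<dots> \<le> (1 + \<Lambda>)\<^sup>2 * (m - q)" using o \<Lambda> by (intro mult_mono) (auto simp: power2_eq_square algebra_simps)
  finally have "(1 + \<Lambda>) * (m - A) \<le> (1 + \<Lambda>) * ((1 + \<Lambda>)\<^sup>2 * (m - q))" using \<Lambda> by (intro mult_left_mono) auto
  then show "B - A \<le> (1 + \<Lambda>) ^ 3 * (m - q)" using 1 by (simp add: power2_eq_square power3_eq_cube mult.assoc)
qed

lemma comparable_chain:
  fixes gap :: "int \<Rightarrow> real"
  assumes pos: "\<And>i. gap i > 0" and \<Lambda>: "\<Lambda> \<ge> 1"
    and up: "\<And>i. gap (i + 1) \<le> \<Lambda> * gap i" and down: "\<And>i. gap i \<le> \<Lambda> * gap (i + 1)"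
  shows "gap i \<le> \<Lambda> ^ nat \<bar>i - l\<bar> * gap l"
proof -
  have a: "gap (l + int n) \<le> \<Lambda> ^ n * gap l" for n
  proof (induction n)
    case (Suc n)
    have "gap (l + int (Suc n)) \<le> \<Lambda> * gap (l + int n)" using up[of "l + int n"] by (simp add: add_ac)
    also have "\<dots> \<le> \<Lambda> * (\<Lambda> ^ n * gap l)" using Suc \<Lambda> by (intro mult_left_mono) auto
    finally show ?case by (simp add: mult.assoc)
  qed simp
  have b: "gap (l - int n) \<le> \<Lambda> ^ n * gap l" for n
  proof (induction n)
    case (Suc n)
    have "gap (l - int (Suc n)) \<le> \<Lambda> * gap (l - int n)" using down[of "l - int (Suc n)"] by simp
    also have "\<dots> \<le> \<Lambda> * (\<Lambda> ^ n * gap l)" using Suc \<Lambda> by (intro mult_left_mono) auto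
    finally show ?case by (simp add: mult.assoc)
  qed simp
  show ?thesis
  proof (cases "i \<ge> l")
    case True then show ?thesis using a[of "nat (i - l)"] by simp
  next
    case False then show ?thesis using b[of "nat (l - i)"] by simp
  qed
qed

lemma ln_bound_exp:
  assumes "\<bar>ln x\<bar> \<le> M" "x > (0 :: real)"
  shows "x \<le> exp M" "1 \<le> exp M * x"
proof -
  have "ln x \<le> M" "- M \<le> ln x" using assms by auto
  then have "exp (ln x) \<le> exp M" "exp (- M) \<le> exp (ln x)" by simp_all
  then show "x \<le> exp M" "1 \<le> exp M * x" using assms(2) by (simp_all add: exp_minus field_simps)
qed

lemma ln_quotient_bound:
  assumes "\<bar>ln (x / y)\<bar> \<le> M" "x > (0 :: real)" "y > 0"
  shows "x \<le> exp M * y" "y \<le> exp M * x"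
  using ln_bound_exp[OF assms(1)] assms by (simp_all add: field_simps)

lemma ccw4_farey:
  assumes "vdet v w = 1"
  shows "ccw4 (pt v) (pt (w - v)) (pt w) (pt (w + v))"
proof -
  have "vdet w v = - 1" using assms vdet_swap[of w v] by simp
  moreover have "v \<noteq> 0" "w \<noteq> 0" "w - v \<noteq> 0" "w + v \<noteq> 0"
    using fan_nonzero[OF assms, of 1] fan_nonzero[OF assms, of "-1"] vdet_nonzero[of v w] assms by (auto simp: add.commute)
  ultimately show ?thesis using assms unfolding ccw4_def by (simp add: ccw_pt_iff vdet_simps)
qed

text \<open>Coordinates in which \<open>pt v\<close> and its image are both at infinity, so that the
  edges of this fan end at the integers and \<open>G\<close> is the boundary map. The last
  assumption covers all fans, because the quarter integers are reached through edges that do not end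
  at \<open>pt v\<close>.\<close>

locale normalised_fan =
  fixes h k :: "rhat \<Rightarrow> rhat" and v w :: "real \<times> real" and G :: "real \<Rightarrow> real" and M :: real
  assumes v: "int_vec v" and w: "int_vec w" and vw: "vdet v w = 1"
    and cross_ratio_k: "\<And>a b c d. ccw4 a b c d \<Longrightarrow> cross_ratio (k a) (k b) (k c) (k d) = cross_ratio (h a) (h b) (h c) (h d)"
    and k_inf: "k (pt v) = None" and k_Some: "\<And>a. k (pt (a *\<^sub>R v + w)) = Some (G a)" and G: "strict_mono G"
    and bound: "\<And>v w m n. int_vec v \<Longrightarrow> int_vec w \<Longrightarrow> vdet v w = 1 \<Longrightarrow>
      \<bar>ln (fan_ratio (\<lambda>n. shear h (geod (pt v) (pt (of_int n *\<^sub>R v + w)))) m n)\<bar> \<le> M"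
begin

abbreviation "\<Lambda> \<equiv> exp M"

lemma M_nonneg: "M \<ge> 0" using bound[OF v w vw, of 0 0] by linarith

lemma \<Lambda>_ge_1: "\<Lambda> \<ge> 1" using M_nonneg by simp

lemma G_less: "a < b \<Longrightarrow> G a < G b" using G by (simp add: strict_mono_less)

lemma shear_k:
  assumes "int_vec v'" "int_vec w'" "vdet v' w' = 1"
  shows "shear h (geod (pt v') (pt w')) = ln (cross_ratio (k (pt v')) (k (pt (w' - v'))) (k (pt w')) (k (pt (w' + v'))))"
  unfolding shear_eq[OF assms] cross_ratio_k[OF ccw4_farey[OF assms(3)]] ..

text \<open>With 0 steps to either side the fan ratio is the exponential of one shear, so the shear
  norm bounds every single shear.\<close>

lemma edge_bound:
  assumes "int_vec v'" "int_vec w'" "vdet v' w' = 1"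
  shows "\<bar>ln (cross_ratio (k (pt v')) (k (pt (w' - v'))) (k (pt w')) (k (pt (w' + v'))))\<bar> \<le> M"
  using bound[OF assms, of 0 0] unfolding fan_ratio_def shear_k[OF assms, symmetric] by simp

lemma k_pt: "q \<noteq> 0 \<Longrightarrow> u = p *\<^sub>R v + q *\<^sub>R w \<Longrightarrow> k (pt u) = Some (G (p / q))"
proof -
  assume q: "q \<noteq> 0" and u: "u = p *\<^sub>R v + q *\<^sub>R w"
  have "u = q *\<^sub>R ((p / q) *\<^sub>R v + w)" using q u by (simp add: scaleR_add_right)
  then show ?thesis using pt_scale[OF q] k_Some by simp
qed

lemma shear_fan:
  "shear h (geod (pt v) (pt (of_int n *\<^sub>R v + w))) =
    ln ((G (of_int (n + 1)) - G (of_int n)) / (G (of_int n) - G (of_int (n - 1))))"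
proof -
  have e: "of_int n *\<^sub>R v + w - v = of_int (n - 1) *\<^sub>R v + w" "of_int n *\<^sub>R v + w + v = of_int (n + 1) *\<^sub>R v + w"
    by (simp_all add: algebra_simps)
  show ?thesis
    by (subst shear_k) (use v w vdet_fan(1)[OF vw] in \<open>simp_all add: k_inf k_Some e del: of_int_add of_int_diff\<close>)
qed

text \<open>With infinity fixed, the exponential of a shear is a quotient of consecutive gaps of
  \<open>G\<close>; the products in the fan ratio telescope and the sums become lengths. The bound
  is thus a quasisymmetry condition for intervals with integer centre and integer radius.\<close>

lemma fan_ratio_eq:
  "fan_ratio (\<lambda>n. shear h (geod (pt v) (pt (of_int n *\<^sub>R v + w)))) m j =
    (G (of_int (m + int j + 1)) - G (of_int m)) / (G (of_int m) - G (of_int (m - int j - 1)))"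
proof -
  define D where "D n = G (of_int (n + 1)) - G (of_int n)" for n :: int
  define s where "s n = shear h (geod (pt v) (pt (of_int n *\<^sub>R v + w)))" for n :: int
  have D: "D n > 0" for n using G_less[of "of_int n" "of_int (n + 1)"] by (simp add: D_def)
  have es: "exp (s n) = D n / D (n - 1)" for n
    unfolding s_def shear_fan using D[of n] D[of "n - 1"] by (simp add: D_def)
  have up: "exp (\<Sum>i=1..j. s (m + int i)) = D (m + int j) / D m" for j
  proof (induction j)
    case (Suc j)
    then show ?case using D[of m] D[of "m + int j"] by (simp add: exp_add es add_ac)
  qed (use D[of m] in simp)
  have down: "exp (- (\<Sum>i=1..j. s (m - int i))) = D (m - int j - 1) / D (m - 1)" for j
  proof (induction j)
    case (Suc j)
    have "- (\<Sum>i=1..Suc j. s (m - int i)) = - (\<Sum>i=1..j. s (m - int i)) - s (m - int (Suc j))" by simp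
    then have "exp (- (\<Sum>i=1..Suc j. s (m - int i))) = exp (- (\<Sum>i=1..j. s (m - int i))) / exp (s (m - int (Suc j)))"
      by (simp only: exp_diff)
    also have "\<dots> = D (m - int (Suc j) - 1) / D (m - 1)"
      unfolding Suc es using D[of "m - int j - 1"] by (simp add: diff_diff_eq add_ac)
    finally show ?case .
  qed (use D[of "m - 1"] in simp)
  have S1: "(\<Sum>i\<le>j. D (m + int i)) = G (of_int (m + int j + 1)) - G (of_int m)" for j
    by (induction j) (simp_all add: D_def add_ac)
  have S2: "(\<Sum>i\<le>j. D (m - int i - 1)) = G (of_int m) - G (of_int (m - int j - 1))" for j
    by (induction j) (simp_all add: D_def algebra_simps)
  have "fan_ratio s m j = exp (s m) * ((\<Sum>i\<le>j. D (m + int i)) / D m) / ((\<Sum>i\<le>j. D (m - int i - 1)) / D (m - 1))"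
    unfolding fan_ratio_def up down sum_divide_distrib ..
  also have "\<dots> = (\<Sum>i\<le>j. D (m + int i)) / (\<Sum>i\<le>j. D (m - int i - 1))"
    unfolding es using D[of m] D[of "m - 1"] by simp
  finally show ?thesis unfolding S1 S2 s_def .
qed

lemma gap_ratio:
  assumes "j > 0"
  shows "G (of_int (m + int j)) - G (of_int m) \<le> \<Lambda> * (G (of_int m) - G (of_int (m - int j)))"
    "G (of_int m) - G (of_int (m - int j)) \<le> \<Lambda> * (G (of_int (m + int j)) - G (of_int m))"
proof -
  have "\<bar>ln ((G (of_int (m + int j)) - G (of_int m)) / (G (of_int m) - G (of_int (m - int j))))\<bar> \<le> M"
    using bound[OF v w vw, of m "j - 1"] assms unfolding fan_ratio_eq by (simp add: of_nat_diff algebra_simps)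
  moreover have "G (of_int (m + int j)) - G (of_int m) > 0" "G (of_int m) - G (of_int (m - int j)) > 0"
    using G_less assms by simp_all
  ultimately show "G (of_int (m + int j)) - G (of_int m) \<le> \<Lambda> * (G (of_int m) - G (of_int (m - int j)))"
    "G (of_int m) - G (of_int (m - int j)) \<le> \<Lambda> * (G (of_int (m + int j)) - G (of_int m))"
    using ln_quotient_bound by blast+
qed

text \<open>Consecutive cells between multiples of \<open>j\<close> differ at most by the factor
  \<open>\<Lambda>\<close>, any two of the 60 cells are fewer than 60 steps apart, and there are 60
  of them to sum.\<close>

lemma cell_bound:
  assumes j: "j > (0 :: nat)" and l: "c - 30 \<le> l" "l < c + 30"
  shows "G (of_int (c + 30) * real j) - G (of_int (c - 30) * real j) \<le>
    60 * \<Lambda> ^ 60 * (G (of_int (l + 1) * real j) - G (of_int l * real j))"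
proof -
  define gap where "gap i = G (of_int (i + 1) * real j) - G (of_int i * real j)" for i :: int
  have pos: "gap i > 0" for i using G_less[of "of_int i * real j" "of_int (i + 1) * real j"] j by (simp add: gap_def)
  have e: "of_int (i * int j + int j) = of_int (i + 1) * real j" "of_int (i * int j) = of_int i * real j"
    "of_int (i * int j - int j) = of_int (i - 1) * real j" for i by (simp_all add: algebra_simps)
  have ratio: "gap i \<le> \<Lambda> * gap (i - 1)" "gap (i - 1) \<le> \<Lambda> * gap i" for i
    using gap_ratio[OF j, of "i * int j"] unfolding e by (simp_all add: gap_def)
  have "gap i \<le> \<Lambda> ^ 60 * gap l" if "c - 30 \<le> i" "i < c + 30" for i
  proof -
    have "gap i \<le> \<Lambda> ^ nat \<bar>i - l\<bar> * gap l"
      by (rule comparable_chain[OF pos \<Lambda>_ge_1]) (use ratio[of "_ + 1"] in simp_all)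
    also have "\<dots> \<le> \<Lambda> ^ 60 * gap l"
      using that l pos[of l] \<Lambda>_ge_1 by (intro mult_right_mono power_increasing) auto
    finally show ?thesis .
  qed
  then have "(\<Sum>n<60. gap (c - 30 + int n)) \<le> (\<Sum>n<(60::nat). \<Lambda> ^ 60 * gap l)"
    by (intro sum_mono) auto
  moreover have "(\<Sum>n<N. gap (c - 30 + int n)) = G (of_int (c - 30 + int N) * real j) - G (of_int (c - 30) * real j)" for N
    by (induction N) (simp_all add: gap_def add_ac)
  from this[of 60] have "(\<Sum>n<60. gap (c - 30 + int n)) = G (of_int (c + 30) * real j) - G (of_int (c - 30) * real j)"
    by (simp add: add.commute)
  ultimately show ?thesis by (simp add: gap_def)
qed

text \<open>Inside a unit interval the fan at infinity gives no information, so the quarter points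
  are reached through the shears of edges that start at \<open>n\<close> and at
  \<open>n + 1\<close>.\<close>

lemma quarter_cell:
  fixes n i :: int
  assumes "4 * n \<le> i" "i < 4 * n + 4"
  shows "G (of_int (n + 1)) - G (of_int n) \<le> (1 + \<Lambda>) ^ 3 * (G (of_int (i + 1) / 4) - G (of_int i / 4))"
proof -
  let ?n = "real_of_int n"
  define A where "A = G ?n"
  define B where "B = G (?n + 1)"
  define q1 where "q1 = G ((4 * ?n + 1) / 4)"
  define t1 where "t1 = G ((3 * ?n + 1) / 3)"
  define m where "m = G ((2 * ?n + 1) / 2)"
  define t2 where "t2 = G ((3 * ?n + 2) / 3)"
  define q3 where "q3 = G ((4 * ?n + 3) / 4)"
  have o: "A < q1" "q1 < t1" "t1 < m" "m < t2" "t2 < q3" "q3 < B" "A < t1" "A < m" "m < B" "A < B" "t2 < B" "m < q3" "q1 < m"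
    unfolding A_def B_def q1_def t1_def m_def t2_def q3_def by (intro G_less; simp add: field_simps)+
  define iv where "iv p q = of_int p *\<^sub>R v + of_int q *\<^sub>R w" for p q :: int
  have iv: "int_vec (iv p q)" for p q using v w by (simp add: iv_def)
  have wv: "vdet w v = -1" using vdet_swap[of w v] vw by simp
  have det: "vdet (iv p q) (iv r s) = of_int (p * s - q * r)" for p q r s
    unfolding iv_def using vw wv by (simp add: vdet_simps algebra_simps)
  have ivd: "iv r s - iv p q = iv (r - p) (s - q)" "iv r s + iv p q = iv (r + p) (s + q)" for p q r s
    by (simp_all add: iv_def algebra_simps)
  have kS: "k (pt (iv p q)) = Some (G (of_int p / of_int q))" if "q \<noteq> 0" for p q
    by (rule k_pt) (use that in \<open>auto simp: iv_def\<close>)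
  have kN: "k (pt (iv (- 1) 0)) = None" using k_inf by (simp add: iv_def)
  \<comment> \<open>Some vectors occur with negative sign because \<open>edge_bound\<close> refers
    literally to \<open>w' - v'\<close>; the boundary point is the same.\<close>
  have neg: "G (of_int (- p) / of_int (- q)) = G (of_int p / of_int q)" for p q by simp
  have vals: "k (pt (iv n 1)) = Some A" "k (pt (iv (n + 1) 1)) = Some B" "k (pt (iv (2 * n + 1) 2)) = Some m"
    "k (pt (iv (3 * n + 1) 3)) = Some t1" "k (pt (iv (3 * n + 2) 3)) = Some t2"
    "k (pt (iv (4 * n + 1) 4)) = Some q1" "k (pt (iv (4 * n + 3) 4)) = Some q3"
    "k (pt (iv (- n - 1) (- 1))) = Some B" "k (pt (iv (- n) (- 1))) = Some A" "k (pt (iv (- 2 * n - 1) (- 2))) = Some m"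
    using neg[of n 1] neg[of "n + 1" 1] neg[of "2 * n + 1" 2]
    by (simp_all add: kS A_def B_def m_def t1_def t2_def q1_def q3_def)
  have edge: "\<bar>ln (cross_ratio (k (pt (iv p q))) (k (pt (iv a b))) (k (pt (iv r s))) (k (pt (iv c d))))\<bar> \<le> M"
    if "p * s - q * r = 1" "r - p = a" "s - q = b" "r + p = c" "s + q = d" for p q r s a b c d
    using edge_bound[OF iv iv, of p q r s] that(1) unfolding det ivd that(2-5) by simp
  \<comment> \<open>The triangle on the outer side of the edge from \<open>n\<close> to
    \<open>n + 1\<close> has its apex at infinity, so the cross ratio is a quotient of two
    gaps.\<close>
  have E1: "\<bar>ln ((m - A) / (B - m))\<bar> \<le> M"
  proof -
    have "(m - A) / (B - m) = - ((m - A) / (m - B))" by (simp add: minus_divide_right)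
    moreover have "\<bar>ln (cross_ratio (k (pt (iv (n + 1) 1))) (k (pt (iv (- 1) 0))) (k (pt (iv n 1))) (k (pt (iv (2 * n + 1) 2))))\<bar> \<le> M"
      by (rule edge) (simp_all add: algebra_simps)
    ultimately show ?thesis by (simp only: vals kN cross_ratio.simps)
  qed
  have E2: "\<bar>ln (((B - m) * (t1 - A)) / ((B - A) * (m - t1)))\<bar> \<le> M"
  proof -
    have "((B - m) * (t1 - A)) / ((B - A) * (m - t1)) = ((B - m) * (t1 - A)) / ((A - B) * (t1 - m))"
      by (simp add: algebra_simps)
    moreover have "\<bar>ln (cross_ratio (k (pt (iv (2 * n + 1) 2))) (k (pt (iv (- n - 1) (- 1)))) (k (pt (iv n 1))) (k (pt (iv (3 * n + 1) 3))))\<bar> \<le> M"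
      by (rule edge) (simp_all add: algebra_simps)
    ultimately show ?thesis by (simp only: vals cross_ratio.simps)
  qed
  have E3: "\<bar>ln (((m - t1) * (q1 - A)) / ((m - A) * (t1 - q1)))\<bar> \<le> M"
  proof -
    have "((m - t1) * (q1 - A)) / ((m - A) * (t1 - q1)) = ((m - t1) * (q1 - A)) / ((A - m) * (q1 - t1))"
      by (simp add: algebra_simps)
    moreover have "\<bar>ln (cross_ratio (k (pt (iv (3 * n + 1) 3))) (k (pt (iv (- 2 * n - 1) (- 2)))) (k (pt (iv n 1))) (k (pt (iv (4 * n + 1) 4))))\<bar> \<le> M"
      by (rule edge) (simp_all add: algebra_simps)
    ultimately show ?thesis by (simp only: vals cross_ratio.simps)
  qed
  have E2': "\<bar>ln (((B - A) * (t2 - m)) / ((m - A) * (B - t2)))\<bar> \<le> M"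
  proof -
    have "((B - A) * (t2 - m)) / ((m - A) * (B - t2)) = ((A - B) * (t2 - m)) / ((m - A) * (t2 - B))"
      by (simp add: algebra_simps minus_divide_left minus_divide_right divide_simps)
    moreover have "\<bar>ln (cross_ratio (k (pt (iv (n + 1) 1))) (k (pt (iv n 1))) (k (pt (iv (2 * n + 1) 2))) (k (pt (iv (3 * n + 2) 3))))\<bar> \<le> M"
      by (rule edge) (simp_all add: algebra_simps)
    ultimately show ?thesis by (simp only: vals cross_ratio.simps)
  qed
  have E3': "\<bar>ln (((B - m) * (q3 - t2)) / ((t2 - m) * (B - q3)))\<bar> \<le> M"
  proof -
    have "((B - m) * (q3 - t2)) / ((t2 - m) * (B - q3)) = ((m - B) * (q3 - t2)) / ((t2 - m) * (q3 - B))"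
      by (simp add: algebra_simps minus_divide_left minus_divide_right divide_simps)
    moreover have "\<bar>ln (cross_ratio (k (pt (iv (n + 1) 1))) (k (pt (iv (2 * n + 1) 2))) (k (pt (iv (3 * n + 2) 3))) (k (pt (iv (4 * n + 3) 4))))\<bar> \<le> M"
      by (rule edge) (simp_all add: algebra_simps)
    ultimately show ?thesis by (simp only: vals cross_ratio.simps)
  qed
  have d: "m - A > 0" "B - m > 0" "t1 - A > 0" "B - A > 0" "m - t1 > 0" "q1 - A > 0" "t1 - q1 > 0"
    "t2 - m > 0" "B - t2 > 0" "q3 - t2 > 0" "B - q3 > 0" using o by simp_all
  note e1 = ln_quotient_bound[OF E1 d(1,2)]
    and e2 = ln_quotient_bound[OF E2 mult_pos_pos mult_pos_pos, OF d(2,3,4,5)]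
    and e3 = ln_quotient_bound[OF E3 mult_pos_pos mult_pos_pos, OF d(5,6,1,7)]
    and e2' = ln_quotient_bound[OF E2' mult_pos_pos mult_pos_pos, OF d(4,8,1,9)]
    and e3' = ln_quotient_bound[OF E3' mult_pos_pos mult_pos_pos, OF d(2,10,8,11)]
  have lower: "B - A \<le> (1 + \<Lambda>) ^ 3 * (q1 - A)" "B - A \<le> (1 + \<Lambda>) ^ 3 * (m - q1)"
    by (rule quarter_gap_bounds[OF o(1,2,3,9) \<Lambda>_ge_1 e1 e2 e3(2)])+
  have r: "- x - - y = y - x" for x y :: real by simp
  \<comment> \<open>The right half is the mirror image of the left half: the negated points increase
    and satisfy the hypotheses of \<open>quarter_gap_bounds\<close>.\<close>
  have o': "- B < - q3" "- q3 < - t2" "- t2 < - m" "- m < - A" using o by simp_all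
  have upper: "B - A \<le> (1 + \<Lambda>) ^ 3 * (B - q3)" "B - A \<le> (1 + \<Lambda>) ^ 3 * (q3 - m)"
    using quarter_gap_bounds[OF o' \<Lambda>_ge_1, unfolded r, OF e1(2,1) e2'(2,1) e3'(1)] .
  have "i = 4 * n \<or> i = 4 * n + 1 \<or> i = 4 * n + 2 \<or> i = 4 * n + 3" using assms by presburger
  moreover have "G (of_int (4 * n) / 4) = A" "G (of_int (4 * n + 1) / 4) = q1" "G (of_int (4 * n + 1 + 1) / 4) = m"
    "G (of_int (4 * n + 2) / 4) = m" "G (of_int (4 * n + 2 + 1) / 4) = q3" "G (of_int (4 * n + 3) / 4) = q3" "G (of_int (4 * n + 3 + 1) / 4) = B"
    by (simp_all add: A_def B_def q1_def q3_def m_def add_divide_distrib add.commute)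
  moreover have "G (of_int (n + 1)) = B" "G (of_int n) = A" by (simp_all add: A_def B_def)
  ultimately show ?thesis using lower upper by auto
qed

end

section \<open>A good position for the base point\<close>

text \<open>A bound on \<open>|p - q * z|\<close> bounds \<open>q\<close> through the imaginary part
  and then \<open>p\<close>, so only finitely many integral vectors compete with
  \<open>(1, 0)\<close>.\<close>

lemma exists_minimal_vector:
  assumes z: "Im z > 0"
  obtains v where "int_vec v" "v \<noteq> 0" "\<And>u. int_vec u \<Longrightarrow> u \<noteq> 0 \<Longrightarrow> cmod (nv v z) \<le> cmod (nv u z)"
proof -
  define F where "F = {v. int_vec v \<and> v \<noteq> 0 \<and> cmod (nv v z) \<le> 1}"
  define m where "m = \<lceil>1 / Im z\<rceil>"
  define l where "l = \<lceil>1 + cmod z / Im z\<rceil>"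
  have "F \<subseteq> real_of_int ` {- l..l} \<times> real_of_int ` {- m..m}"
  proof
    fix v assume "v \<in> F"
    then have v: "int_vec v" "cmod (nv v z) \<le> 1" by (auto simp: F_def)
    obtain p q where pq: "fst v = of_int p" "snd v = of_int q" using v(1) unfolding int_vec_def by (metis Ints_cases)
    have "\<bar>snd v\<bar> * Im z = \<bar>Im (nv v z)\<bar>" using z by (simp add: nv_def abs_mult)
    also have "\<dots> \<le> 1" using abs_Im_le_cmod v(2) order.trans by blast
    finally have q: "\<bar>snd v\<bar> \<le> 1 / Im z" using z by (simp add: field_simps)
    have "\<bar>fst v\<bar> = cmod (nv v z + of_real (snd v) * z)" by (simp add: nv_def)
    also have "\<dots> \<le> 1 + \<bar>snd v\<bar> * cmod z"
      using norm_triangle_ineq[of "nv v z" "of_real (snd v) * z"] v(2) by (simp add: norm_mult)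
    also have "\<dots> \<le> 1 + 1 / Im z * cmod z" using q by (intro add_left_mono mult_right_mono) auto
    finally have p: "\<bar>fst v\<bar> \<le> 1 + cmod z / Im z" by simp
    have "\<bar>real_of_int q\<bar> \<le> of_int m" "\<bar>real_of_int p\<bar> \<le> of_int l"
      using p q pq unfolding m_def l_def by linarith+
    then have "q \<in> {- m..m}" "p \<in> {- l..l}" by (simp_all add: abs_le_iff)
    then show "v \<in> real_of_int ` {- l..l} \<times> real_of_int ` {- m..m}" using pq by (metis image_eqI mem_Times_iff)
  qed
  then have fin: "finite F" by (rule finite_subset) auto
  have e: "(1, 0) \<in> F" by (simp add: F_def int_vec_def nv_def prod_eq_iff)
  then have "F \<noteq> {}" by blast
  then obtain v where v: "v \<in> F" "\<And>u. u \<in> F \<Longrightarrow> cmod (nv v z) \<le> cmod (nv u z)"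
    using arg_min_if_finite[OF fin, of "\<lambda>v. cmod (nv v z)"] by (metis not_le)
  have "cmod (nv v z) \<le> cmod (nv u z)" if "int_vec u" "u \<noteq> 0" for u
  proof (cases "u \<in> F")
    case False
    then have "1 < cmod (nv u z)" using that by (auto simp: F_def)
    then show ?thesis using v(1) by (auto simp: F_def)
  qed (use v in blast)
  moreover have "int_vec v" "v \<noteq> 0" using v(1) by (simp_all add: F_def)
  ultimately show ?thesis using that by blast
qed

lemma nv_nonzero:
  assumes "Im z > 0" "v \<noteq> 0"
  shows "nv v z \<noteq> 0"
proof
  assume "nv v z = 0"
  then have "Im (nv v z) = 0" "Re (nv v z) = 0" by simp_all
  then show False using assms by (auto simp: nv_def prod_eq_iff)
qed

text \<open>\<open>- (nv w z / nv v z)\<close> is the image of \<open>z\<close> under the modular transformation that takes \<open>pt v\<close> to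
  \<open>\<infinity>\<close> and \<open>pt w\<close> to \<open>0\<close>.\<close>

lemma exists_good_basis:
  assumes z: "Im z > 0"
  obtains v w where "int_vec v" "int_vec w" "vdet v w = 1" "(Im (- (nv w z / nv v z)))\<^sup>2 \<ge> 3 / 4"
proof -
  obtain v where v: "int_vec v" "v \<noteq> 0" and min: "\<And>u. int_vec u \<Longrightarrow> u \<noteq> 0 \<Longrightarrow> cmod (nv v z) \<le> cmod (nv u z)"
    using exists_minimal_vector[OF z] by blast
  have nv: "nv v z \<noteq> 0" by (rule nv_nonzero[OF z v(2)])
  obtain p q where pq: "v = (of_int p, of_int q)" using v(1) unfolding int_vec_def by (metis Ints_cases prod.collapse)
  \<comment> \<open>A minimal vector is primitive, since division by a common factor would shorten
    it; this allows completing it to a unimodular basis.\<close>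
  have "gcd p q = 1"
  proof -
    define g where "g = gcd p q"
    have g0: "g > 0" using v(2) pq by (auto simp: g_def prod_eq_iff)
    obtain p' q' where p': "p = g * p'" "q = g * q'" unfolding g_def by (metis dvdE gcd_dvd1 gcd_dvd2)
    have eq: "v = of_int g *\<^sub>R (of_int p', of_int q')" by (simp add: pq p')
    have "(of_int p', of_int q') \<noteq> (0 :: real \<times> real)" using v(2) eq by (metis scaleR_zero_right)
    then have "cmod (nv v z) \<le> cmod (nv (of_int p', of_int q') z)" by (intro min) (auto simp: int_vec_def)
    moreover have "cmod (nv v z) = of_int g * cmod (nv (of_int p', of_int q') z)"
      unfolding eq nv_scale using g0 by (simp add: norm_mult)
    moreover have "cmod (nv v z) > 0" using nv by simp
    ultimately have "of_int g * cmod (nv (of_int p', of_int q') z) \<le> 1 * cmod (nv (of_int p', of_int q') z)"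
      "cmod (nv (of_int p', of_int q') z) > 0" using g0 by (auto simp: zero_less_mult_iff)
    then have "real_of_int g \<le> 1" by (simp only: mult_le_cancel_right_pos)
    then have "g = 1" using g0 by linarith
    then show ?thesis by (simp add: g_def)
  qed
  then obtain x y where xy: "x * p + y * q = 1" using bezout_int[of p q] by metis
  define w where "w = (real_of_int (- y), real_of_int x)"
  have w: "int_vec w" by (simp add: w_def int_vec_def)
  have "vdet v w = of_int (x * p + y * q)" by (simp add: vdet_def pq w_def algebra_simps)
  then have vw: "vdet v w = 1" using xy by simp
  define z' where "z' = - (nv w z / nv v z)"
  \<comment> \<open>Minimality is tested on the fan neighbour closest to \<open>z'\<close>: from
    \<open>|n - z'| >= 1\<close> and \<open>|n - Re z'| <= 1/2\<close> at least 3/4 remains for the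
    square of the imaginary part.\<close>
  define n where "n = round (Re z')"
  have fan: "nv (of_int n *\<^sub>R v + w) z = nv v z * (of_int n - z')"
    unfolding nv_add nv_scale z'_def using nv by (simp add: field_simps)
  have "cmod (nv v z) \<le> cmod (nv (of_int n *\<^sub>R v + w) z)"
    by (rule min) (use v w fan_nonzero[OF vw] in auto)
  then have "cmod (nv v z) * 1 \<le> cmod (nv v z) * cmod (of_int n - z')" unfolding fan norm_mult by simp
  then have "1 \<le> cmod (of_int n - z')" by (rule mult_left_le_imp_le) (use nv in simp)
  then have "1 \<le> (cmod (of_int n - z'))\<^sup>2" by (simp add: one_le_power)
  then have s: "1 \<le> (of_int n - Re z')\<^sup>2 + (Im z')\<^sup>2" unfolding cmod_power2 by simp
  have "\<bar>of_int n - Re z'\<bar> \<le> 1 / 2" unfolding n_def using of_int_round_abs_le[of "Re z'"] by simp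
  then have "(of_int n - Re z')\<^sup>2 \<le> (1 / 2)\<^sup>2" by (metis abs_le_square_iff abs_of_pos half_gt_zero zero_less_one)
  then have "(Im z')\<^sup>2 \<ge> 3 / 4" using s by (simp add: power2_eq_square)
  then show ?thesis using that[OF v(1) w vw] by (simp add: z'_def)
qed

lemma Im_moved_point:
  assumes "vdet v w = 1" "Im z > 0"
  shows "Im (- (nv w z / nv v z)) = Im z / (cmod (nv v z))\<^sup>2"
proof -
  have "Im (- (nv w z / nv v z)) = - Im (nv w z * cnj (nv v z)) / (cmod (nv v z))\<^sup>2"
    by (simp add: Im_divide cmod_power2 diff_divide_distrib)
  also have "- Im (nv w z * cnj (nv v z)) = Im z * vdet v w"
    by (simp add: nv_def vdet_def algebra_simps)
  finally show ?thesis using assms by simp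
qed

section \<open>The separation property\<close>

text \<open>The cost of a window of 60 cells times the cost of passing from a unit cell to a quarter
  cell; the product serves both lattices.\<close>

definition shear_kappa :: "real \<Rightarrow> real" where
  "shear_kappa M = 60 * exp M ^ 60 * (1 + exp M) ^ 3"

lemma shear_kappa_pos: "shear_kappa M > 0"
  by (simp add: shear_kappa_def add_pos_pos)

context normalised_fan
begin

lemma exists_lattice:
  assumes y: "y\<^sup>2 \<ge> 3 / 4" "y > 0"
  obtains d lo hi where "d > 0" "d \<le> 29 / 100 * y" "lo \<le> x - 7 / 2 * y - 2 * d" "x + 7 / 2 * y + 2 * d \<le> hi"
    "\<And>i :: int. lo \<le> of_int i * d \<Longrightarrow> of_int (i + 1) * d \<le> hi \<Longrightarrow>
      G hi - G lo \<le> shear_kappa M * (G (of_int (i + 1) * d) - G (of_int i * d))"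
proof -
  have c1: "1 \<le> (1 + \<Lambda>) ^ 3" using \<Lambda>_ge_1 by (intro one_le_power) simp
  have cover: "of_int (\<lfloor>x / D\<rfloor> - 30) * D \<le> x - 30 * D" "x + 29 * D \<le> of_int (\<lfloor>x / D\<rfloor> + 30) * D" if "D > 0" for D
  proof -
    have "of_int \<lfloor>x / D\<rfloor> * D \<le> x" "x \<le> (of_int \<lfloor>x / D\<rfloor> + 1) * D"
      using floor_divide_lower[OF that, of x] floor_divide_upper[OF that, of x] by simp_all
    then show "of_int (\<lfloor>x / D\<rfloor> - 30) * D \<le> x - 30 * D" "x + 29 * D \<le> of_int (\<lfloor>x / D\<rfloor> + 30) * D"
      by (simp_all add: algebra_simps)
  qed
  show ?thesis
  proof (cases "y \<ge> 100 / 29")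
    \<comment> \<open>At the threshold \<open>29 / 100 * y\<close> reaches 1, so its integer part is
      a possible mesh \<open>j\<close>. From \<open>29 / 100 * y <= j + 1 <= 2 * j\<close> the
      required half-width \<open>7/2 * y + 2 * j\<close> is below \<open>27 * j\<close>, and 29
      cells on either side cover it.\<close>
    case True
    define l where "l = \<lfloor>29 / 100 * y\<rfloor>"
    define j where "j = nat l"
    have "l \<ge> 1" unfolding l_def using True by (simp add: le_floor_iff)
    then have j: "j \<ge> 1" "real j = of_int l" by (simp_all add: j_def)
    have jy: "real j \<le> 29 / 100 * y" "29 / 100 * y \<le> real j + 1" unfolding j(2) l_def by linarith+
    have j1: "real j \<ge> 1" using j(1) by simp
    have jp: "real j > 0" "j > 0" using j(1) by simp_all
    define c where "c = \<lfloor>x / real j\<rfloor>"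
    note cov = cover[OF jp(1), folded c_def]
    show ?thesis
    proof (rule that[of "real j" "of_int (c - 30) * real j" "of_int (c + 30) * real j"])
      show "of_int (c - 30) * real j \<le> x - 7 / 2 * y - 2 * real j" using cov(1) jy j1 by linarith
      show "x + 7 / 2 * y + 2 * real j \<le> of_int (c + 30) * real j" using cov(2) jy j1 by linarith
      fix i :: int assume i: "of_int (c - 30) * real j \<le> of_int i * real j" "of_int (i + 1) * real j \<le> of_int (c + 30) * real j"
      have "real_of_int (c - 30) \<le> of_int i" "real_of_int (i + 1) \<le> of_int (c + 30)"
        using i jp(1) by (simp_all only: mult_le_cancel_right_pos)
      then have "c - 30 \<le> i" "i < c + 30" by linarith+
      then have "G (of_int (c + 30) * real j) - G (of_int (c - 30) * real j) \<le>
          60 * \<Lambda> ^ 60 * (G (of_int (i + 1) * real j) - G (of_int i * real j))" by (rule cell_bound[OF jp(2)])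
      also have "\<dots> \<le> shear_kappa M * (G (of_int (i + 1) * real j) - G (of_int i * real j))"
      proof (rule mult_right_mono)
        show "60 * \<Lambda> ^ 60 \<le> shear_kappa M" unfolding shear_kappa_def using c1 by (simp add: mult_le_cancel_left1)
        show "0 \<le> G (of_int (i + 1) * real j) - G (of_int i * real j)"
          using G_less[of "of_int i * real j" "of_int (i + 1) * real j"] jp(1) by simp
      qed
      finally show "G (of_int (c + 30) * real j) - G (of_int (c - 30) * real j) \<le>
          shear_kappa M * (G (of_int (i + 1) * real j) - G (of_int i * real j))" .
    qed (use jp jy in auto)
  next
    case False
    \<comment> \<open>Here every positive integer is too coarse. Since
      \<open>(25 / 29)^2 < 3/4\<close>, the height is at least 25/29, which is exactly what the mesh
      1/4 requires; as \<open>y < 100 / 29\<close>, a window of 60 unit cells is wide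
      enough.\<close>
    have "25 / 29 \<le> y" by (rule power2_le_imp_le) (use y in \<open>auto simp: power2_eq_square\<close>)
    define c where "c = \<lfloor>x / 1\<rfloor>"
    note cov = cover[of 1, folded c_def]
    show ?thesis
    proof (rule that[of "1 / 4" "of_int (c - 30)" "of_int (c + 30)"])
      show "1 / 4 \<le> 29 / 100 * y" using \<open>25 / 29 \<le> y\<close> by simp
      show "real_of_int (c - 30) \<le> x - 7 / 2 * y - 2 * (1 / 4)" using cov(1) False by simp
      show "x + 7 / 2 * y + 2 * (1 / 4) \<le> real_of_int (c + 30)" using cov(2) False by simp
      fix i :: int assume i: "real_of_int (c - 30) \<le> of_int i * (1 / 4)" "of_int (i + 1) * (1 / 4) \<le> real_of_int (c + 30)"
      define n where "n = i div 4"
      have n: "4 * n \<le> i" "i < 4 * n + 4" unfolding n_def by presburger+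
      have "real_of_int (4 * (c - 30)) \<le> of_int i" "real_of_int (i + 1) \<le> of_int (4 * (c + 30))" using i by simp_all
      then have "4 * (c - 30) \<le> i" "i + 1 \<le> 4 * (c + 30)" by linarith+
      then have nc: "c - 30 \<le> n" "n < c + 30" using n by presburger+
      have "G (of_int (c + 30)) - G (of_int (c - 30)) \<le> 60 * \<Lambda> ^ 60 * (G (of_int (n + 1)) - G (of_int n))"
        using cell_bound[of 1, OF _ nc] by simp
      also have "\<dots> \<le> 60 * \<Lambda> ^ 60 * ((1 + \<Lambda>) ^ 3 * (G (of_int (i + 1) / 4) - G (of_int i / 4)))"
        by (intro mult_left_mono quarter_cell[OF n]) simp
      finally show "G (of_int (c + 30)) - G (of_int (c - 30)) \<le> shear_kappa M * (G (of_int (i + 1) * (1 / 4)) - G (of_int i * (1 / 4)))"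
        by (simp add: shear_kappa_def mult.assoc)
    qed simp
  qed
qed

end

text \<open>The base point is normalised through the basis \<open>v\<close>, \<open>w\<close>, the
  image through \<open>k\<close>. The centred map \<open>f\<close> has mean zero, which supplies the
  far points for \<open>separation_of_lattice\<close>; the bound is uniform in \<open>z\<close> and
  depends on \<open>h\<close> through \<open>M\<close> only.\<close>

lemma separation_of_finite_shear_norm:
  assumes h: "orientation_preserving_homeo h" and M: "shear_norm (shear h) \<le> ereal M"
    and z: "Im z > 0" and bz: "bary (cayley_bdry \<circ> h \<circ> inv cayley_bdry) (cayley z) \<omega>"
    and \<xi>\<eta>: "cmod \<xi> = 1" "cmod \<eta> = 1" "cmod (\<xi> - \<eta>) \<ge> 6 / 5"
  defines "f \<equiv> disk_mob \<omega> \<circ> (cayley_bdry \<circ> h \<circ> inv cayley_bdry) \<circ> disk_mob (- cayley z)"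
  shows "cmod (f \<xi> - f \<eta>) \<ge> 1 / (950 * shear_kappa M ^ 3)"
proof -
  have hccw: "\<And>a b c. ccw a b c \<Longrightarrow> ccw (h a) (h b) (h c)" using h by (simp add: orientation_preserving_homeo_def)
  have g: "circle_map (cayley_bdry \<circ> h \<circ> inv cayley_bdry)" by (rule circle_map_boundary[OF h])
  have cz: "cmod (cayley z) < 1" by (rule cmod_cayley_less_1[OF z])
  have om: "cmod \<omega> < 1" using bz by (simp add: bary_def)
  have f: "circle_map f" unfolding f_def by (rule circle_map_conj[OF g cz om])
  have "bary f 0 0" using bary_conj_iff[OF g cz om cz om] bz by (simp add: f_def)
  then have f0: "circ_int f = 0" by (simp add: bary_def poisson_def circ_int_def)
  obtain v w where basis: "int_vec v" "int_vec w" "vdet v w = 1" and im: "(Im (- (nv w z / nv v z)))\<^sup>2 \<ge> 3 / 4"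
    using exists_good_basis[OF z] by blast
  define z' where "z' = - (nv w z / nv v z)"
  have nz: "v \<noteq> 0" using vdet_nonzero[of v w] basis by auto
  have nv0: "nv v z \<noteq> 0" by (rule nv_nonzero[OF z nz])
  have z': "Im z' = Im z / (cmod (nv v z))\<^sup>2" "Im z' > 0"
    using Im_moved_point[OF basis(3) z] z nv0 by (simp_all add: z'_def)
  define X where "X a = pt (a *\<^sub>R v + w)" for a
  obtain k where k: "\<And>a b c. ccw a b c \<Longrightarrow> ccw (k a) (k b) (k c)" "k (pt v) = None"
    "\<And>a b. cmod (cayley_bdry (k a) - cayley_bdry (k b)) = cmod (disk_mob \<omega> (cayley_bdry (h a)) - disk_mob \<omega> (cayley_bdry (h b)))"
    "\<And>a b c d. ccw4 a b c d \<Longrightarrow> cross_ratio (k a) (k b) (k c) (k d) = cross_ratio (h a) (h b) (h c) (h d)"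
    using normalised_boundary_map[where h = h and w = \<omega> and p = "pt v"] hccw om by blast
  define G where "G a = the (k (X a))" for a
  have Xv: "vdet (c *\<^sub>R v + w) v = - 1" for c
    using vdet_fan(1)[OF basis(3), of c] vdet_swap[of "c *\<^sub>R v + w" v] by simp
  have ccwX: "ccw (pt v) (X a) (X b)" if "a < b" for a b
    unfolding X_def ccw_pt_iff[OF nz fan_nonzero[OF basis(3)] fan_nonzero[OF basis(3)]]
      Xv vdet_fan(2)[OF basis(3)]
    using that by simp
  have kX: "k (X a) = Some (G a)" for a
  proof -
    have "ccw None (k (X a)) (k (X (a + 1)))" using k(1)[OF ccwX[of a "a + 1"]] k(2) by simp
    then show ?thesis by (cases "k (X a)") (auto simp: G_def)
  qed
  have G_mono: "strict_mono G"
  proof (rule strict_monoI)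
    fix a b :: real assume "a < b"
    from k(1)[OF ccwX[OF this]] show "G a < G b" by (simp add: k(2) kX)
  qed
  interpret normalised_fan h k v w G M
  proof
    fix v w m n assume "int_vec v" "int_vec w" "vdet v w = 1"
    from order.trans[OF fan_ratio_le_shear_norm[OF this] M]
    show "\<bar>ln (fan_ratio (\<lambda>n. shear h (geod (pt v) (pt (of_int n *\<^sub>R v + w)))) m n)\<bar> \<le> M" by simp
  qed (use basis k kX G_mono in \<open>auto simp: X_def\<close>)
  \<comment> \<open>In the fan coordinate \<open>a\<close> the base point reads \<open>z'\<close>:
    by \<open>fan\<close> the factor \<open>nv v z\<close> splits off from every linear form, and it
    turns \<open>Im z\<close> into \<open>Im z'\<close> in the visual distances.\<close>
  define P where "P a = disk_mob (cayley z) (cayley_bdry (X a))" for a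
  define Q where "Q = disk_mob (cayley z) (cayley_bdry (pt v))"
  have fmob: "f (disk_mob (cayley z) (cayley_bdry r)) = disk_mob \<omega> (cayley_bdry (h r))" for r
    unfolding f_def using disk_mob_inverse[OF cz, of "cayley_bdry r"] by (simp add: inv_cayley_bdry(1) del: cayley_bdry.simps)
  have fan: "nv (a *\<^sub>R v + w) z = nv v z * (of_real a - z')" for a
    unfolding nv_add nv_scale z'_def using nv0 by (simp add: field_simps)
  have \<kappa>: "shear_kappa M \<ge> 1"
  proof -
    have "1 \<le> \<Lambda> ^ 60" "1 \<le> (1 + \<Lambda>) ^ 3" using \<Lambda>_ge_1 by (intro one_le_power; simp)+
    then have "1 * 1 \<le> (60 * \<Lambda> ^ 60) * (1 + \<Lambda>) ^ 3" by (intro mult_mono) auto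
    then show ?thesis by (simp add: shear_kappa_def)
  qed
  obtain d lo hi where d: "d > 0" "d \<le> 29 / 100 * Im z'" "lo \<le> Re z' - 7 / 2 * Im z' - 2 * d" "Re z' + 7 / 2 * Im z' + 2 * d \<le> hi"
    "\<And>i :: int. lo \<le> of_int i * d \<Longrightarrow> of_int (i + 1) * d \<le> hi \<Longrightarrow>
      G hi - G lo \<le> shear_kappa M * (G (of_int (i + 1) * d) - G (of_int i * d))"
    using exists_lattice[of "Im z'" "Re z'"] im z'(2) unfolding z'_def[symmetric] by blast
  show ?thesis
  proof (rule separation_of_lattice[where P = P and Q = Q and G = G and z = z' and f = f, OF z'(2) _ _ _ _ _ G_mono _ _ _ _ d(1-4) \<kappa> d(5) \<xi>\<eta>])
    show "cmod (P a) = 1" for a unfolding P_def by (rule disk_mob_unit[OF cz cmod_cayley_bdry])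
    show "cmod Q = 1" unfolding Q_def by (rule disk_mob_unit[OF cz cmod_cayley_bdry])
    show "\<zeta> = Q \<or> (\<exists>a. \<zeta> = P a)" if u: "cmod \<zeta> = 1" for \<zeta>
    proof -
      have cz': "cmod (- cayley z) < 1" using cz by simp
      obtain r where r: "cayley_bdry r = disk_mob (- cayley z) \<zeta>"
        using cayley_bdry_surj[OF disk_mob_unit[OF cz' u]] by blast
      then have zr: "\<zeta> = disk_mob (cayley z) (cayley_bdry r)" using disk_mob_inverse'[OF cz, of \<zeta>] u by simp
      define x where "x = vdet (hom_coord r) w"
      define y where "y = vdet v (hom_coord r)"
      have e: "hom_coord r = x *\<^sub>R v + y *\<^sub>R w" unfolding x_def y_def by (rule vec_expand[OF basis(3)])
      show ?thesis
      proof (cases "y = 0")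
        case True
        then have "x \<noteq> 0" "hom_coord r = x *\<^sub>R v" using e hom_coord_nonzero[of r] by auto
        then have "r = pt v" using pt_scale[of x v] pt_hom_coord[of r] by simp
        then show ?thesis using zr by (simp add: Q_def)
      next
        case False
        have "hom_coord r = y *\<^sub>R ((x / y) *\<^sub>R v + w)" using e False by (simp add: scaleR_add_right)
        then have "r = X (x / y)" using pt_scale[OF False] pt_hom_coord[of r] by (simp add: X_def)
        then show ?thesis using zr by (auto simp: P_def)
      qed
    qed
    show "cmod (P a - P b) = 2 * Im z' * \<bar>a - b\<bar> / (cmod (of_real a - z') * cmod (of_real b - z'))" for a b
      unfolding P_def X_def visual_distance[OF z fan_nonzero[OF basis(3)] fan_nonzero[OF basis(3)]] fan vdet_fan(2)[OF basis(3)] norm_mult z'(1)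
      by (simp add: power2_eq_square)
    show "cmod (P a - Q) = 2 * Im z' / cmod (of_real a - z')" for a
    proof -
      have "\<bar>vdet (a *\<^sub>R v + w) v\<bar> = 1" using vdet_fan(1)[OF basis(3), of a] vdet_swap[of "a *\<^sub>R v + w" v] by simp
      then show ?thesis
        unfolding P_def Q_def X_def visual_distance[OF z fan_nonzero[OF basis(3)] nz] fan norm_mult z'(1)
        by (simp add: power2_eq_square)
    qed
    show "cmod (f \<zeta>) = 1" if "cmod \<zeta> = 1" for \<zeta> using circle_map_unit[OF f that] .
    show "cmod (f (P a) - f (P b)) = 2 * \<bar>G a - G b\<bar> / (sqrt (1 + (G a)\<^sup>2) * sqrt (1 + (G b)\<^sup>2))" for a b
      unfolding P_def fmob k(3)[symmetric] kX by (rule dist_cayley_bdry_Some)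
    show "cmod (f (P a) - f Q) = 2 / sqrt (1 + (G a)\<^sup>2)" for a
      unfolding P_def Q_def fmob k(3)[symmetric] kX k(2) by (rule dist_cayley_bdry_None)
    show "\<exists>\<eta>. cmod \<eta> = 1 \<and> cmod (\<eta> - \<zeta>) \<ge> 6 / 5 \<and> (cmod (f \<eta> - \<alpha>))\<^sup>2 > 1 / 2"
      if "cmod \<zeta> = 1" "cmod \<alpha> = 1" for \<zeta> \<alpha>
      using exists_far_point[OF circle_map_cont[OF f] circle_map_unit[OF f] that(2) _ that(1)] f0 by (metis mult_zero_left order_refl zero_complex.sel(1))
  qed
qed

section \<open>The dilatation of the extension\<close>

text \<open>The Cayley transform and its inverse \<open>C\<close> are holomorphic, so the chain rule
  multiplies the two coefficients by numbers of equal modulus.\<close>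

lemma de_ext_has_derivative:
  assumes z: "Im z > 0" and g: "circle_map (cayley_bdry \<circ> h \<circ> inv cayley_bdry)"
    and d: "(de_disk (cayley_bdry \<circ> h \<circ> inv cayley_bdry) has_derivative (\<lambda>l. A * l + B * cnj l)) (at (cayley z))"
  obtains S T where "S \<noteq> 0" "T \<noteq> 0" "(de_ext h has_derivative (\<lambda>l. (S * A * T) * l + (S * B * cnj T) * cnj l)) (at z)"
proof -
  let ?e = "de_disk (cayley_bdry \<circ> h \<circ> inv cayley_bdry)"
  define C where "C y = \<i> * (1 - y) / (1 + y)" for y :: complex
  have e1: "cmod (?e y) < 1" if "cmod y < 1" for y
    using bary_exists[OF g that] de_disk_eq[OF g that] by (metis bary_def)
  have cz: "cmod (cayley z) < 1" by (rule cmod_cayley_less_1[OF z])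
  have zi: "z + \<i> \<noteq> 0" using z by (auto simp: complex_eq_iff)
  define T where "T = - 2 * \<i> / (z + \<i>)\<^sup>2"
  have "(cayley has_field_derivative - ((1 * (z + \<i>) - (z - \<i>) * 1) / ((z + \<i>) * (z + \<i>)))) (at z)"
    unfolding cayley_def by (rule derivative_eq_intros refl | use zi in simp)+
  moreover have "- ((1 * (z + \<i>) - (z - \<i>) * 1) / ((z + \<i>) * (z + \<i>))) = T" by (simp add: T_def power2_eq_square)
  ultimately have dT: "(cayley has_derivative (*) T) (at z)" by (simp add: has_field_derivative_def)
  define y where "y = ?e (cayley z)"
  have "cmod y < 1" using e1[OF cz] by (simp add: y_def)
  then have n: "1 + y \<noteq> 0" by (metis add.commute add_eq_0_iff norm_minus_cancel norm_one less_irrefl)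
  define S where "S = - 2 * \<i> / (1 + y)\<^sup>2"
  have "(C has_field_derivative ((\<i> * (0 - 1)) * (1 + y) - (\<i> * (1 - y)) * 1) / ((1 + y) * (1 + y))) (at y)"
    unfolding C_def by (rule derivative_eq_intros refl | use n in simp)+
  moreover have "((\<i> * (0 - 1)) * (1 + y) - (\<i> * (1 - y)) * 1) / ((1 + y) * (1 + y)) = S"
    by (simp add: S_def power2_eq_square algebra_simps)
  ultimately have dS: "(C has_derivative (*) S) (at (?e (cayley z)))" by (simp add: has_field_derivative_def y_def)
  have "(C \<circ> (?e \<circ> cayley) has_derivative ((*) S \<circ> ((\<lambda>l. A * l + B * cnj l) \<circ> (*) T))) (at z)"
    by (intro diff_chain_at dT d) (use dS in simp)
  moreover have "((*) S \<circ> ((\<lambda>l. A * l + B * cnj l) \<circ> (*) T)) = (\<lambda>l. (S * A * T) * l + (S * B * cnj T) * cnj l)"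
    by (auto simp: algebra_simps)
  moreover have "(C \<circ> (?e \<circ> cayley)) x = de_ext h x" if "x \<in> {x. Im x > 0}" for x
  proof -
    let ?y = "?e (cayley x)"
    have y: "cmod ?y < 1" using e1 cmod_cayley_less_1 that by simp
    have "inj_on cayley UHP" by (rule inj_onI) (metis UHP_def cayley_inverse mem_Collect_eq)
    then have "inv_into UHP cayley ?y = C ?y"
      using cayley_surj[OF y] by (intro inv_into_f_eq) (auto simp: C_def UHP_def)
    then show ?thesis by (simp add: de_ext_def)
  qed
  moreover have "open {x. Im x > 0}" by (intro open_Collect_less continuous_intros)
  ultimately have "(de_ext h has_derivative (\<lambda>l. (S * A * T) * l + (S * B * cnj T) * cnj l)) (at z)"
    using has_derivative_transform_within_open[of "C \<circ> (?e \<circ> cayley)" _ z UNIV "{x. Im x > 0}" "de_ext h"] z by simp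
  moreover have "S \<noteq> 0" "T \<noteq> 0" using n zi by (simp_all add: S_def T_def)
  ultimately show ?thesis using that by blast
qed

lemma d_z_d_zbar_eq:
  assumes "(f has_derivative (\<lambda>l. A * l + B * cnj l)) (at z)"
  shows "d_z f z = A" "d_zbar f z = B"
  unfolding d_z_def d_zbar_def frechet_derivative_at[OF assms, symmetric] by (simp_all add: algebra_simps)

theorem theorem3:
  shows "\<exists>C :: real \<Rightarrow> real. (\<forall>x\<ge>0. 0 < C x) \<and>
    (\<forall>h :: rhat \<Rightarrow> rhat. orientation_preserving_homeo h \<and> shear_norm (shear h) < \<infinity> \<longrightarrow>
       max_dilatation (de_ext h) < ereal (C (real_of_ereal (shear_norm (shear h)))))"
proof -
  define \<delta> where "\<delta> M = 1 / (950 * shear_kappa M ^ 3)" for M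
  \<comment> \<open>The summand 1 makes the final inequality strict.\<close>
  define C where "C M = 12288 / \<delta> M ^ 5 + 1" for M
  have \<delta>: "\<delta> M > 0" for M using shear_kappa_pos[of M] by (simp add: \<delta>_def)
  have "0 < C x" for x using \<delta>[of x] by (simp add: C_def add_pos_pos)
  moreover have "max_dilatation (de_ext h) < ereal (C (real_of_ereal (shear_norm (shear h))))"
    if h: "orientation_preserving_homeo h" and fin: "shear_norm (shear h) < \<infinity>" for h
  proof -
    let ?g = "cayley_bdry \<circ> h \<circ> inv cayley_bdry"
    define M where "M = real_of_ereal (shear_norm (shear h))"
    \<comment> \<open>The case split also meets minus infinity, which \<open>real_of_ereal\<close>
      turns into 0.\<close>
    have M: "shear_norm (shear h) \<le> ereal M"
      using fin unfolding M_def by (cases "shear_norm (shear h)") auto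
    have g: "circle_map ?g" by (rule circle_map_boundary[OF h])
    have "max_dilatation (de_ext h) \<le> ereal (12288 / \<delta> M ^ 5)"
      unfolding max_dilatation_def
    proof (rule SUP_least)
      fix z assume "z \<in> UHP"
      then have z: "Im z > 0" by (simp add: UHP_def)
      have cz: "cmod (cayley z) < 1" by (rule cmod_cayley_less_1[OF z])
      obtain \<omega> where b: "bary ?g (cayley z) \<omega>" using bary_exists[OF g cz] .
      obtain A B where AB: "(de_disk ?g has_derivative (\<lambda>l. A * l + B * cnj l)) (at (cayley z))"
        "cmod B < cmod A" "(cmod A + cmod B) / (cmod A - cmod B) \<le> 12288 / \<delta> M ^ 5"
        using de_disk_has_derivative[OF g cz b \<delta>[of M] separation_of_finite_shear_norm[OF h M z b, folded \<delta>_def]] .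
      obtain S T where ST: "S \<noteq> 0" "T \<noteq> 0"
        "(de_ext h has_derivative (\<lambda>l. (S * A * T) * l + (S * B * cnj T) * cnj l)) (at z)"
        using de_ext_has_derivative[OF z g AB(1)] .
      note dz = d_z_d_zbar_eq[OF ST(3)]
      have diff: "de_ext h differentiable (at z)" unfolding differentiable_def using ST(3) by blast
      define c where "c = cmod S * cmod T"
      have c: "c > 0" using ST by (simp add: c_def)
      have n: "cmod (S * A * T) = c * cmod A" "cmod (S * B * cnj T) = c * cmod B" by (simp_all add: c_def norm_mult)
      have lt: "cmod (d_zbar (de_ext h) z) < cmod (d_z (de_ext h) z)" unfolding dz n using AB(2) c by simp
      have "cmod (beltrami (de_ext h) z) = cmod B / cmod A"
        unfolding beltrami_def norm_divide dz n using c by simp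
      moreover have A0: "cmod A > 0" using AB(2) by (meson norm_ge_zero order.strict_trans1)
      moreover have "(1 + b / a) / (1 - b / a) = (a + b) / (a - b)" if "0 < a" "b < a" for a b :: real
        using that by (simp add: divide_simps)
      ultimately have "(1 + cmod (beltrami (de_ext h) z)) / (1 - cmod (beltrami (de_ext h) z)) = (cmod A + cmod B) / (cmod A - cmod B)"
        using AB(2) by simp
      then show "(if de_ext h differentiable (at z) \<and> cmod (d_zbar (de_ext h) z) < cmod (d_z (de_ext h) z)
        then ereal ((1 + cmod (beltrami (de_ext h) z)) / (1 - cmod (beltrami (de_ext h) z))) else \<infinity>) \<le> ereal (12288 / \<delta> M ^ 5)"
        using diff lt AB(3) by simp
    qed
    also have "\<dots> < ereal (C M)" by (simp add: C_def)
    finally show ?thesis by (simp add: M_def)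
  qed
  ultimately show ?thesis by blast
qed

end
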